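(* Let $(\bar M^{4m},\bar g)$, $m\ge 2$, be a quaternion-Kähler manifold (not assumed to be complete) of non-vanishing scalar curvature. Then $\bar M$ does not admit any extrinsic hypersphere.
   Context: A quaternion-Kähler manifold is a Riemannian manifold of dimension $4m$, $m\ge 2$, whose restricted holonomy group is contained in $\mathrm{Sp}(m)\cdot\mathrm{Sp}(1)\subset\mathrm{SO}(4m)$. For a hypersurface $M\subset\bar M$ with induced metric $g$, the second fundamental form is $\mathrm{II}(X,Y)=\bar\nabla_XY-\nabla_XY$ for $X,Y$ tangent to $M$, where $\bar\nabla$ and $\nabla$ are the Levi-Civita connections of $\bar g$ and $g$. An extrinsic hypersphere of $(\bar M,\bar g)$ is a hypersurface $M\subset\bar M$ which is complete with respect to the induced metric $g$ and satisfies $\mathrm{II}(X,Y)=\lambda\, g(X,Y)\,N$ for all $X,Y$ tangent to $M$, for some real constant $\lambda\neq 0$ and a unit length normal vector field $N$ along $M$. Manifolds are connected. *)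

theory Defs
  imports "HOL-Analysis.Analysis"
begin

section \<open>Smooth functions\<close>

primrec Ck_on :: "nat \<Rightarrow> 'e::real_normed_vector set \<Rightarrow> ('e \<Rightarrow> 'b::real_normed_vector) \<Rightarrow> bool" where
  "Ck_on 0 W f \<longleftrightarrow> continuous_on W f"
| "Ck_on (Suc k) W f \<longleftrightarrow> (\<forall>x\<in>W. f differentiable (at x)) \<and>
     (\<forall>v. Ck_on k W (\<lambda>x. frechet_derivative f (at x) v))"

text \<open>On a set that need not be open, a smooth function is one that locally extends to a
  \<open>C\<^sup>\<infinity>\<close> function on an open set. Non-open sets only occur below as domains of pieces of curves.\<close>

definition smooth_on :: "'e::real_normed_vector set \<Rightarrow> ('e \<Rightarrow> 'b::real_normed_vector) \<Rightarrow> bool" where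
  "smooth_on S f \<longleftrightarrow>
     (\<forall>x\<in>S. \<exists>W h. open W \<and> x \<in> W \<and> (\<forall>k. Ck_on k W h) \<and> (\<forall>y\<in>S \<inter> W. h y = f y))"


section \<open>Smooth manifolds\<close>

text \<open>A chart is a pair of its domain and its coordinate map; the values of the coordinate map
  outside the domain are irrelevant. A manifold is modelled on a Euclidean space
  \<open>'e\<close>, so that its dimension is \<open>DIM('e)\<close>.\<close>

type_synonym ('a, 'e) chart = "'a set \<times> ('a \<Rightarrow> 'e)"

record ('a, 'e) manifold =
  mtop :: "'a topology"
  atlas :: "('a, 'e) chart set"

abbreviation points :: "('a, 'e) manifold \<Rightarrow> 'a set" where
  "points M \<equiv> topspace (mtop M)"

definition cinv :: "('a, 'e) chart \<Rightarrow> 'e \<Rightarrow> 'a" where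
  "cinv c = inv_into (fst c) (snd c)"

definition smooth_manifold :: "('a, 'e::euclidean_space) manifold \<Rightarrow> bool" where
  "smooth_manifold M \<longleftrightarrow>
     Hausdorff_space (mtop M) \<and> second_countable (mtop M) \<and>
     connected_space (mtop M) \<and> points M \<noteq> {} \<and>
     points M = (\<Union>c\<in>atlas M. fst c) \<and>
     (\<forall>c\<in>atlas M. openin (mtop M) (fst c) \<and> open (snd c ` fst c) \<and>
        homeomorphic_map (subtopology (mtop M) (fst c)) (top_of_set (snd c ` fst c)) (snd c)) \<and>
     (\<forall>c\<in>atlas M. \<forall>c'\<in>atlas M. smooth_on (snd c ` (fst c \<inter> fst c')) (snd c' \<circ> cinv c))"

definition charts_at :: "('a, 'e) manifold \<Rightarrow> 'a \<Rightarrow> ('a, 'e) chart set" where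
  "charts_at M p = {c \<in> atlas M. p \<in> fst c}"

text \<open>Used only where the result does not depend on the chart.\<close>

definition chart_at :: "('a, 'e) manifold \<Rightarrow> 'a \<Rightarrow> ('a, 'e) chart" where
  "chart_at M p = (SOME c. c \<in> charts_at M p)"

definition smooth_map ::
  "('a, 'e::euclidean_space) manifold \<Rightarrow> ('b, 'f::euclidean_space) manifold \<Rightarrow> ('a \<Rightarrow> 'b) \<Rightarrow> bool" where
  "smooth_map M N f \<longleftrightarrow> continuous_map (mtop M) (mtop N) f \<and>
     (\<forall>c\<in>atlas M. \<forall>d\<in>atlas N. smooth_on (snd c ` (fst c \<inter> f -` fst d)) (snd d \<circ> f \<circ> cinv c))"


section \<open>Tangent vectors\<close>

text \<open>A tangent vector at \<open>p\<close> is the family of its coordinate vectors with respect to all charts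
  around \<open>p\<close>, transforming by the derivatives of the coordinate changes, and extended by \<open>0\<close>
  to all other pairs. Linear combinations are formed chart by chart.\<close>

type_synonym ('a, 'e) tvec = "('a, 'e) chart \<Rightarrow> 'e"

definition tangent_space :: "('a, 'e::euclidean_space) manifold \<Rightarrow> 'a \<Rightarrow> ('a, 'e) tvec set" where
  "tangent_space M p = {v.
     (\<forall>c\<in>charts_at M p. \<forall>c'\<in>charts_at M p.
        v c' = frechet_derivative (snd c' \<circ> cinv c) (at (snd c p)) (v c)) \<and>
     (\<forall>c. c \<notin> charts_at M p \<longrightarrow> v c = 0)}"

text \<open>The tangent vector at \<open>p\<close> whose coordinate vector in the chart \<open>c\<close> is \<open>u\<close>.\<close>

definition mk_tvec ::
  "('a, 'e::euclidean_space) manifold \<Rightarrow> ('a, 'e) chart \<Rightarrow> 'a \<Rightarrow> 'e \<Rightarrow> ('a, 'e) tvec" where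
  "mk_tvec M c p u = (\<lambda>c'. if c' \<in> charts_at M p
     then frechet_derivative (snd c' \<circ> cinv c) (at (snd c p)) u else 0)"

text \<open>The derivative \<open>v(F)\<close> of a vector-valued function defined near \<open>p\<close> along \<open>v\<close> in the
  tangent space at \<open>p\<close>.\<close>

definition vderiv :: "('a, 'e::euclidean_space) manifold \<Rightarrow> 'a \<Rightarrow> ('a, 'e) tvec \<Rightarrow>
    ('a \<Rightarrow> 'b::real_normed_vector) \<Rightarrow> 'b" where
  "vderiv M p v F = (let c = chart_at M p in
     frechet_derivative (F \<circ> cinv c) (at (snd c p)) (v c))"

definition pushforward :: "('a, 'e::euclidean_space) manifold \<Rightarrow> ('b, 'f::euclidean_space) manifold \<Rightarrow>
    ('a \<Rightarrow> 'b) \<Rightarrow> 'a \<Rightarrow> ('a, 'e) tvec \<Rightarrow> ('b, 'f) tvec" where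
  "pushforward M N f p v =
     (\<lambda>d. if d \<in> charts_at N (f p) then vderiv M p v (snd d \<circ> f) else 0)"

definition smooth_field_along :: "('a, 'e::euclidean_space) manifold \<Rightarrow> ('b, 'f::euclidean_space) manifold \<Rightarrow>
    ('a \<Rightarrow> 'b) \<Rightarrow> ('a \<Rightarrow> ('b, 'f) tvec) \<Rightarrow> bool" where
  "smooth_field_along M N f W \<longleftrightarrow>
     (\<forall>p\<in>points M. W p \<in> tangent_space N (f p)) \<and>
     (\<forall>c\<in>atlas M. \<forall>d\<in>atlas N.
        smooth_on (snd c ` (fst c \<inter> f -` fst d)) (\<lambda>x. W (cinv c x) d))"

abbreviation smooth_field :: "('a, 'e::euclidean_space) manifold \<Rightarrow> ('a \<Rightarrow> ('a, 'e) tvec) \<Rightarrow> bool" where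
  "smooth_field M X \<equiv> smooth_field_along M M id X"


section \<open>Riemannian metrics and the Levi-Civita connection\<close>

type_synonym ('a, 'e) metric_tensor = "'a \<Rightarrow> ('a, 'e) tvec \<Rightarrow> ('a, 'e) tvec \<Rightarrow> real"

definition local_metric :: "('a, 'e::euclidean_space) manifold \<Rightarrow> ('a, 'e) metric_tensor \<Rightarrow>
    ('a, 'e) chart \<Rightarrow> 'e \<Rightarrow> 'e \<Rightarrow> 'e \<Rightarrow> real" where
  "local_metric M g c x v w =
     (let p = cinv c x in g p (mk_tvec M c p v) (mk_tvec M c p w))"

definition riemannian_metric :: "('a, 'e::euclidean_space) manifold \<Rightarrow> ('a, 'e) metric_tensor \<Rightarrow> bool" where
  "riemannian_metric M g \<longleftrightarrow>
     (\<forall>c\<in>atlas M.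
        (\<forall>x\<in>snd c ` fst c. bilinear (local_metric M g c x) \<and>
           (\<forall>v w. local_metric M g c x v w = local_metric M g c x w v) \<and>
           (\<forall>v. v \<noteq> 0 \<longrightarrow> local_metric M g c x v v > 0)) \<and>
        (\<forall>v w. smooth_on (snd c ` fst c) (\<lambda>x. local_metric M g c x v w)))"

text \<open>The connection form of the Levi-Civita connection in a chart, characterised as the unique
  symmetric (torsion-free) one for which the metric is parallel. Its components with respect to
  the standard basis are the Christoffel symbols.\<close>

definition christoffel :: "('a, 'e::euclidean_space) manifold \<Rightarrow> ('a, 'e) metric_tensor \<Rightarrow>
    ('a, 'e) chart \<Rightarrow> 'e \<Rightarrow> 'e \<Rightarrow> 'e \<Rightarrow> 'e" where
  "christoffel M g c x = (THE \<Gamma>. bilinear \<Gamma> \<and> (\<forall>u v. \<Gamma> u v = \<Gamma> v u) \<and>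
     (\<forall>u v w. frechet_derivative (\<lambda>y. local_metric M g c y v w) (at x) u =
        local_metric M g c x (\<Gamma> u v) w + local_metric M g c x v (\<Gamma> u w)))"

text \<open>The covariant derivative at \<open>p\<close>, in direction \<open>v\<close> tangent to \<open>M\<close>, of a vector field \<open>W\<close>
  along a smooth map \<open>f\<close> from \<open>M\<close> to the Riemannian manifold \<open>(N, h)\<close>. For \<open>f = id\<close> this is the
  Levi-Civita connection itself.\<close>

definition cov_deriv_along :: "('a, 'e::euclidean_space) manifold \<Rightarrow> ('b, 'f::euclidean_space) manifold \<Rightarrow>
    ('b, 'f) metric_tensor \<Rightarrow> ('a \<Rightarrow> 'b) \<Rightarrow> ('a \<Rightarrow> ('b, 'f) tvec) \<Rightarrow> 'a \<Rightarrow> ('a, 'e) tvec \<Rightarrow>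
    ('b, 'f) tvec" where
  "cov_deriv_along M N h f W p v = (\<lambda>d. if d \<in> charts_at N (f p)
     then vderiv M p v (\<lambda>q. W q d) +
       christoffel N h d (snd d (f p)) (pushforward M N f p v d) (W p d)
     else 0)"

abbreviation levi_civita :: "('a, 'e::euclidean_space) manifold \<Rightarrow> ('a, 'e) metric_tensor \<Rightarrow>
    ('a \<Rightarrow> ('a, 'e) tvec) \<Rightarrow> ('a \<Rightarrow> ('a, 'e) tvec) \<Rightarrow> 'a \<Rightarrow> ('a, 'e) tvec" where
  "levi_civita M g X Y p \<equiv> cov_deriv_along M M g id Y p (X p)"


section \<open>Curvature\<close>

text \<open>Convention: \<open>R(X,Y)Z = \<nabla>\<^sub>X \<nabla>\<^sub>Y Z - \<nabla>\<^sub>Y \<nabla>\<^sub>X Z - \<nabla>\<^bsub>[X,Y]\<^esub> Z\<close>,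
  written here for coordinate fields, whose bracket vanishes.\<close>

definition curvature :: "('a, 'e::euclidean_space) manifold \<Rightarrow> ('a, 'e) metric_tensor \<Rightarrow>
    ('a, 'e) chart \<Rightarrow> 'e \<Rightarrow> 'e \<Rightarrow> 'e \<Rightarrow> 'e \<Rightarrow> 'e" where
  "curvature M g c x u v w = (let \<Gamma> = christoffel M g c in
     frechet_derivative (\<lambda>y. \<Gamma> y v w) (at x) u - frechet_derivative (\<lambda>y. \<Gamma> y u w) (at x) v
     + \<Gamma> x u (\<Gamma> x v w) - \<Gamma> x v (\<Gamma> x u w))"

text \<open>The double trace of the curvature tensor in a \<open>g\<close>-orthonormal basis of the tangent space;
  it depends neither on the basis nor on the chart. The sign makes it positive on round spheres.\<close>

definition scalar_curvature :: "('a, 'e::euclidean_space) manifold \<Rightarrow> ('a, 'e) metric_tensor \<Rightarrow> 'a \<Rightarrow> real" where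
  "scalar_curvature M g p = (let c = chart_at M p; x = snd c p;
       e = (SOME e :: 'e \<Rightarrow> 'e. \<forall>i\<in>Basis. \<forall>j\<in>Basis.
              local_metric M g c x (e i) (e j) = (if i = j then 1 else 0))
     in \<Sum>i\<in>Basis. \<Sum>j\<in>Basis. local_metric M g c x (curvature M g c x (e i) (e j) (e j)) (e i))"


section \<open>Curves, distance and completeness\<close>

definition pw_smooth_curve :: "('a, 'e::euclidean_space) manifold \<Rightarrow> (real \<Rightarrow> 'a) \<Rightarrow> bool" where
  "pw_smooth_curve M \<gamma> \<longleftrightarrow> continuous_map (top_of_set {0..1}) (mtop M) \<gamma> \<and>
     (\<exists>S. finite S \<and> (\<forall>a b. 0 \<le> a \<and> a < b \<and> b \<le> 1 \<and> {a<..<b} \<inter> S = {} \<longrightarrow>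
        (\<forall>c\<in>atlas M. smooth_on {t \<in> {a..b}. \<gamma> t \<in> fst c} (snd c \<circ> \<gamma>))))"

definition velocity :: "('a, 'e::euclidean_space) manifold \<Rightarrow> (real \<Rightarrow> 'a) \<Rightarrow> real \<Rightarrow> ('a, 'e) tvec" where
  "velocity M \<gamma> t = (\<lambda>c. if c \<in> charts_at M (\<gamma> t)
     then vector_derivative (snd c \<circ> \<gamma>) (at t) else 0)"

definition curve_length :: "('a, 'e::euclidean_space) manifold \<Rightarrow> ('a, 'e) metric_tensor \<Rightarrow> (real \<Rightarrow> 'a) \<Rightarrow> real" where
  "curve_length M g \<gamma> =
     integral {0..1} (\<lambda>t. sqrt (g (\<gamma> t) (velocity M \<gamma> t) (velocity M \<gamma> t)))"

text \<open>The value \<open>0\<close> off the manifold makes this an instance of the locale \<open>Metric_space\<close>,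
  which requires nonnegativity everywhere.\<close>

definition riem_dist :: "('a, 'e::euclidean_space) manifold \<Rightarrow> ('a, 'e) metric_tensor \<Rightarrow> 'a \<Rightarrow> 'a \<Rightarrow> real" where
  "riem_dist M g p q = (if p \<in> points M \<and> q \<in> points M
     then Inf {curve_length M g \<gamma> | \<gamma>. pw_smooth_curve M \<gamma> \<and> \<gamma> 0 = p \<and> \<gamma> 1 = q} else 0)"

definition complete_manifold :: "('a, 'e::euclidean_space) manifold \<Rightarrow> ('a, 'e) metric_tensor \<Rightarrow> bool" where
  "complete_manifold M g \<longleftrightarrow> Metric_space.mcomplete (points M) (riem_dist M g)"


section \<open>Restricted holonomy and quaternion-Kaehler manifolds\<close>

definition parallel_along :: "('a, 'e::euclidean_space) manifold \<Rightarrow> ('a, 'e) metric_tensor \<Rightarrow>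
    (real \<Rightarrow> 'a) \<Rightarrow> (real \<Rightarrow> ('a, 'e) tvec) \<Rightarrow> bool" where
  "parallel_along M g \<gamma> V \<longleftrightarrow>
     (\<forall>t\<in>{0..1}. V t \<in> tangent_space M (\<gamma> t)) \<and>
     (\<forall>c\<in>atlas M. continuous_on {t \<in> {0..1}. \<gamma> t \<in> fst c} (\<lambda>t. V t c)) \<and>
     (\<exists>S. finite S \<and> (\<forall>t\<in>{0<..<1} - S. \<forall>c\<in>charts_at M (\<gamma> t).
        ((\<lambda>s. V s c) has_vector_derivative
           - christoffel M g c (snd c (\<gamma> t)) (velocity M \<gamma> t c) (V t c)) (at t)))"

definition null_homotopic_loop :: "'a topology \<Rightarrow> 'a \<Rightarrow> (real \<Rightarrow> 'a) \<Rightarrow> bool" where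
  "null_homotopic_loop X p \<gamma> \<longleftrightarrow>
     homotopic_with (\<lambda>\<eta>. \<eta> 0 = p \<and> \<eta> 1 = p) (top_of_set {0..1}) X \<gamma> (\<lambda>t. p)"

definition restricted_holonomy :: "('a, 'e::euclidean_space) manifold \<Rightarrow> ('a, 'e) metric_tensor \<Rightarrow> 'a \<Rightarrow>
    (('a, 'e) tvec \<Rightarrow> ('a, 'e) tvec) set" where
  "restricted_holonomy M g p = {A \<in> tangent_space M p \<rightarrow>\<^sub>E tangent_space M p.
     \<exists>\<gamma>. pw_smooth_curve M \<gamma> \<and> null_homotopic_loop (mtop M) p \<gamma> \<and>
       (\<forall>v\<in>tangent_space M p. \<exists>V. parallel_along M g \<gamma> V \<and> V 0 = v \<and> V 1 = A v)}"

text \<open>The pair \<open>(a, b)\<close> stands for the quaternion \<open>a + b j\<close>, where \<open>j z = cnj z j\<close> for complex \<open>z\<close>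
  and \<open>j\<^sup>2 = -1\<close>. The inner product of the product type is the standard one.\<close>

type_synonym quat = "complex \<times> complex"

definition qmult :: "quat \<Rightarrow> quat \<Rightarrow> quat" where
  "qmult q r = (fst q * fst r - snd q * cnj (snd r), fst q * snd r + snd q * cnj (fst r))"

definition qcnj :: "quat \<Rightarrow> quat" where
  "qcnj q = (cnj (fst q), - snd q)"

text \<open>Matrices with \<open>a a\<^sup>* = 1\<close>.\<close>

definition Sp :: "(quat ^ 'm ^ 'm) set" where
  "Sp = {a. \<forall>i k. (\<Sum>j\<in>UNIV. qmult (a $ i $ j) (qcnj (a $ k $ j))) = (if i = k then (1, 0) else 0)}"

text \<open>\<open>Sp(m)\<cdot>Sp(1)\<close> acting on \<open>H\<^sup>m\<close>, matrices from the left and unit quaternions from the right.\<close>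

definition SpSp1 :: "(quat ^ 'm \<Rightarrow> quat ^ 'm) set" where
  "SpSp1 = {\<lambda>x. \<chi> i. qmult (\<Sum>j\<in>UNIV. qmult (a $ i $ j) (x $ j)) q | a q. a \<in> Sp \<and> norm q = 1}"

text \<open>A linear isometry from the model space onto the tangent space at \<open>p\<close> (surjectivity is
  automatic, by dimension).\<close>

definition orthonormal_frame :: "('a, 'e::euclidean_space) manifold \<Rightarrow> ('a, 'e) metric_tensor \<Rightarrow> 'a \<Rightarrow>
    ('e \<Rightarrow> ('a, 'e) tvec) \<Rightarrow> bool" where
  "orthonormal_frame M g p L \<longleftrightarrow> (\<forall>x. L x \<in> tangent_space M p) \<and>
     (\<forall>c\<in>charts_at M p. linear (\<lambda>x. L x c)) \<and> (\<forall>x y. g p (L x) (L y) = x \<bullet> y)"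

text \<open>The containment of the holonomy group is understood, as usual, with respect to a suitable
  orthonormal frame of the tangent space.\<close>

definition quaternion_kaehler :: "('a, quat ^ 'm) manifold \<Rightarrow> ('a, quat ^ 'm) metric_tensor \<Rightarrow> bool" where
  "quaternion_kaehler M g \<longleftrightarrow> CARD('m) \<ge> 2 \<and> smooth_manifold M \<and> riemannian_metric M g \<and>
     (\<forall>p\<in>points M. \<exists>L. orthonormal_frame M g p L \<and>
        (\<forall>A\<in>restricted_holonomy M g p. \<exists>B\<in>SpSp1. \<forall>x. A (L x) = L (B x)))"


section \<open>Extrinsic hyperspheres\<close>

text \<open>A hypersurface is a subset with a manifold structure of its own, of codimension one, for which
  the inclusion is a smooth immersion. Embedded hypersurfaces are the case in which
  the topology of \<open>M\<close> is the subspace topology.\<close>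

definition hypersurface :: "('a, 'f::euclidean_space) manifold \<Rightarrow> ('a, 'e::euclidean_space) manifold \<Rightarrow> bool" where
  "hypersurface M N \<longleftrightarrow> smooth_manifold M \<and> DIM('f) + 1 = DIM('e) \<and>
     points M \<subseteq> points N \<and> smooth_map M N id \<and>
     (\<forall>p\<in>points M. inj_on (pushforward M N id p) (tangent_space M p))"

definition induced_metric :: "('a, 'f::euclidean_space) manifold \<Rightarrow> ('a, 'e::euclidean_space) manifold \<Rightarrow>
    ('a, 'e) metric_tensor \<Rightarrow> ('a, 'f) metric_tensor" where
  "induced_metric M N h = (\<lambda>p v w. h p (pushforward M N id p v) (pushforward M N id p w))"

text \<open>For vector fields \<open>X\<close>, \<open>Y\<close> on \<open>M\<close>, the difference of the two covariant derivatives, formed in the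
  tangent space of the ambient manifold. The ambient derivative of \<open>Y\<close> in the direction of \<open>X\<close>
  only involves the values of \<open>Y\<close> on \<open>M\<close>.\<close>

definition second_fundamental_form :: "('a, 'f::euclidean_space) manifold \<Rightarrow> ('a, 'e::euclidean_space) manifold \<Rightarrow>
    ('a, 'e) metric_tensor \<Rightarrow> ('a \<Rightarrow> ('a, 'f) tvec) \<Rightarrow> ('a \<Rightarrow> ('a, 'f) tvec) \<Rightarrow> 'a \<Rightarrow> ('a, 'e) tvec" where
  "second_fundamental_form M N h X Y p = (\<lambda>d.
     cov_deriv_along M N h id (\<lambda>q. pushforward M N id q (Y q)) p (X p) d -
     pushforward M N id p (levi_civita M (induced_metric M N h) X Y p) d)"

definition unit_normal_field :: "('a, 'f::euclidean_space) manifold \<Rightarrow> ('a, 'e::euclidean_space) manifold \<Rightarrow>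
    ('a, 'e) metric_tensor \<Rightarrow> ('a \<Rightarrow> ('a, 'e) tvec) \<Rightarrow> bool" where
  "unit_normal_field M N h \<nu> \<longleftrightarrow> smooth_field_along M N id \<nu> \<and>
     (\<forall>p\<in>points M. h p (\<nu> p) (\<nu> p) = 1 \<and>
        (\<forall>v\<in>tangent_space M p. h p (pushforward M N id p v) (\<nu> p) = 0))"

definition extrinsic_hypersphere :: "('a, 'f::euclidean_space) manifold \<Rightarrow> ('a, 'e::euclidean_space) manifold \<Rightarrow>
    ('a, 'e) metric_tensor \<Rightarrow> bool" where
  "extrinsic_hypersphere M N h \<longleftrightarrow> hypersurface M N \<and>
     complete_manifold M (induced_metric M N h) \<and>
     (\<exists>(l::real) \<nu>. l \<noteq> 0 \<and> unit_normal_field M N h \<nu> \<and>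
        (\<forall>X Y. smooth_field M X \<and> smooth_field M Y \<longrightarrow>
           (\<forall>p\<in>points M. second_fundamental_form M N h X Y p =
              (\<lambda>d. (l * induced_metric M N h p (X p) (Y p)) *\<^sub>R \<nu> p d))))"

end

theory Submission
  imports Defs
begin

text \<open>The contradiction arises at a single point. The Weingarten equation \<open>\<nabla> N = - \<lambda> id\<close> of an umbilical
  hypersurface gives \<open>R(X, Y) N = 0\<close> for all tangent \<open>X\<close>, \<open>Y\<close>. On the other hand, parallel transport around
  small loops normalises the span of \<open>I\<close>, \<open>J\<close>, \<open>K\<close>, so \<open>[R(X, Y), I]\<close> and \<open>[R(X, Y), J]\<close> lie in this
  span. Let \<open>D\<close> be the orthogonal complement of the quaternionic line of \<open>N\<close>, which is nonzero since \<open>m \<ge> 2\<close>.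
  For tangent \<open>X\<close>, \<open>Y\<close> the operator \<open>R(X, Y)\<close> preserves this line and \<open>D\<close>, so by the Bianchi identity it kills
  the line when \<open>X\<close>, \<open>Y\<close> lie in \<open>D\<close>. By pair symmetry \<open>R(I N, J N)\<close>, \<open>R(J N, K N)\<close> and \<open>R(K N, I N)\<close> vanish on
  \<open>D\<close>, hence everywhere, and then all \<open>R(X, Y)\<close> with \<open>X\<close>, \<open>Y\<close> tangent commute with \<open>I\<close>, \<open>J\<close>, \<open>K\<close>. Finally
  \<open>R(N, X)\<close> has rank at most two, which forces it to vanish. So \<open>R\<close> commutes with \<open>I\<close>, \<open>J\<close>, \<open>K\<close> and is therefore
  Ricci-flat.\<close>


section \<open>Calculus of iterated directional derivatives\<close>

text \<open>Two quaternionic facts stand behind the last steps. A nonzero real combination of I, J,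
  K is invertible, so a commutator lying in their span vanishes once its values are restricted: for
  z in D the vector [R(N, X), I] z is a combination of N and I N, hence orthogonal to J z and K z.
  And the image of an operator commuting with I, J, K is a quaternionic subspace, of dimension
  divisible by four, so rank at most two leaves only zero. The obstacle is that the hypotheses are
  global and the contradiction sits at a point. Holonomy is given as a set of transports around
  null-homotopic loops, so the curvature must be extracted as the second-order coefficient of the
  transport around explicit loops shrinking in a chart. The second fundamental form is given on
  vector fields of the whole hypersurface, so coordinate vectors are realised by cut-off fields.
  Christoffel symbols are given by a definite description, so their existence, smoothness and
  transformation rule come from their defining linear system.\<close>

abbreviation \<D> :: "('e::real_normed_vector \<Rightarrow> 'b::real_normed_vector) \<Rightarrow> 'e \<Rightarrow> 'e \<Rightarrow> 'b" where
  "\<D> f x \<equiv> frechet_derivative f (at x)"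

lemma Ck_on_subset: "Ck_on k W f \<Longrightarrow> W' \<subseteq> W \<Longrightarrow> Ck_on k W' f"
  by (induction k arbitrary: f) (auto intro: continuous_on_subset)

text \<open>\<open>frechet_derivative\<close> is a choice among all derivatives at the point, and
  both functions have the same ones there, even if there are none.\<close>

lemma frechet_derivative_transform_open:
  assumes "open W" "x \<in> W" "\<And>y. y \<in> W \<Longrightarrow> f y = g y"
  shows "\<D> f x = \<D> g x"
proof -
  have "(f has_derivative D) (at x) \<longleftrightarrow> (g has_derivative D) (at x)" for D
    using has_derivative_transform_within_open[OF _ assms(1,2)] assms(3) by metis
  then show ?thesis by (simp add: frechet_derivative_def)
qed

lemma differentiable_transform_open:
  assumes "f differentiable (at x)" "open W" "x \<in> W" "\<And>y. y \<in> W \<Longrightarrow> f y = g y"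
  shows "g differentiable (at x)"
  using assms has_derivative_transform_within_open unfolding differentiable_def by metis

lemma Ck_on_cong:
  assumes "open W" "\<And>y. y \<in> W \<Longrightarrow> f y = g y" "Ck_on k W f"
  shows "Ck_on k W g"
  using assms(2,3)
proof (induction k arbitrary: f g)
  case 0
  then show ?case using continuous_on_cong[of W W f g] by simp
next
  case (Suc k)
  have "g differentiable (at x)" if "x \<in> W" for x
    using differentiable_transform_open[OF _ assms(1) that Suc.prems(1)] Suc.prems(2) that by auto
  moreover have "Ck_on k W (\<lambda>x. \<D> g x v)" for v
  proof (rule Suc.IH)
    show "\<D> f y v = \<D> g y v" if "y \<in> W" for y
      using frechet_derivative_transform_open[OF assms(1) that Suc.prems(1)] by simp
    show "Ck_on k W (\<lambda>x. \<D> f x v)"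
      using Suc.prems(2) by simp
  qed
  ultimately show ?case by simp
qed

lemma Ck_on_local:
  assumes "\<And>x. x \<in> W \<Longrightarrow> \<exists>U. open U \<and> x \<in> U \<and> Ck_on k U f"
  shows "Ck_on k W f"
  using assms
proof (induction k arbitrary: f)
  case 0
  have "continuous (at x) f" if x: "x \<in> W" for x
  proof -
    obtain U where "open U" "x \<in> U" "Ck_on 0 U f" using 0[OF x] by blast
    then show ?thesis by (simp add: continuous_on_eq_continuous_at)
  qed
  then show ?case by (simp add: continuous_at_imp_continuous_on)
next
  case (Suc k)
  have "f differentiable (at x)" if "x \<in> W" for x
    using Suc.prems[OF that] by auto
  moreover have "Ck_on k W (\<lambda>x. \<D> f x v)" for v
  proof (rule Suc.IH)
    show "\<exists>U. open U \<and> x \<in> U \<and> Ck_on k U (\<lambda>x. \<D> f x v)" if "x \<in> W" for x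
      using Suc.prems[OF that] by auto
  qed
  ultimately show ?case by simp
qed

lemma Ck_on_Suc_imp: "Ck_on (Suc k) W f \<Longrightarrow> Ck_on k W f"
proof (induction k arbitrary: f)
  case 0
  then show ?case
    by (auto intro: continuous_at_imp_continuous_on differentiable_imp_continuous_within)
next
  case (Suc k)
  then show ?case by simp
qed

lemma Ck_on_le: "Ck_on k W f \<Longrightarrow> j \<le> k \<Longrightarrow> Ck_on j W f"
  by (induction k) (use le_Suc_eq Ck_on_Suc_imp in blast)+

text \<open>Near a point of an open set the extension in the definition agrees with the function
  itself, so fields, metrics and coordinate changes can be handled through
  \<open>Ck_on\<close>.\<close>

lemma smooth_on_open_iff:
  assumes "open S"
  shows "smooth_on S f \<longleftrightarrow> (\<forall>k. Ck_on k S f)"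
proof
  assume s: "smooth_on S f"
  show "\<forall>k. Ck_on k S f"
  proof
    fix k show "Ck_on k S f"
    proof (rule Ck_on_local)
      fix x assume x: "x \<in> S"
      obtain W h where W: "open W" "x \<in> W" "\<forall>k. Ck_on k W h" "\<forall>y\<in>S \<inter> W. h y = f y"
        using s x unfolding smooth_on_def by blast
      have "Ck_on k (S \<inter> W) f"
        by (rule Ck_on_cong[of _ h]) (use W assms Ck_on_subset[of k W h "S \<inter> W"] in auto)
      then show "\<exists>U. open U \<and> x \<in> U \<and> Ck_on k U f" using W x assms by (intro exI[of _ "S \<inter> W"]) auto
    qed
  qed
next
  assume "\<forall>k. Ck_on k S f"
  then show "smooth_on S f" unfolding smooth_on_def using assms by blast
qed

lemma Ck_on_const [simp]: "Ck_on k W (\<lambda>x. c)"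
  by (induction k arbitrary: c) (auto simp: frechet_derivative_const)

lemma frechet_derivative_eqI: "(f has_derivative D) (at x) \<Longrightarrow> \<D> f x = D"
  using frechet_derivative_at by metis

lemma differentiable_has_derivative:
  "f differentiable (at x) \<Longrightarrow> (f has_derivative \<D> f x) (at x)"
  using frechet_derivative_works by blast

text \<open>An explicit derivative \<open>D\<close> takes the place of the choice in
  \<open>frechet_derivative\<close>. Closure properties then become inductions on the order whose
  step is a differentiation rule.\<close>

lemma Ck_on_SucI:
  assumes "open W" "\<And>x. x \<in> W \<Longrightarrow> (f has_derivative D x) (at x)" "\<And>v. Ck_on k W (\<lambda>x. D x v)"
  shows "Ck_on (Suc k) W f"
proof -
  have "Ck_on k W (\<lambda>x. \<D> f x v)" for v
    by (rule Ck_on_cong[OF assms(1) _ assms(3)[of v]]) (use frechet_derivative_eqI[OF assms(2)] in simp)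
  moreover have "f differentiable (at x)" if "x \<in> W" for x
    using assms(2)[OF that] unfolding differentiable_def by blast
  ultimately show ?thesis by simp
qed

lemma Ck_on_id: "open W \<Longrightarrow> Ck_on k W (\<lambda>x. x)"
  by (cases k) (auto intro!: Ck_on_SucI[of W _ "\<lambda>x v. v"] simp del: Ck_on.simps(2))

section \<open>Closure of C^k maps under algebraic operations and composition\<close>

lemma Ck_on_add:
  assumes "open W" "Ck_on k W p" "Ck_on k W q"
  shows "Ck_on k W (\<lambda>x. p x + q x)"
  using assms(2,3)
proof (induction k arbitrary: p q)
  case 0
  then show ?case by (simp add: continuous_on_add)
next
  case (Suc k)
  show ?case
  proof (rule Ck_on_SucI[OF \<open>open W\<close>])
    show "((\<lambda>x. p x + q x) has_derivative (\<lambda>v. \<D> p x v + \<D> q x v)) (at x)"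
      if "x \<in> W" for x
      using Suc.prems that by (auto intro!: has_derivative_add differentiable_has_derivative)
  qed (use Suc in auto)
qed

lemma Ck_on_bilinear:
  assumes "bounded_bilinear B" "open W" "Ck_on k W f" "Ck_on k W g"
  shows "Ck_on k W (\<lambda>x. B (f x) (g x))"
  using assms(3,4)
proof (induction k arbitrary: f g)
  case 0
  then show ?case using assms(1) by (simp add: bounded_bilinear.continuous_on)
next
  case (Suc k)
  show ?case
  proof (rule Ck_on_SucI[OF \<open>open W\<close>])
    show "((\<lambda>x. B (f x) (g x)) has_derivative
        (\<lambda>v. B (f x) (\<D> g x v) + B (\<D> f x v) (g x))) (at x)"
      if "x \<in> W" for x
      using Suc.prems that assms(1)
      by (auto intro!: bounded_bilinear.FDERIV differentiable_has_derivative)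
    show "Ck_on k W (\<lambda>x. B (f x) (\<D> g x v) + B (\<D> f x v) (g x))" for v
      using Suc.prems Ck_on_Suc_imp[of k W f] Ck_on_Suc_imp[of k W g]
      by (intro Ck_on_add[OF assms(2)] Suc.IH) auto
  qed
qed

lemmas Ck_on_scaleR = Ck_on_bilinear[OF bounded_bilinear_scaleR]
lemmas Ck_on_mult = Ck_on_bilinear[OF bounded_bilinear_mult]
lemmas Ck_on_inner = Ck_on_bilinear[OF bounded_bilinear_inner]

lemma Ck_on_minus:
  assumes "open W" "Ck_on k W f" shows "Ck_on k W (\<lambda>x. - f x)"
  using Ck_on_scaleR[OF assms(1) Ck_on_const[of k W "-1::real"] assms(2)] by simp

lemma Ck_on_diff:
  assumes "open W" "Ck_on k W f" "Ck_on k W g" shows "Ck_on k W (\<lambda>x. f x - g x)"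
  using Ck_on_add[OF assms(1,2) Ck_on_minus[OF assms(1,3)]] by simp

lemma Ck_on_sum:
  assumes "open W" "\<And>i. i \<in> A \<Longrightarrow> Ck_on k W (f i)"
  shows "Ck_on k W (\<lambda>x. \<Sum>i\<in>A. f i x)"
  using assms(2)
  by (induction A rule: infinite_finite_induct) (auto intro: Ck_on_add[OF assms(1)])

lemma Ck_on_power:
  fixes f :: "'e::real_normed_vector \<Rightarrow> real"
  assumes "open W" "Ck_on k W f" shows "Ck_on k W (\<lambda>x. f x ^ n)"
  by (induction n) (auto intro: Ck_on_mult assms)

lemma linear_sum_Basis:
  fixes D :: "'e::euclidean_space \<Rightarrow> 'b::real_vector"
  assumes "linear D" shows "D v = (\<Sum>b\<in>Basis. (v \<bullet> b) *\<^sub>R D b)"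
  by (subst euclidean_representation[of v, symmetric]) (simp add: linear_sum[OF assms] linear_cmul[OF assms])

text \<open>\<open>Ck_on\<close> controls derivatives in fixed directions, while the chain rule
  differentiates \<open>f\<close> in the direction \<open>\<D> g x v\<close>, which moves with
  \<open>x\<close>. Expanding this direction in the basis leaves derivatives of \<open>f\<close> in
  fixed directions, to which the induction hypothesis applies.\<close>

lemma Ck_on_compose:
  fixes g :: "'e::real_normed_vector \<Rightarrow> 'f::euclidean_space" and f :: "'f \<Rightarrow> 'b::real_normed_vector"
  assumes "open W" "open U" "Ck_on k W g" "Ck_on k U f" "g ` W \<subseteq> U"
  shows "Ck_on k W (\<lambda>x. f (g x))"
  using assms(3,4)
proof (induction k arbitrary: f)
  case 0
  then show ?case using assms(5) by (simp add: continuous_on_compose2)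
next
  case (Suc k)
  have gU: "g x \<in> U" if "x \<in> W" for x using assms(5) that by auto
  have eq: "\<D> f (g x) (\<D> g x v) =
     (\<Sum>b\<in>Basis. (\<D> g x v \<bullet> b) *\<^sub>R \<D> f (g x) b)"
    if "x \<in> W" for x v
  proof (rule linear_sum_Basis[OF linear_frechet_derivative])
    show "f differentiable (at (g x))" using Suc.prems gU that by auto
  qed
  show ?case
  proof (rule Ck_on_SucI[OF \<open>open W\<close>])
    show "((\<lambda>x. f (g x)) has_derivative
        (\<lambda>v. \<D> f (g x) (\<D> g x v))) (at x)" if "x \<in> W" for x
      by (rule has_derivative_compose[OF differentiable_has_derivative differentiable_has_derivative]) (use Suc.prems gU that in auto)
    show "Ck_on k W (\<lambda>x. \<D> f (g x) (\<D> g x v))" for v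
    proof (rule Ck_on_cong[OF assms(1) eq[symmetric]])
      show "Ck_on k W (\<lambda>x. \<Sum>b\<in>Basis. (\<D> g x v \<bullet> b) *\<^sub>R \<D> f (g x) b)"
        using Suc.prems Ck_on_Suc_imp[of k W g]
        by (intro Ck_on_sum Ck_on_scaleR Ck_on_inner Ck_on_const assms Suc.IH) auto
    qed
  qed
qed

lemma Ck_on_differentiable: "Ck_on (Suc k) W f \<Longrightarrow> x \<in> W \<Longrightarrow> f differentiable (at x)"
  by simp

lemma Ck_on_has_derivative:
  "Ck_on (Suc k) W f \<Longrightarrow> x \<in> W \<Longrightarrow> (f has_derivative \<D> f x) (at x)"
  by (simp add: differentiable_has_derivative)

subsection \<open>Second derivatives\<close>

lemma has_real_derivative_along:
  fixes f :: "'e::real_normed_vector \<Rightarrow> real"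
  assumes "f differentiable (at (x + s *\<^sub>R u))"
  shows "((\<lambda>s. f (x + s *\<^sub>R u)) has_real_derivative \<D> f (x + s *\<^sub>R u) u) (at s)"
proof -
  have "((\<lambda>s. x + s *\<^sub>R u) has_derivative (\<lambda>h. h *\<^sub>R u)) (at s)"
    by (auto intro!: derivative_eq_intros)
  from has_derivative_compose[OF this differentiable_has_derivative[OF assms]]
  have "((\<lambda>s. f (x + s *\<^sub>R u)) has_derivative (\<lambda>h. \<D> f (x + s *\<^sub>R u) (h *\<^sub>R u))) (at s)" .
  then show ?thesis
    using linear_cmul[OF linear_frechet_derivative[OF assms]]
    by (simp add: has_field_derivative_def mult.commute[of _ "frechet_derivative f _ u"])
qed

text \<open>The mean value theorem is applied twice, first along \<open>u\<close>, then along
  \<open>v\<close>. The second difference is symmetric in \<open>u\<close> and \<open>v\<close>, so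
  the other order turns it into the other mixed derivative.\<close>

lemma second_difference_mvt:
  fixes f :: "'e::real_normed_vector \<Rightarrow> real"
  assumes W: "Ck_on 2 W f" and t: "t > 0"
    and box: "\<And>a b. 0 \<le> a \<Longrightarrow> a \<le> t \<Longrightarrow> 0 \<le> b \<Longrightarrow> b \<le> t \<Longrightarrow> x + a *\<^sub>R u + b *\<^sub>R v \<in> W"
  shows "\<exists>a b. 0 < a \<and> a < t \<and> 0 < b \<and> b < t \<and>
     f (x + t *\<^sub>R u + t *\<^sub>R v) - f (x + t *\<^sub>R u) - f (x + t *\<^sub>R v) + f x =
       t * t * \<D> (\<lambda>y. \<D> f y u) (x + a *\<^sub>R u + b *\<^sub>R v) v"
proof -
  have C: "Ck_on (Suc (Suc 0)) W f" using W by (simp add: numeral_2_eq_2)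
  let ?g = "\<lambda>s. f ((x + t *\<^sub>R v) + s *\<^sub>R u) - f (x + s *\<^sub>R u)"
  let ?D = "\<lambda>y. \<D> f y u"
  have "\<exists>a. 0 < a \<and> a < t \<and> ?g t - ?g 0 = (t - 0) * (?D ((x + t *\<^sub>R v) + a *\<^sub>R u) - ?D (x + a *\<^sub>R u))"
  proof (rule MVT2[OF t])
    fix s assume s: "0 \<le> s" "s \<le> t"
    have "x + t *\<^sub>R v + s *\<^sub>R u \<in> W" "x + s *\<^sub>R u \<in> W"
      using box[of s t] box[of s 0] s t by (auto simp: algebra_simps)
    then show "(?g has_real_derivative (?D ((x + t *\<^sub>R v) + s *\<^sub>R u) - ?D (x + s *\<^sub>R u))) (at s)"
      using C by (intro DERIV_diff has_real_derivative_along) auto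
  qed
  then obtain a where a: "0 < a" "a < t" "?g t - ?g 0 = t * (?D ((x + t *\<^sub>R v) + a *\<^sub>R u) - ?D (x + a *\<^sub>R u))"
    by auto
  have "\<exists>b. 0 < b \<and> b < t \<and> ?D ((x + a *\<^sub>R u) + t *\<^sub>R v) - ?D ((x + a *\<^sub>R u) + 0 *\<^sub>R v) =
     (t - 0) * \<D> ?D ((x + a *\<^sub>R u) + b *\<^sub>R v) v"
  proof (rule MVT2[OF t])
    fix s assume s: "0 \<le> s" "s \<le> t"
    have "x + a *\<^sub>R u + s *\<^sub>R v \<in> W" using box[of a s] s a by auto
    then show "((\<lambda>s. ?D ((x + a *\<^sub>R u) + s *\<^sub>R v)) has_real_derivative
        \<D> ?D ((x + a *\<^sub>R u) + s *\<^sub>R v) v) (at s)"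
      using C by (intro has_real_derivative_along) auto
  qed
  then obtain b where b: "0 < b" "b < t"
    "?D ((x + a *\<^sub>R u) + t *\<^sub>R v) - ?D (x + a *\<^sub>R u) = t * \<D> ?D ((x + a *\<^sub>R u) + b *\<^sub>R v) v"
    by auto
  have "f (x + t *\<^sub>R u + t *\<^sub>R v) - f (x + t *\<^sub>R u) - f (x + t *\<^sub>R v) + f x = ?g t - ?g 0"
    by (simp add: algebra_simps)
  also have "\<dots> = t * (?D ((x + a *\<^sub>R u) + t *\<^sub>R v) - ?D (x + a *\<^sub>R u))"
    using a(3) by (simp add: algebra_simps)
  also have "\<dots> = t * t * \<D> ?D (x + a *\<^sub>R u + b *\<^sub>R v) v"
    using b(3) by simp
  finally show ?thesis using a b by blast
qed

text \<open>If the mixed derivatives differed at \<open>x\<close>, continuity would keep them apart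
  on a ball, but both orders of the mean value argument express the same second difference over a
  small parallelogram.\<close>

lemma symmetric_second_derivative_real:
  fixes f :: "'e::real_normed_vector \<Rightarrow> real"
  assumes W: "open W" "x \<in> W" "Ck_on 2 W f"
  shows "\<D> (\<lambda>y. \<D> f y u) x v =
         \<D> (\<lambda>y. \<D> f y v) x u"
proof (rule ccontr)
  let ?P = "\<lambda>y. \<D> (\<lambda>y. \<D> f y u) y v"
  let ?Q = "\<lambda>y. \<D> (\<lambda>y. \<D> f y v) y u"
  assume ne: "?P x \<noteq> ?Q x"
  define e where "e = \<bar>?P x - ?Q x\<bar> / 2"
  have e: "e > 0" using ne by (simp add: e_def)
  have "continuous_on W ?P" "continuous_on W ?Q" using W(3) by (simp_all add: numeral_2_eq_2)
  then have "continuous (at x) ?P" "continuous (at x) ?Q" using W by (auto simp: continuous_on_eq_continuous_at)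
  then have "(?P \<longlongrightarrow> ?P x) (nhds x)" "(?Q \<longlongrightarrow> ?Q x) (nhds x)"
    unfolding continuous_at tendsto_at_iff_tendsto_nhds[of ?P x] tendsto_at_iff_tendsto_nhds[of ?Q x] by blast+
  then have "\<forall>\<^sub>F y in nhds x. dist (?P y) (?P x) < e \<and> dist (?Q y) (?Q x) < e"
    using e by (intro eventually_conj tendstoD)
  moreover have "\<forall>\<^sub>F y in nhds x. y \<in> W" using W eventually_nhds_in_open by blast
  ultimately have "\<forall>\<^sub>F y in nhds x. dist (?P y) (?P x) < e \<and> dist (?Q y) (?Q x) < e \<and> y \<in> W"
    by eventually_elim auto
  then obtain d where d: "d > 0"
    "\<And>y. dist y x < d \<Longrightarrow> dist (?P y) (?P x) < e \<and> dist (?Q y) (?Q x) < e \<and> y \<in> W"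
    by (auto simp: eventually_nhds_metric)
  \<comment> \<open>Keeps the parallelogram spanned by \<open>t *\<^sub>R u\<close> and
    \<open>t *\<^sub>R v\<close> inside the ball of radius \<open>d\<close>; the summand 1 keeps the
    denominator positive when \<open>u\<close> and \<open>v\<close> vanish.\<close>
  define t where "t = d / (2 * (norm u + norm v + 1))"
  have pos: "norm u + norm v + 1 > 0" by (simp add: add_nonneg_pos)
  have t: "t > 0" using d pos by (simp add: t_def)
  have near: "dist (x + a *\<^sub>R u + b *\<^sub>R v) x < d" if "0 \<le> a" "a \<le> t" "0 \<le> b" "b \<le> t" for a b
  proof -
    have "dist (x + a *\<^sub>R u + b *\<^sub>R v) x = norm (a *\<^sub>R u + b *\<^sub>R v)" by (simp add: dist_norm)
    also have "\<dots> \<le> a * norm u + b * norm v" using norm_triangle_ineq[of "a *\<^sub>R u" "b *\<^sub>R v"] that by simp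
    also have "\<dots> \<le> t * norm u + t * norm v" using that by (intro add_mono mult_right_mono) auto
    also have "\<dots> \<le> t * (norm u + norm v + 1)" using t by (simp add: algebra_simps)
    also have "\<dots> = d / 2" using pos unfolding t_def by (simp add: divide_simps)
    finally show ?thesis using d by simp
  qed
  obtain a b where ab: "0 < a" "a < t" "0 < b" "b < t"
     "f (x + t *\<^sub>R u + t *\<^sub>R v) - f (x + t *\<^sub>R u) - f (x + t *\<^sub>R v) + f x = t * t * ?P (x + a *\<^sub>R u + b *\<^sub>R v)"
    using second_difference_mvt[OF W(3) t, of x u v] near d by blast
  have "x + a *\<^sub>R v + b *\<^sub>R u \<in> W" if "0 \<le> a" "a \<le> t" "0 \<le> b" "b \<le> t" for a b
    using near[of b a] d that by (auto simp: algebra_simps)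
  then obtain a' b' where ab': "0 < a'" "a' < t" "0 < b'" "b' < t"
     "f (x + t *\<^sub>R v + t *\<^sub>R u) - f (x + t *\<^sub>R v) - f (x + t *\<^sub>R u) + f x = t * t * ?Q (x + a' *\<^sub>R v + b' *\<^sub>R u)"
    using second_difference_mvt[OF W(3) t, of x v u] by blast
  have "t * t * ?P (x + a *\<^sub>R u + b *\<^sub>R v) = t * t * ?Q (x + a' *\<^sub>R v + b' *\<^sub>R u)"
    using ab(5) ab'(5) by (simp add: algebra_simps)
  then have eq: "?P (x + a *\<^sub>R u + b *\<^sub>R v) = ?Q (x + a' *\<^sub>R v + b' *\<^sub>R u)" using t by simp
  have "dist (?P (x + a *\<^sub>R u + b *\<^sub>R v)) (?P x) < e"
    using d near[of a b] ab by simp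
  moreover have "dist (?Q (x + a' *\<^sub>R v + b' *\<^sub>R u)) (?Q x) < e"
    using d near[of b' a'] ab' by (simp add: algebra_simps)
  ultimately show False using eq unfolding e_def by (simp add: dist_real_def) argo
qed

lemma frechet_derivative_inner_left:
  assumes "f differentiable (at x)"
  shows "\<D> (\<lambda>y. f y \<bullet> b) x = (\<lambda>v. \<D> f x v \<bullet> b)"
  by (rule frechet_derivative_eqI) (auto intro!: derivative_eq_intros differentiable_has_derivative assms)

lemma symmetric_second_derivative:
  fixes f :: "'e::real_normed_vector \<Rightarrow> 'b::euclidean_space"
  assumes W: "open W" "x \<in> W" "Ck_on 2 W f"
  shows "\<D> (\<lambda>y. \<D> f y u) x v =
         \<D> (\<lambda>y. \<D> f y v) x u"
proof (rule euclidean_eqI)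
  fix b :: 'b
  have C: "Ck_on (Suc (Suc 0)) W f" using W(3) by (simp add: numeral_2_eq_2)
  have *: "\<D> (\<lambda>y. \<D> f y u) x v \<bullet> b =
    \<D> (\<lambda>y. \<D> (\<lambda>z. f z \<bullet> b) y u) x v" for u v
  proof -
    have "\<D> (\<lambda>y. \<D> (\<lambda>z. f z \<bullet> b) y u) x =
          \<D> (\<lambda>y. \<D> f y u \<bullet> b) x"
      by (rule frechet_derivative_transform_open[OF W(1,2)]) (use C in \<open>simp add: frechet_derivative_inner_left\<close>)
    then show ?thesis using C W(2) by (simp add: frechet_derivative_inner_left)
  qed
  show "\<D> (\<lambda>y. \<D> f y u) x v \<bullet> b =
        \<D> (\<lambda>y. \<D> f y v) x u \<bullet> b"
    unfolding * by (rule symmetric_second_derivative_real[OF W(1,2)])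
      (use W in \<open>auto intro: Ck_on_inner\<close>)
qed

subsection \<open>Bump functions\<close>

text \<open>The powers of \<open>1 / t\<close> make the family closed under differentiation;
  \<open>n = 0\<close> is the classical flat function.\<close>

definition flat_fun :: "nat \<Rightarrow> real \<Rightarrow> real" where
  "flat_fun n t = (if t > 0 then (1 / t) ^ n * exp (- (1 / t)) else 0)"

lemma flat_fun_pos_iff: "flat_fun n t > 0 \<longleftrightarrow> t > 0"
  by (simp add: flat_fun_def)

lemma flat_fun_tendsto_0: "(flat_fun n \<longlongrightarrow> 0) (at 0)"
proof -
  have "((\<lambda>s. s ^ n / exp s) \<longlongrightarrow> (0::real)) at_top" by (rule tendsto_power_div_exp_0)
  then have "((\<lambda>t. inverse t ^ n / exp (inverse t)) \<longlongrightarrow> (0::real)) (at_right 0)"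
    by (rule filterlim_compose[OF _ filterlim_inverse_at_top_right])
  moreover have "\<forall>\<^sub>F t in at_right 0. flat_fun n t = inverse t ^ n / exp (inverse t)"
    by (rule eventually_mono[OF eventually_at_right_less]) (simp add: flat_fun_def exp_minus divide_inverse)
  ultimately have "(flat_fun n \<longlongrightarrow> 0) (at_right 0)" by (simp add: tendsto_cong)
  moreover have "(flat_fun n \<longlongrightarrow> 0) (at_left 0)"
  proof (rule Lim_transform_eventually[OF tendsto_const])
    show "\<forall>\<^sub>F t in at_left 0. 0 = flat_fun n t"
      by (simp add: eventually_at_filter flat_fun_def)
  qed
  ultimately show ?thesis by (simp add: filterlim_at_split)
qed

lemma flat_fun_has_derivative:
  "(flat_fun n has_real_derivative (flat_fun (n + 2) t - n * flat_fun (n + 1) t)) (at t)"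
proof (cases t "0::real" rule: linorder_cases)
  case less
  have "((\<lambda>t. 0) has_real_derivative 0) (at t)" by simp
  then have "(flat_fun n has_real_derivative 0) (at t)"
    by (rule has_field_derivative_transform_within_open[of _ _ _ "{..<0}"]) (use less in \<open>auto simp: flat_fun_def\<close>)
  then show ?thesis using less by (simp add: flat_fun_def)
next
  case equal
  \<comment> \<open>Dividing by \<open>h\<close> raises the exponent by one, so the difference
    quotient at 0 is again a member of the family and tends to 0.\<close>
  have "((\<lambda>h. flat_fun n h / h) \<longlongrightarrow> 0) (at 0)"
  proof (rule Lim_transform_eventually[OF flat_fun_tendsto_0[of "n + 1"]])
    show "\<forall>\<^sub>F h in at 0. flat_fun (n + 1) h = flat_fun n h / h"
      by (simp add: flat_fun_def)
  qed
  then show ?thesis using equal by (simp add: DERIV_def flat_fun_def)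
next
  case greater
  have "((\<lambda>t. (1 / t) ^ n * exp (- (1 / t))) has_real_derivative
     (flat_fun (n + 2) t - n * flat_fun (n + 1) t)) (at t)"
    using greater
    apply (auto intro!: derivative_eq_intros simp: flat_fun_def)
    apply (cases n) apply (auto simp: field_simps power2_eq_square)
    done
  then show ?thesis
    by (rule has_field_derivative_transform_within_open[of _ _ _ "{0<..}"]) (use greater in \<open>auto simp: flat_fun_def\<close>)
qed

lemma Ck_on_flat_fun: "Ck_on k UNIV (flat_fun n)"
proof (induction k arbitrary: n)
  case 0
  show ?case
    using DERIV_isCont[OF flat_fun_has_derivative] by (simp add: continuous_at_imp_continuous_on)
next
  case (Suc k)
  show ?case
  proof (rule Ck_on_SucI)
    show "(flat_fun n has_derivative (\<lambda>v. (flat_fun (n + 2) t - n * flat_fun (n + 1) t) * v)) (at t)" for t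
      using flat_fun_has_derivative[of n t] by (simp add: has_field_derivative_def)
    show "Ck_on k UNIV (\<lambda>t. (flat_fun (n + 2) t - n * flat_fun (n + 1) t) * v)" for v
      by (intro Ck_on_mult Ck_on_diff Ck_on_const Suc.IH open_UNIV)
  qed simp
qed

text \<open>\<open>flat_fun 0\<close> is applied to r^2 minus the squared distance, which is smooth
  also at the centre. Such functions will cut off coordinate fields to fields on the whole
  manifold.\<close>

lemma bump_function_exists:
  fixes x0 :: "'e::euclidean_space"
  assumes "r > 0"
  shows "\<exists>\<phi> :: 'e \<Rightarrow> real. (\<forall>k. Ck_on k UNIV \<phi>) \<and> (\<forall>x. \<phi> x > 0 \<longleftrightarrow> dist x0 x < r) \<and> (\<forall>x. dist x0 x \<ge> r \<longrightarrow> \<phi> x = 0)"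
proof (intro exI conjI allI impI)
  let ?\<phi> = "\<lambda>x::'e. flat_fun 0 (r\<^sup>2 - (x - x0) \<bullet> (x - x0))"
  show "Ck_on k UNIV ?\<phi>" for k
    by (rule Ck_on_compose[OF _ _ _ Ck_on_flat_fun])
      (auto intro!: Ck_on_diff Ck_on_inner Ck_on_const Ck_on_id)
  have eq: "(x - x0) \<bullet> (x - x0) = (dist x0 x)\<^sup>2" for x
    by (metis dist_commute dist_norm power2_norm_eq_inner)
  show "0 < ?\<phi> x \<longleftrightarrow> dist x0 x < r" for x
    unfolding flat_fun_pos_iff eq using assms by (auto simp: power_strict_mono intro: power_less_imp_less_base)
  show "?\<phi> x = 0" if "dist x0 x \<ge> r" for x
    unfolding eq flat_fun_def using that assms power_mono[of r "dist x0 x" 2] by (simp add: not_less[symmetric])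
qed


section \<open>The Levi-Civita connection and curvature of a metric on an open set\<close>

lemma bilinear_sum_Basis:
  fixes B :: "'a::euclidean_space \<Rightarrow> 'b::euclidean_space \<Rightarrow> 'c::real_vector"
  assumes "bilinear B"
  shows "B v w = (\<Sum>i\<in>Basis. \<Sum>j\<in>Basis. ((v \<bullet> i) * (w \<bullet> j)) *\<^sub>R B i j)"
proof -
  have "B v w = (\<Sum>i\<in>Basis. (v \<bullet> i) *\<^sub>R B i w)"
    using linear_sum_Basis[of "\<lambda>x. B x w" v] assms by (simp add: bilinear_def)
  also have "\<dots> = (\<Sum>i\<in>Basis. (v \<bullet> i) *\<^sub>R (\<Sum>j\<in>Basis. (w \<bullet> j) *\<^sub>R B i j))"
    using linear_sum_Basis[of "B i" w for i] assms by (simp add: bilinear_def)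
  finally show ?thesis by (simp add: scaleR_sum_right)
qed

text \<open>Expanding in bases leaves finitely many components of \<open>B\<close>, so joint
  differentiability reduces to that with fixed arguments. The map \<open>f\<close> allows for fields
  along a hypersurface or a coordinate change.\<close>

lemma bilinear_family_derivative:
  fixes B :: "'d::real_normed_vector \<Rightarrow> 'a::euclidean_space \<Rightarrow> 'b::euclidean_space \<Rightarrow> 'c::real_normed_vector"
    and f :: "'e::real_normed_vector \<Rightarrow> 'd"
  assumes W: "open W" "f x \<in> W" and B: "\<And>y. y \<in> W \<Longrightarrow> bilinear (B y)"
    and dB: "\<And>v w. (\<lambda>y. B y v w) differentiable (at (f x))"
    and f: "(f has_derivative f') (at x)" and a: "(a has_derivative a') (at x)" and b: "(b has_derivative b') (at x)"
  shows "((\<lambda>y. B (f y) (a y) (b y)) has_derivative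
     (\<lambda>u. \<D> (\<lambda>z. B z (a x) (b x)) (f x) (f' u) + B (f x) (a' u) (b x) + B (f x) (a x) (b' u))) (at x)"
proof -
  let ?D = "\<lambda>v w. \<D> (\<lambda>z. B z v w) (f x)"
  let ?S = "\<lambda>v w y. \<Sum>i\<in>Basis. \<Sum>j\<in>Basis. ((v \<bullet> i) * (w \<bullet> j)) *\<^sub>R B y i j"
  have D: "((\<lambda>y. B y v w) has_derivative ?D v w) (at (f x))" for v w
    using dB differentiable_has_derivative by blast
  have D2: "?D v w h = (\<Sum>i\<in>Basis. \<Sum>j\<in>Basis. ((v \<bullet> i) * (w \<bullet> j)) *\<^sub>R ?D i j h)" for v w h
  proof -
    have "(?S v w has_derivative (\<lambda>h. \<Sum>i\<in>Basis. \<Sum>j\<in>Basis. ((v \<bullet> i) * (w \<bullet> j)) *\<^sub>R ?D i j h)) (at (f x))"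
      by (intro has_derivative_sum has_derivative_scaleR_right D)
    then have "((\<lambda>y. B y v w) has_derivative (\<lambda>h. \<Sum>i\<in>Basis. \<Sum>j\<in>Basis. ((v \<bullet> i) * (w \<bullet> j)) *\<^sub>R ?D i j h)) (at (f x))"
      by (rule has_derivative_transform_within_open[OF _ W]) (rule bilinear_sum_Basis[OF B, symmetric])
    from frechet_derivative_eqI[OF this] show ?thesis by (simp add: fun_eq_iff)
  qed
  have "((\<lambda>y. ?S (a y) (b y) (f y)) has_derivative
     (\<lambda>u. \<Sum>i\<in>Basis. \<Sum>j\<in>Basis. ((a x \<bullet> i) * (b x \<bullet> j)) *\<^sub>R ?D i j (f' u) +
        ((a x \<bullet> i) * (b' u \<bullet> j) + (a' u \<bullet> i) * (b x \<bullet> j)) *\<^sub>R B (f x) i j)) (at x)"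
    by (intro has_derivative_sum has_derivative_scaleR has_derivative_mult has_derivative_inner_left a b
      has_derivative_compose[OF f D])
  moreover have "\<forall>\<^sub>F y in at x. ?S (a y) (b y) (f y) = B (f y) (a y) (b y)"
  proof -
    have "\<forall>\<^sub>F y in at x. f y \<in> W"
      using has_derivative_continuous[OF f] W by (auto simp: continuous_within intro: topological_tendstoD)
    then show ?thesis by eventually_elim (rule bilinear_sum_Basis[OF B, symmetric])
  qed
  moreover have "?S (a x) (b x) (f x) = B (f x) (a x) (b x)" by (rule bilinear_sum_Basis[OF B[OF W(2)], symmetric])
  ultimately have "((\<lambda>y. B (f y) (a y) (b y)) has_derivative
     (\<lambda>u. \<Sum>i\<in>Basis. \<Sum>j\<in>Basis. ((a x \<bullet> i) * (b x \<bullet> j)) *\<^sub>R ?D i j (f' u) +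
        ((a x \<bullet> i) * (b' u \<bullet> j) + (a' u \<bullet> i) * (b x \<bullet> j)) *\<^sub>R B (f x) i j)) (at x)"
    by (rule has_derivative_transform_eventually) simp_all
  moreover have "(\<Sum>i\<in>Basis. \<Sum>j\<in>Basis. ((a x \<bullet> i) * (b x \<bullet> j)) *\<^sub>R ?D i j (f' u) +
        ((a x \<bullet> i) * (b' u \<bullet> j) + (a' u \<bullet> i) * (b x \<bullet> j)) *\<^sub>R B (f x) i j) =
     ?D (a x) (b x) (f' u) + B (f x) (a' u) (b x) + B (f x) (a x) (b' u)" for u
    unfolding D2[of "a x" "b x" "f' u"] bilinear_sum_Basis[OF B[OF W(2)], of "a' u" "b x"]
      bilinear_sum_Basis[OF B[OF W(2)], of "a x" "b' u"]
    by (simp add: sum.distrib scaleR_add_left algebra_simps)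
  ultimately show ?thesis by simp
qed

lemma frechet_derivative_bilinear_family:
  fixes B :: "'d::real_normed_vector \<Rightarrow> 'a::euclidean_space \<Rightarrow> 'b::euclidean_space \<Rightarrow> 'c::real_normed_vector"
  assumes W: "open W" "x \<in> W" and B: "\<And>y. y \<in> W \<Longrightarrow> bilinear (B y)"
    and dB: "\<And>v w. (\<lambda>y. B y v w) differentiable (at x)"
  shows "bilinear (\<lambda>v w. \<D> (\<lambda>y. B y v w) x h)"
proof -
  have D: "((\<lambda>y. B y v w) has_derivative \<D> (\<lambda>y. B y v w) x) (at x)" for v w
    using dB differentiable_has_derivative by blast
  have eqI: "\<D> f x = D" if "(g has_derivative D) (at x)" "\<And>y. y \<in> W \<Longrightarrow> g y = f y" for f g D
    using has_derivative_transform_within_open[OF that(1) W that(2)] frechet_derivative_eqI by blast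
  show ?thesis
    unfolding bilinear_def
    by (intro conjI allI linearI; rule fun_cong[where x = h];
      (rule eqI[OF has_derivative_add[OF D D]] | rule eqI[OF has_derivative_scaleR_right[OF D]]))
      (simp_all add: B bilinear_ladd bilinear_radd bilinear_lmul bilinear_rmul)
qed

text \<open>In the product rule the derivative of \<open>s\<close> would be multiplied by
  \<open>f x = 0\<close>, so continuity of \<open>s\<close> is enough. This upgrades a continuous
  solution of a linear system to a differentiable one.\<close>

lemma has_derivative_scaleR_vanishing:
  fixes f :: "'e::real_normed_vector \<Rightarrow> 'b::real_normed_vector"
  assumes f: "(f has_derivative f') (at x)" "f x = 0" and s: "isCont s x"
  shows "((\<lambda>y. s y *\<^sub>R f y) has_derivative (\<lambda>h. s x *\<^sub>R f' h)) (at x)"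
proof -
  have bl: "bounded_linear f'" using f has_derivative_bounded_linear by blast
  obtain K where K: "K > 0" "\<And>h. norm (f' h) \<le> norm h * K" using bounded_linear.pos_bounded[OF bl] by blast
  let ?q = "\<lambda>y. norm (f y - f x - f' (y - x)) / norm (y - x)"
  have q: "(?q \<longlongrightarrow> 0) (at x)" using f(1) by (simp add: has_derivative_iff_norm)
  have s0: "((\<lambda>y. \<bar>s y - s x\<bar>) \<longlongrightarrow> 0) (at x)"
    using s by (simp add: isCont_def LIM_zero tendsto_rabs_zero)
  have "((\<lambda>y. \<bar>s y - s x\<bar> * (?q y + K) + \<bar>s x\<bar> * ?q y) \<longlongrightarrow> 0 * (0 + K) + \<bar>s x\<bar> * 0) (at x)"
    by (intro tendsto_intros q s0)
  then have lim: "((\<lambda>y. \<bar>s y - s x\<bar> * (?q y + K) + \<bar>s x\<bar> * ?q y) \<longlongrightarrow> 0) (at x)" by simp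
  have "((\<lambda>y. norm (s y *\<^sub>R f y - s x *\<^sub>R f x - s x *\<^sub>R f' (y - x)) / norm (y - x)) \<longlongrightarrow> 0) (at x)"
  proof (rule tendsto_sandwich[OF _ _ tendsto_const lim])
    show "\<forall>\<^sub>F y in at x. norm (s y *\<^sub>R f y - s x *\<^sub>R f x - s x *\<^sub>R f' (y - x)) / norm (y - x)
        \<le> \<bar>s y - s x\<bar> * (?q y + K) + \<bar>s x\<bar> * ?q y"
    proof (rule eventually_at_filter[THEN iffD2], rule always_eventually, intro allI impI)
      fix y assume y: "y \<noteq> x"
      let ?r = "f y - f x - f' (y - x)"
      have "s y *\<^sub>R f y - s x *\<^sub>R f x - s x *\<^sub>R f' (y - x) = (s y - s x) *\<^sub>R (?r + f' (y - x)) + s x *\<^sub>R ?r"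
        using f(2) by (simp add: algebra_simps)
      then have "norm (s y *\<^sub>R f y - s x *\<^sub>R f x - s x *\<^sub>R f' (y - x)) \<le>
         norm ((s y - s x) *\<^sub>R (?r + f' (y - x))) + norm (s x *\<^sub>R ?r)"
        using norm_triangle_ineq by metis
      also have "\<dots> \<le> \<bar>s y - s x\<bar> * (norm ?r + norm (y - x) * K) + \<bar>s x\<bar> * norm ?r"
        using norm_triangle_le[OF add_left_mono[OF K(2)[of "y - x"], of "norm ?r"]]
        by (simp add: mult_left_mono)
      finally have "norm (s y *\<^sub>R f y - s x *\<^sub>R f x - s x *\<^sub>R f' (y - x)) / norm (y - x) \<le>
         (\<bar>s y - s x\<bar> * (norm ?r + norm (y - x) * K) + \<bar>s x\<bar> * norm ?r) / norm (y - x)"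
        by (simp add: divide_right_mono)
      also have "\<dots> = \<bar>s y - s x\<bar> * (?q y + K) + \<bar>s x\<bar> * ?q y"
        using y by (simp add: field_simps)
      finally show "norm (s y *\<^sub>R f y - s x *\<^sub>R f x - s x *\<^sub>R f' (y - x)) / norm (y - x)
        \<le> \<bar>s y - s x\<bar> * (?q y + K) + \<bar>s x\<bar> * ?q y" .
    qed
  qed simp
  then show ?thesis
    using bl by (simp add: has_derivative_iff_norm bounded_linear_const_scaleR)
qed

text \<open>The formula of \<open>christoffel\<close>, and below that of \<open>curvature\<close>,
  for a metric given directly in coordinates, so that the local theory can precede the
  charts.\<close>

definition levi_form :: "('e::euclidean_space \<Rightarrow> 'e \<Rightarrow> 'e \<Rightarrow> real) \<Rightarrow> 'e \<Rightarrow> 'e \<Rightarrow> 'e \<Rightarrow> 'e" where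
  "levi_form G x = (THE \<Gamma>. bilinear \<Gamma> \<and> (\<forall>u v. \<Gamma> u v = \<Gamma> v u) \<and>
     (\<forall>u v w. \<D> (\<lambda>y. G y v w) x u = G x (\<Gamma> u v) w + G x v (\<Gamma> u w)))"

definition curv_form :: "('e::euclidean_space \<Rightarrow> 'e \<Rightarrow> 'e \<Rightarrow> 'e) \<Rightarrow> 'e \<Rightarrow> 'e \<Rightarrow> 'e \<Rightarrow> 'e \<Rightarrow> 'e" where
  "curv_form \<Gamma> x u v w =
     \<D> (\<lambda>y. \<Gamma> y v w) x u - \<D> (\<lambda>y. \<Gamma> y u w) x v
     + \<Gamma> x u (\<Gamma> x v w) - \<Gamma> x v (\<Gamma> x u w)"

locale local_riemann =
  fixes W :: "'e::euclidean_space set" and G :: "'e \<Rightarrow> 'e \<Rightarrow> 'e \<Rightarrow> real"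
  assumes open_W: "open W"
    and bil: "x \<in> W \<Longrightarrow> bilinear (G x)"
    and sym: "x \<in> W \<Longrightarrow> G x v w = G x w v"
    and pos: "x \<in> W \<Longrightarrow> v \<noteq> 0 \<Longrightarrow> G x v v > 0"
    and Ck: "Ck_on k W (\<lambda>x. G x v w)"
begin

text \<open>Multiplication by the Gram matrix of the metric. It turns the conditions
  \<open>G x a w = \<kappa> w\<close> for all \<open>w\<close> into a linear system for
  \<open>a\<close> with smooth coefficients.\<close>

definition flat :: "'e \<Rightarrow> 'e \<Rightarrow> 'e" where
  "flat x v = (\<Sum>b\<in>Basis. G x v b *\<^sub>R b)"

lemma flat_inner: "x \<in> W \<Longrightarrow> flat x v \<bullet> w = G x v w"
  using linear_sum_Basis[of "G x v" w] bil[of x]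
  by (simp add: flat_def inner_sum_left bilinear_def inner_commute[of w] mult.commute)

lemma nondegenerate: "x \<in> W \<Longrightarrow> (\<And>w. G x v w = 0) \<Longrightarrow> v = 0"
  using pos by force

lemma eq_by_metric: "x \<in> W \<Longrightarrow> (\<And>w. G x v w = G x v' w) \<Longrightarrow> v = v'"
  using nondegenerate[of x "v - v'"] bil[of x] by (simp add: bilinear_lsub)

lemma linear_flat: "x \<in> W \<Longrightarrow> linear (flat x)"
  unfolding flat_def using bil[of x]
  by (intro linearI) (simp_all add: bilinear_ladd bilinear_lmul scaleR_add_left sum.distrib scaleR_sum_right)

lemma inj_flat: "x \<in> W \<Longrightarrow> inj (flat x)"
  using eq_by_metric flat_inner by (metis injI)

lemma surj_flat: "x \<in> W \<Longrightarrow> surj (flat x)"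
  using linear_injective_imp_surjective linear_flat inj_flat by blast

lemma Ck_flat: "Ck_on k W (\<lambda>x. flat x v)"
  unfolding flat_def by (intro Ck_on_sum Ck_on_scaleR Ck_on_const Ck open_W)

lemma riesz:
  assumes "x \<in> W" "linear \<kappa>" shows "\<exists>!a. \<forall>w. G x a w = \<kappa> w"
proof -
  obtain a where a: "flat x a = (\<Sum>b\<in>Basis. \<kappa> b *\<^sub>R b)" using surj_flat[OF assms(1)] by (metis surjD)
  have "G x a w = \<kappa> w" for w
    using flat_inner[OF assms(1), of a w] linear_sum_Basis[OF assms(2), of w]
    unfolding a by (simp add: inner_sum_left inner_commute[of w] mult.commute)
  then show ?thesis using eq_by_metric[OF assms(1)] by metis
qed

text \<open>Differentiating the system shows that the derivative of the solution solves a system with the same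
  matrix, which is what makes the induction on \<open>k\<close> work.\<close>

lemma Ck_solution:
  assumes "Ck_on k W K" "\<And>x. x \<in> W \<Longrightarrow> flat x (a x) = K x"
  shows "Ck_on k W a"
proof -
  have cont: "isCont a x" and diff: "(K has_derivative K') (at x) \<Longrightarrow> \<exists>D. (a has_derivative D) (at x)"
    if x: "x \<in> W" and K: "continuous_on W K" and eq: "\<And>x. x \<in> W \<Longrightarrow> flat x (a x) = K x" for x a K K'
  proof -
    obtain S where SL: "linear S" "S \<circ> flat x = id"
      using linear_injective_left_inverse[OF linear_flat[OF x] inj_flat[OF x]] by blast
    have S: "S (flat x v) = v" for v using SL(2) by (metis comp_apply id_apply)
    have blS: "bounded_linear S" using SL(1) linear_conv_bounded_linear by blast
    \<comment> \<open>\<open>?P y\<close> is the difference of the matrices at \<open>y\<close> and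
      at \<open>x\<close>. Only the matrix at \<open>x\<close> is inverted, by \<open>S\<close>; the
      difference stays on the right-hand side of \<open>a_eq\<close> and is small near
      \<open>x\<close>.\<close>
    let ?P = "\<lambda>y v. \<Sum>b\<in>Basis. (v \<bullet> b) *\<^sub>R (flat y b - flat x b)"
    let ?N = "\<lambda>y. \<Sum>b\<in>Basis. norm (flat y b - flat x b)"
    have diffW: "flat y v - flat x v = ?P y v" if "y \<in> W" for y v
      using linear_sum_Basis[OF linear_flat[OF x], of v] linear_sum_Basis[OF linear_flat[OF that], of v]
      by (simp add: sum_subtractf scaleR_diff_right)
    have a_eq: "a y = S (K y - ?P y (a y))" if "y \<in> W" for y
      using S[of "a y"] eq[OF that] diffW[OF that, of "a y"] by (metis diff_diff_eq2 add_diff_cancel_left')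
    have evW: "\<forall>\<^sub>F y in at x. y \<in> W" using x open_W eventually_at_topological by blast
    \<comment> \<open>Half of this lower bound will absorb the perturbation
      \<open>?P y (a y)\<close>, which bounds \<open>a\<close> near \<open>x\<close> before its
      continuity is known.\<close>
    obtain B where B: "B > 0" "\<And>v. norm (flat x v) \<ge> B * norm v"
      using linear_inj_bounded_below_pos[OF linear_flat[OF x] inj_flat[OF x]] by metis
    have Kx: "(K \<longlongrightarrow> K x) (at x)"
      using K x open_W by (simp add: continuous_on_eq_continuous_at isCont_def)
    have flatx: "((\<lambda>y. flat y b) \<longlongrightarrow> flat x b) (at x)" for b
      using Ck_flat[of 0 b] x open_W by (simp add: continuous_on_eq_continuous_at isCont_def)
    have "((\<lambda>y. ?N y) \<longlongrightarrow> (\<Sum>b\<in>(Basis::'e set). norm (flat x b - flat x b))) (at x)"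
      by (intro tendsto_intros flatx)
    then have N0: "((\<lambda>y. ?N y) \<longlongrightarrow> 0) (at x)" by simp
    have Nb: "norm (?P y v) \<le> ?N y * norm v" for y v
      unfolding sum_distrib_right
      by (intro order_trans[OF norm_sum] sum_mono) (simp add: mult.commute mult_right_mono Basis_le_norm)
    have "\<forall>\<^sub>F y in at x. ?N y < B / 2"
      using order_tendstoD(2)[OF N0, of "B / 2"] B by linarith
    moreover have "\<forall>\<^sub>F y in at x. norm (K y) < norm (K x) + 1"
      using order_tendstoD(2)[OF tendsto_norm[OF Kx]] by simp
    ultimately have bdd: "\<forall>\<^sub>F y in at x. norm (a y) \<le> 2 / B * (norm (K x) + 1)"
      using evW
    proof eventually_elim
      case (elim y)
      have "B * norm (a y) \<le> norm (flat x (a y))" using B by simp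
      also have "\<dots> = norm (K y - ?P y (a y))"
        using eq[OF elim(3)] diffW[OF elim(3), of "a y"] by (metis diff_diff_eq2 add_diff_cancel_left')
      also have "\<dots> \<le> norm (K y) + (B / 2) * norm (a y)"
        by (intro order_trans[OF norm_triangle_ineq4] add_left_mono order_trans[OF Nb] mult_right_mono)
          (use elim in auto)
      finally have "B / 2 * norm (a y) \<le> norm (K x) + 1" using elim by simp
      then show ?case using B by (simp add: field_simps)
    qed
    have "((\<lambda>y. ?P y (a y)) \<longlongrightarrow> 0) (at x)"
    proof (rule Lim_null_comparison)
      show "\<forall>\<^sub>F y in at x. norm (?P y (a y)) \<le>
          ?N y * (2 / B * (norm (K x) + 1))"
        using bdd
      proof eventually_elim
        case (elim y)
        show ?case by (rule order_trans[OF Nb]) (intro mult_left_mono sum_nonneg elim norm_ge_zero)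
      qed
      show "((\<lambda>y. ?N y * (2 / B * (norm (K x) + 1))) \<longlongrightarrow> 0) (at x)"
        using tendsto_mult_right[OF N0, of "2 / B * (norm (K x) + 1)"] by simp
    qed
    from bounded_linear.tendsto[OF blS tendsto_diff[OF Kx this]]
    have "((\<lambda>y. S (K y - ?P y (a y))) \<longlongrightarrow> S (K x)) (at x)" by simp
    moreover have "S (K x) = a x" using S eq[OF x] by metis
    moreover have "\<forall>\<^sub>F y in at x. S (K y - ?P y (a y)) = a y"
      using evW by eventually_elim (rule a_eq[symmetric])
    ultimately show cont: "isCont a x"
      unfolding isCont_def using Lim_transform_eventually[of _ "a x" "at x" a] by simp
    show "\<exists>D. (a has_derivative D) (at x)" if K': "(K has_derivative K') (at x)"
    proof -
      have dflat: "((\<lambda>y. flat y b - flat x b) has_derivative \<D> (\<lambda>y. flat y b) x) (at x)" for b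
        using has_derivative_diff[OF Ck_on_has_derivative[OF Ck_flat x] has_derivative_const, of b "flat x b"] by simp
      have inn: "isCont (\<lambda>y. a y \<bullet> b) x" for b using cont by (intro continuous_intros)
      \<comment> \<open>So far \<open>a\<close> is only known to be continuous, but
        \<open>flat y b - flat x b\<close> vanishes at \<open>x\<close>, so
        \<open>has_derivative_scaleR_vanishing\<close> applies to each summand.\<close>
      have "((\<lambda>y. S (K y - ?P y (a y))) has_derivative
         (\<lambda>h. S (K' h - (\<Sum>b\<in>Basis. (a x \<bullet> b) *\<^sub>R \<D> (\<lambda>y. flat y b) x h)))) (at x)"
        by (intro bounded_linear.has_derivative[OF blS] has_derivative_diff K' has_derivative_sum
          has_derivative_scaleR_vanishing dflat inn) simp
      then have "(a has_derivative
         (\<lambda>h. S (K' h - (\<Sum>b\<in>Basis. (a x \<bullet> b) *\<^sub>R \<D> (\<lambda>y. flat y b) x h)))) (at x)"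
        by (rule has_derivative_transform_within_open[OF _ open_W x]) (rule a_eq[symmetric])
      then show ?thesis by blast
    qed
  qed
  show ?thesis
    using assms
  proof (induction k arbitrary: a K)
    case 0
    then show ?case using cont[of _ K a] by (simp add: continuous_at_imp_continuous_on)
  next
    case (Suc k)
    have cK: "continuous_on W K" using Ck_on_le[OF Suc.prems(1), of 0] by simp
    have D: "(a has_derivative \<D> a x) (at x)" if "x \<in> W" for x
    proof -
      have "a differentiable (at x)"
        unfolding differentiable_def
        by (rule diff[OF that cK Suc.prems(2) Ck_on_has_derivative[OF Suc.prems(1) that]])
      then show ?thesis by (rule differentiable_has_derivative)
    qed
    have eq: "flat x (\<D> a x v) =
        \<D> K x v - (\<Sum>b\<in>Basis. (a x \<bullet> b) *\<^sub>R \<D> (\<lambda>y. flat y b) x v)"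
      if x: "x \<in> W" for x v
    proof -
      have "((\<lambda>y. \<Sum>b\<in>Basis. (a y \<bullet> b) *\<^sub>R flat y b) has_derivative
         (\<lambda>h. \<Sum>b\<in>Basis. (a x \<bullet> b) *\<^sub>R \<D> (\<lambda>y. flat y b) x h +
            (\<D> a x h \<bullet> b) *\<^sub>R flat x b)) (at x)"
        by (intro has_derivative_sum has_derivative_scaleR has_derivative_inner_left D x
          Ck_on_has_derivative[OF Ck_flat])
      then have "(K has_derivative
         (\<lambda>h. \<Sum>b\<in>Basis. (a x \<bullet> b) *\<^sub>R \<D> (\<lambda>y. flat y b) x h +
            (\<D> a x h \<bullet> b) *\<^sub>R flat x b)) (at x)"
        by (rule has_derivative_transform_within_open[OF _ open_W x])
          (simp add: Suc.prems(2)[symmetric] linear_sum_Basis[OF linear_flat, symmetric])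
      from frechet_derivative_eqI[OF this] have "\<D> K x v =
        (\<Sum>b\<in>Basis. (a x \<bullet> b) *\<^sub>R \<D> (\<lambda>y. flat y b) x v) +
        flat x (\<D> a x v)"
        using linear_sum_Basis[OF linear_flat[OF x], of "\<D> a x v"]
        by (simp add: sum.distrib)
      then show ?thesis by simp
    qed
    show ?case
    proof (rule Ck_on_SucI[OF open_W D])
      fix v
      have "Ck_on k W (\<lambda>x. \<D> K x v -
          (\<Sum>b\<in>Basis. (a x \<bullet> b) *\<^sub>R \<D> (\<lambda>y. flat y b) x v))"
      proof (intro Ck_on_diff Ck_on_sum Ck_on_scaleR Ck_on_inner Ck_on_const open_W)
        show "Ck_on k W (\<lambda>x. \<D> K x v)" using Suc.prems(1) by simp
        show "Ck_on k W a" using Suc.IH[OF Ck_on_Suc_imp[OF Suc.prems(1)] Suc.prems(2)] .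
        show "Ck_on k W (\<lambda>x. \<D> (\<lambda>y. flat y b) x v)" for b
          using Ck_flat[of "Suc k" b] by simp
      qed
      then show "Ck_on k W (\<lambda>x. \<D> a x v)"
        by (rule Suc.IH) (rule eq)
    qed
  qed
qed

section \<open>The connection form of the metric\<close>

abbreviation dG :: "'e \<Rightarrow> 'e \<Rightarrow> 'e \<Rightarrow> 'e \<Rightarrow> real" where
  "dG x u v w \<equiv> \<D> (\<lambda>y. G y v w) x u"

abbreviation \<Gamma> :: "'e \<Rightarrow> 'e \<Rightarrow> 'e \<Rightarrow> 'e" where
  "\<Gamma> \<equiv> levi_form G"

lemma G_differentiable: "x \<in> W \<Longrightarrow> (\<lambda>y. G y v w) differentiable (at x)"
  using Ck_on_differentiable[OF Ck] .

lemma dG_bilinear: "x \<in> W \<Longrightarrow> bilinear (\<lambda>v w. dG x u v w)"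
  by (rule frechet_derivative_bilinear_family[OF open_W]) (auto simp: bil G_differentiable)

lemma dG_linear: "x \<in> W \<Longrightarrow> linear (\<lambda>u. dG x u v w)"
  using linear_frechet_derivative[OF G_differentiable] .

lemma dG_sym: "x \<in> W \<Longrightarrow> dG x u v w = dG x u w v"
  using frechet_derivative_transform_open[OF open_W, of x "\<lambda>y. G y v w" "\<lambda>y. G y w v"] sym by simp

text \<open>The right-hand side of Koszul's formula for constant fields, whose bracket terms
  vanish.\<close>

definition koszul :: "'e \<Rightarrow> 'e \<Rightarrow> 'e \<Rightarrow> 'e \<Rightarrow> real" where
  "koszul x u v w = (dG x u v w + dG x v u w - dG x w u v) / 2"

lemmas dG_simps = bilinear_ladd[OF dG_bilinear] bilinear_lmul[OF dG_bilinear]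
  bilinear_radd[OF dG_bilinear] bilinear_rmul[OF dG_bilinear] linear_add[OF dG_linear] linear_cmul[OF dG_linear]

lemma koszul_linear: "x \<in> W \<Longrightarrow> linear (koszul x u v)"
  unfolding koszul_def by (intro linearI) (simp_all add: dG_simps field_simps)

lemma koszul_bilinear: "x \<in> W \<Longrightarrow> bilinear (\<lambda>u v. koszul x u v w)"
  unfolding koszul_def bilinear_def by (intro conjI allI linearI) (simp_all add: dG_simps field_simps)

text \<open>The fundamental theorem of Riemannian geometry at a point: the Riesz vector of the
  Koszul form is the only candidate. It gives access to the definite description in
  \<open>levi_form\<close>.\<close>

lemma levi_ex1:
  assumes x: "x \<in> W"
  shows "\<exists>!\<Gamma>. bilinear \<Gamma> \<and> (\<forall>u v. \<Gamma> u v = \<Gamma> v u) \<and>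
     (\<forall>u v w. dG x u v w = G x (\<Gamma> u v) w + G x v (\<Gamma> u w))"
proof -
  define C where "C u v = (THE a. \<forall>w. G x a w = koszul x u v w)" for u v
  have C: "G x (C u v) w = koszul x u v w" for u v w
    using theI'[OF riesz[OF x koszul_linear[OF x, of u v]]] unfolding C_def by blast
  have bC: "bilinear C"
    unfolding bilinear_def
    by (intro conjI allI linearI; rule eq_by_metric[OF x])
      (simp_all add: C bilinear_ladd[OF bil[OF x]] bilinear_lmul[OF bil[OF x]]
        bilinear_ladd[OF koszul_bilinear[OF x]] bilinear_lmul[OF koszul_bilinear[OF x]]
        bilinear_radd[OF koszul_bilinear[OF x]] bilinear_rmul[OF koszul_bilinear[OF x]])
  have sC: "C u v = C v u" for u v
    by (rule eq_by_metric[OF x]) (simp add: C koszul_def, rule dG_sym[OF x])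
  have mC: "dG x u v w = G x (C u v) w + G x v (C u w)" for u v w
    unfolding sym[OF x, of v] C koszul_def by (simp add: dG_sym[OF x, of _ w] field_simps)
  show ?thesis
  proof (rule ex1I[of _ C])
    fix C' assume C': "bilinear C' \<and> (\<forall>u v. C' u v = C' v u) \<and> (\<forall>u v w. dG x u v w = G x (C' u v) w + G x v (C' u w))"
    have "G x (C' u v) w = koszul x u v w" for u v w
    proof -
      \<comment> \<open>Adding the first two equations and subtracting the third leaves twice the
        wanted term.\<close>
      have "dG x u v w = G x (C' u v) w + G x (C' u w) v" "dG x v u w = G x (C' u v) w + G x (C' v w) u"
        "dG x w u v = G x (C' u w) v + G x (C' v w) u"
        using C' sym[OF x] by metis+
      then show ?thesis unfolding koszul_def by simp
    qed
    then show "C' = C" using eq_by_metric[OF x] C by (metis ext)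
  qed (use bC sC mC in blast)
qed

lemma levi_props:
  assumes x: "x \<in> W"
  shows levi_bilinear: "bilinear (\<Gamma> x)" and levi_sym: "\<Gamma> x u v = \<Gamma> x v u"
    and levi_metric: "dG x u v w = G x (\<Gamma> x u v) w + G x v (\<Gamma> x u w)"
  using theI'[OF levi_ex1[OF x]] unfolding levi_form_def by blast+

lemma levi_unique:
  assumes "x \<in> W" "bilinear C" "\<And>u v. C u v = C v u"
    "\<And>u v w. dG x u v w = G x (C u v) w + G x v (C u w)"
  shows "C = \<Gamma> x"
  using levi_ex1[OF assms(1)] assms levi_props[OF assms(1)] by metis

lemma levi_koszul:
  assumes x: "x \<in> W" shows "G x (\<Gamma> x u v) w = koszul x u v w"
proof -
  have "dG x u v w = G x (\<Gamma> x u v) w + G x (\<Gamma> x u w) v" "dG x v u w = G x (\<Gamma> x u v) w + G x (\<Gamma> x v w) u"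
    "dG x w u v = G x (\<Gamma> x u w) v + G x (\<Gamma> x v w) u"
    using levi_metric[OF x] levi_sym[OF x] sym[OF x] by metis+
  then show ?thesis unfolding koszul_def by simp
qed

text \<open>The values come from a definite description, so their dependence on the point is
  obtained from the linear system that they solve.\<close>

lemma levi_Ck: "Ck_on k W (\<lambda>x. \<Gamma> x u v)"
proof (rule Ck_solution)
  have "Ck_on k W (\<lambda>x. dG x u v w)" for u v w
    using Ck[of "Suc k"] by simp
  then show "Ck_on k W (\<lambda>x. \<Sum>b\<in>Basis. koszul x u v b *\<^sub>R b)"
    unfolding koszul_def divide_inverse
    by (intro Ck_on_sum Ck_on_scaleR Ck_on_mult Ck_on_add Ck_on_diff Ck_on_const open_W)
  show "flat x (\<Gamma> x u v) = (\<Sum>b\<in>Basis. koszul x u v b *\<^sub>R b)" if "x \<in> W" for x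
    using levi_koszul[OF that] by (simp add: flat_def)
qed

lemma levi_differentiable: "x \<in> W \<Longrightarrow> (\<lambda>y. \<Gamma> y u v) differentiable (at x)"
  using Ck_on_differentiable[OF levi_Ck] .

abbreviation d\<Gamma> :: "'e \<Rightarrow> 'e \<Rightarrow> 'e \<Rightarrow> 'e \<Rightarrow> 'e" where
  "d\<Gamma> x u v w \<equiv> \<D> (\<lambda>y. \<Gamma> y v w) x u"

lemma dlevi_bilinear: "x \<in> W \<Longrightarrow> bilinear (\<lambda>v w. d\<Gamma> x u v w)"
  by (rule frechet_derivative_bilinear_family[OF open_W]) (auto simp: levi_bilinear levi_differentiable)

lemma dlevi_linear: "x \<in> W \<Longrightarrow> linear (\<lambda>u. d\<Gamma> x u v w)"
  using linear_frechet_derivative[OF levi_differentiable] .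

lemma dlevi_sym: "x \<in> W \<Longrightarrow> d\<Gamma> x u v w = d\<Gamma> x u w v"
  using frechet_derivative_transform_open[OF open_W, of x "\<lambda>y. \<Gamma> y v w" "\<lambda>y. \<Gamma> y w v"] levi_sym by simp

text \<open>The vector \<open>a' u + \<Gamma> (f x) (f' u) (a x)\<close> is the covariant derivative
  of \<open>a\<close> along \<open>f\<close>, so this is the compatibility of connection and metric
  for fields along a map.\<close>

lemma metric_derivative:
  assumes x: "f x \<in> W" and f: "(f has_derivative f') (at x)" and a: "(a has_derivative a') (at x)"
    and b: "(b has_derivative b') (at x)"
  shows "((\<lambda>y. G (f y) (a y) (b y)) has_derivative
     (\<lambda>u. G (f x) (a' u + \<Gamma> (f x) (f' u) (a x)) (b x) + G (f x) (a x) (b' u + \<Gamma> (f x) (f' u) (b x)))) (at x)"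
  using bilinear_family_derivative[OF open_W x bil G_differentiable[OF x] f a b]
  by (simp add: levi_metric[OF x] bilinear_ladd[OF bil[OF x]] bilinear_radd[OF bil[OF x]] algebra_simps)

section \<open>Symmetries of the curvature\<close>

abbreviation R :: "'e \<Rightarrow> 'e \<Rightarrow> 'e \<Rightarrow> 'e \<Rightarrow> 'e" where
  "R \<equiv> curv_form \<Gamma>"

text \<open>Because \<open>\<Gamma>\<close> and its derivatives are symmetric, the twelve terms
  cancel in pairs.\<close>

lemma curv_bianchi:
  assumes x: "x \<in> W" shows "R x u v w + R x v w u + R x w u v = 0"
proof -
  have "d\<Gamma> x v w u = d\<Gamma> x v u w" "d\<Gamma> x w v u = d\<Gamma> x w u v" "d\<Gamma> x u w v = d\<Gamma> x u v w"
    using dlevi_sym[OF x] by blast+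
  moreover have "\<Gamma> x w u = \<Gamma> x u w" "\<Gamma> x v u = \<Gamma> x u v" "\<Gamma> x w v = \<Gamma> x v w"
    using levi_sym[OF x] by blast+
  ultimately show ?thesis unfolding curv_form_def by simp
qed

lemma curv_antisym: "R x u v w = - R x v u w"
  unfolding curv_form_def by simp

lemmas levi_simps = bilinear_ladd[OF levi_bilinear] bilinear_lmul[OF levi_bilinear]
  bilinear_radd[OF levi_bilinear] bilinear_rmul[OF levi_bilinear]

lemmas dlevi_simps = bilinear_ladd[OF dlevi_bilinear] bilinear_lmul[OF dlevi_bilinear]
  bilinear_radd[OF dlevi_bilinear] bilinear_rmul[OF dlevi_bilinear] linear_add[OF dlevi_linear] linear_cmul[OF dlevi_linear]

lemma curv_linear:
  assumes x: "x \<in> W"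
  shows "linear (\<lambda>u. R x u v w)" and "linear (\<lambda>v. R x u v w)" and "linear (\<lambda>w. R x u v w)"
proof -
  show "linear (\<lambda>u. R x u v w)"
    unfolding curv_form_def by (intro linearI) (simp_all add: x levi_simps dlevi_simps algebra_simps)
  show "linear (\<lambda>v. R x u v w)"
    unfolding curv_form_def by (intro linearI) (simp_all add: x levi_simps dlevi_simps algebra_simps)
  show "linear (\<lambda>w. R x u v w)"
    unfolding curv_form_def by (intro linearI) (simp_all add: x levi_simps dlevi_simps algebra_simps)
qed

text \<open>Differentiate the metric compatibility once more. Second derivatives of the metric
  commute, and the products of two first-order connection terms cancel, which leaves
  \<open>G x (R x u v w) z + G x w (R x u v z) = 0\<close>.\<close>

lemma curv_skew:
  assumes x: "x \<in> W"
  shows "G x (R x u v w) z = - G x (R x u v z) w"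
proof -
  have d: "(\<lambda>y. dG y v w z) differentiable (at x)" for v w z
    using Ck[of "Suc (Suc 0)"] x by auto
  have *: "\<D> (\<lambda>y. dG y v w z) x u =
     G x (d\<Gamma> x u v w + \<Gamma> x u (\<Gamma> x v w)) z + G x (\<Gamma> x v w) (\<Gamma> x u z)
     + (G x (\<Gamma> x u w) (\<Gamma> x v z) + G x w (d\<Gamma> x u v z + \<Gamma> x u (\<Gamma> x v z)))" for u v
  proof -
    have L: "((\<lambda>y. \<Gamma> y v w) has_derivative (\<lambda>u. d\<Gamma> x u v w)) (at x)" for v w
      using differentiable_has_derivative[OF levi_differentiable[OF x]] .
    have "((\<lambda>y. G y (\<Gamma> y v w) z + G y w (\<Gamma> y v z)) has_derivative
      (\<lambda>u. G x (d\<Gamma> x u v w + \<Gamma> x u (\<Gamma> x v w)) z + G x (\<Gamma> x v w) (0 + \<Gamma> x u z)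
       + (G x (0 + \<Gamma> x u w) (\<Gamma> x v z) + G x w (d\<Gamma> x u v z + \<Gamma> x u (\<Gamma> x v z))))) (at x)"
      by (intro has_derivative_add metric_derivative[where f = "\<lambda>x. x"] x has_derivative_ident has_derivative_const L)
    then have "((\<lambda>y. dG y v w z) has_derivative
      (\<lambda>u. G x (d\<Gamma> x u v w + \<Gamma> x u (\<Gamma> x v w)) z + G x (\<Gamma> x v w) (0 + \<Gamma> x u z)
       + (G x (0 + \<Gamma> x u w) (\<Gamma> x v z) + G x w (d\<Gamma> x u v z + \<Gamma> x u (\<Gamma> x v z))))) (at x)"
      by (rule has_derivative_transform_within_open[OF _ open_W x]) (rule levi_metric[symmetric])
    from frechet_derivative_eqI[OF this] show ?thesis by simp
  qed
  have "\<D> (\<lambda>y. dG y v w z) x u = \<D> (\<lambda>y. dG y u w z) x v"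
    by (rule symmetric_second_derivative_real[OF open_W x Ck])
  then have "G x (R x u v w) z + G x w (R x u v z) = 0"
    unfolding * curv_form_def using bil[OF x]
    by (simp add: bilinear_ladd bilinear_radd bilinear_lsub bilinear_rsub)
  then show ?thesis using sym[OF x, of w] by simp
qed

end


section \<open>Parallel transport around small loops\<close>

lemma vector_derivative_bound:
  fixes f :: "real \<Rightarrow> 'e::real_normed_vector"
  assumes "\<And>t. t \<in> {0..1} \<Longrightarrow> (f has_vector_derivative f' t) (at t within {0..1})"
    and "\<And>t. t \<in> {0..1} \<Longrightarrow> norm (f' t) \<le> B" and "t \<in> {0..1}"
  shows "norm (f t - f 0) \<le> B"
proof -
  have B0: "B \<ge> 0" using order_trans[OF norm_ge_zero assms(2)[of 0]] by simp
  have "norm (f t - f 0) \<le> B * norm (t - 0)"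
  proof (rule differentiable_bound)
    show "(f has_derivative (\<lambda>h. h *\<^sub>R f' s)) (at s within {0..1})" if "s \<in> {0..1}" for s
      using assms(1)[OF that] by (simp add: has_vector_derivative_def)
    show "onorm (\<lambda>h. h *\<^sub>R f' s) \<le> B" if "s \<in> {0..1}" for s
      using assms(2)[OF that] by (intro onorm_bound B0) (simp add: mult.commute[of B] mult_left_mono)
  qed (use assms(3) in auto)
  also have "\<dots> \<le> B" using assms(3) B0 by (simp add: mult_left_le)
  finally show ?thesis .
qed

text \<open>The bound by one half makes the Picard operator a contraction on the whole interval, so
  a single fixed point reaches time 1. Small loops satisfy this bound.\<close>

lemma linear_ode_exists:
  fixes A :: "real \<Rightarrow> 'e::euclidean_space \<Rightarrow> 'e"
  assumes lin: "\<And>t. t \<in> {0..1} \<Longrightarrow> linear (A t)" and cont: "\<And>v. continuous_on {0..1} (\<lambda>t. A t v)"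
    and bd: "\<And>t v. t \<in> {0..1} \<Longrightarrow> norm (A t v) \<le> norm v / 2"
  shows "\<exists>V. V 0 = w \<and> (\<forall>t\<in>{0..1}. (V has_vector_derivative A t (V t)) (at t within {0..1}))"
proof -
  \<comment> \<open>The fixed point is sought among bounded continuous functions on the whole line;
    clamping the time makes \<open>F V\<close> constant outside the unit interval, hence
    bounded.\<close>
  define cl :: "real \<Rightarrow> real" where "cl t = max 0 (min 1 t)" for t
  have cl: "cl t \<in> {0..1}" and cl_id: "t \<in> {0..1} \<Longrightarrow> cl t = t" for t by (auto simp: cl_def)
  have contcl: "continuous_on UNIV cl" unfolding cl_def by (intro continuous_intros)
  have contA: "continuous_on {0..1} (\<lambda>s. A s (V s))" if "continuous_on {0..1} V" for V
  proof -
    have "continuous_on {0..1} (\<lambda>s. \<Sum>b\<in>Basis. (V s \<bullet> b) *\<^sub>R A s b)"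
      by (intro continuous_intros cont that)
    moreover have "(\<Sum>b\<in>Basis. (V s \<bullet> b) *\<^sub>R A s b) = A s (V s)" if "s \<in> {0..1}" for s
      using linear_sum_Basis[OF lin[OF that], of "V s"] by simp
    ultimately show ?thesis using continuous_on_cong[of "{0..1}" "{0..1}"] by (metis (no_types, lifting))
  qed
  define F where "F V t = w + integral {0..cl t} (\<lambda>s. A s (V s))" for V :: "real \<Rightarrow> 'e" and t
  have FB: "F V \<in> bcontfun" if "continuous_on {0..1} V" for V
  proof -
    have c: "continuous_on {0..1} (\<lambda>t. w + integral {0..t} (\<lambda>s. A s (V s)))"
      by (intro continuous_intros indefinite_integral_continuous_1 integrable_continuous_real contA that)
    have "continuous_on UNIV (F V)"
      unfolding F_def by (rule continuous_on_compose2[OF c contcl]) (use cl in auto)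
    moreover have "bounded (range (F V))"
    proof (rule bounded_subset[OF compact_imp_bounded[OF compact_continuous_image[OF c compact_Icc]]])
      show "range (F V) \<subseteq> (\<lambda>t. w + integral {0..t} (\<lambda>s. A s (V s))) ` {0..1}"
        using cl unfolding F_def by blast
    qed
    ultimately show ?thesis by (simp add: bcontfun_def)
  qed
  define T :: "(real \<Rightarrow>\<^sub>C 'e) \<Rightarrow> (real \<Rightarrow>\<^sub>C 'e)" where "T V = Bcontfun (F (apply_bcontfun V))" for V
  have T: "apply_bcontfun (T V) = F (apply_bcontfun V)" for V
    unfolding T_def by (rule Bcontfun_inverse[OF FB]) simp
  have lip: "dist (T V) (T V') \<le> 1/2 * dist V V'" for V V'
  proof (rule dist_bound)
    fix t
    let ?f = "apply_bcontfun V" and ?g = "apply_bcontfun V'"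
    have cV: "continuous_on {0..cl t} (\<lambda>s. A s (V s))" for V :: "real \<Rightarrow>\<^sub>C 'e"
      using continuous_on_subset[OF contA[of V]] cl[of t] by fastforce
    have "dist (T V t) (T V' t) = norm (integral {0..cl t} (\<lambda>s. A s (?f s)) - integral {0..cl t} (\<lambda>s. A s (?g s)))"
      unfolding T F_def by (simp add: dist_norm)
    also have "\<dots> = norm (integral {0..cl t} (\<lambda>s. A s (?f s) - A s (?g s)))"
      by (simp add: integral_diff integrable_continuous_real cV)
    also have "\<dots> \<le> (dist V V' / 2) * (cl t - 0)"
    proof (rule integral_bound)
      show "continuous_on {0..cl t} (\<lambda>s. A s (?f s) - A s (?g s))" by (intro continuous_intros cV)
      fix s assume "s \<in> {0..cl t}"
      then have s: "s \<in> {0..1}" using cl[of t] by auto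
      have "norm (A s (?f s) - A s (?g s)) = norm (A s (?f s - ?g s))"
        using linear_diff[OF lin[OF s]] by simp
      also have "\<dots> \<le> dist V V' / 2" using bd[OF s, of "?f s - ?g s"] dist_bounded[of V s V'] by (simp add: dist_norm)
      finally show "norm (A s (?f s) - A s (?g s)) \<le> dist V V' / 2" .
    qed (use cl[of t] in auto)
    also have "\<dots> \<le> 1/2 * dist V V'" using cl[of t] by (simp add: mult_left_le)
    finally show "dist (T V t) (T V' t) \<le> 1/2 * dist V V'" .
  qed
  obtain V where V: "T V = V" using banach_fix_type[of "1/2" T] lip by auto
  have VF: "apply_bcontfun V = F V" using T[of V] V by simp
  show ?thesis
  proof (intro exI conjI ballI)
    show "V 0 = w" by (subst VF) (simp add: F_def cl_def)
    fix t :: real assume t: "t \<in> {0..1}"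
    have "((\<lambda>t. w + integral {0..t} (\<lambda>s. A s (V s))) has_vector_derivative 0 + A t (V t)) (at t within {0..1})"
      by (intro has_vector_derivative_add has_vector_derivative_const integral_has_vector_derivative contA t) simp
    then have *: "((\<lambda>t. w + integral {0..t} (\<lambda>s. A s (V s))) has_vector_derivative A t (V t)) (at t within {0..1})"
      by simp
    show "(apply_bcontfun V has_vector_derivative A t (V t)) (at t within {0..1})"
    proof (rule has_vector_derivative_transform[OF t _ *])
      show "apply_bcontfun V s = w + integral {0..s} (\<lambda>s. A s (V s))" if "s \<in> {0..1}" for s
        using VF[THEN fun_cong, of s] cl_id[OF that] by (simp add: F_def)
    qed
  qed
qed

text \<open>At a time \<open>s\<close> where the norm is maximal, the increment is at most half of
  that maximum and can be absorbed; this takes the place of a Gronwall estimate.\<close>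

lemma linear_ode_bound:
  fixes A :: "real \<Rightarrow> 'e::euclidean_space \<Rightarrow> 'e"
  assumes V: "\<And>t. t \<in> {0..1} \<Longrightarrow> (V has_vector_derivative A t (V t)) (at t within {0..1})"
    and bd: "\<And>t v. t \<in> {0..1} \<Longrightarrow> norm (A t v) \<le> c * norm v" and c: "0 \<le> c" "c \<le> 1/2" and t: "t \<in> {0..1}"
  shows "norm (V t) \<le> 2 * norm (V 0)" "norm (V t - V 0) \<le> 2 * c * norm (V 0)"
proof -
  have "continuous_on {0..1} V"
    unfolding continuous_on_eq_continuous_within using has_vector_derivative_continuous[OF V] by blast
  then have "continuous_on {0..1} (\<lambda>t. norm (V t))" by (intro continuous_intros)
  then obtain s where s: "s \<in> {0..1}" "\<And>t. t \<in> {0..1} \<Longrightarrow> norm (V t) \<le> norm (V s)"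
    using continuous_attains_sup[of "{0..1::real}" "\<lambda>t. norm (V t)"] by auto
  have diff: "norm (V t - V 0) \<le> c * norm (V s)" if "t \<in> {0..1}" for t
  proof (rule vector_derivative_bound[OF V _ that])
    show "norm (A r (V r)) \<le> c * norm (V s)" if "r \<in> {0..1}" for r
      using bd[OF that, of "V r"] mult_left_mono[OF s(2)[OF that] c(1)] by linarith
  qed
  have "norm (V s) \<le> norm (V 0) + norm (V s - V 0)" using norm_triangle_ineq[of "V 0" "V s - V 0"] by simp
  also have "\<dots> \<le> norm (V 0) + 1/2 * norm (V s)"
    using diff[OF s(1)] mult_right_mono[OF c(2) norm_ge_zero[of "V s"]] by linarith
  finally have S: "norm (V s) \<le> 2 * norm (V 0)" by simp
  show "norm (V t) \<le> 2 * norm (V 0)" using s(2)[OF t] S by linarith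
  show "norm (V t - V 0) \<le> 2 * c * norm (V 0)"
    using diff[OF t] mult_left_mono[OF S c(1)] by simp
qed

lemma bilinear_bound:
  fixes B :: "'a::euclidean_space \<Rightarrow> 'b::euclidean_space \<Rightarrow> 'c::real_normed_vector"
  assumes "bilinear B"
  shows "norm (B v w) \<le> (\<Sum>i\<in>Basis. \<Sum>j\<in>Basis. norm (B i j)) * norm v * norm w"
proof -
  have "norm (B v w) \<le> (\<Sum>i\<in>Basis. \<Sum>j\<in>Basis. norm (((v \<bullet> i) * (w \<bullet> j)) *\<^sub>R B i j))"
    by (subst bilinear_sum_Basis[OF assms]) (intro order_trans[OF norm_sum] sum_mono order_refl)
  also have "\<dots> \<le> (\<Sum>i\<in>Basis. \<Sum>j\<in>Basis. norm (B i j) * norm v * norm w)"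
  proof (intro sum_mono)
    fix i :: 'a and j :: 'b assume "i \<in> Basis" "j \<in> Basis"
    then have "\<bar>v \<bullet> i\<bar> * \<bar>w \<bullet> j\<bar> \<le> norm v * norm w" by (intro mult_mono Basis_le_norm) auto
    from mult_right_mono[OF this norm_ge_zero[of "B i j"]]
    show "norm (((v \<bullet> i) * (w \<bullet> j)) *\<^sub>R B i j) \<le> norm (B i j) * norm v * norm w"
      by (simp add: abs_mult mult_ac)
  qed
  also have "\<dots> = (\<Sum>i\<in>Basis. \<Sum>j\<in>Basis. norm (B i j)) * norm v * norm w"
    by (simp add: sum_distrib_right)
  finally show ?thesis .
qed

text \<open>Any closed curve enclosing a nonzero area would do; this one is polynomial, and encloses the area
  \<open>1/60\<close> in the coordinates given by \<open>u\<close> and \<open>v\<close>.\<close>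

definition loop :: "'e::real_vector \<Rightarrow> 'e \<Rightarrow> real \<Rightarrow> 'e" where
  "loop u v t = (t - t^2) *\<^sub>R u + (t^2 - t^3) *\<^sub>R v"

definition loop' :: "'e::real_vector \<Rightarrow> 'e \<Rightarrow> real \<Rightarrow> 'e" where
  "loop' u v t = (1 - 2 * t) *\<^sub>R u + (2 * t - 3 * t^2) *\<^sub>R v"

lemma loop_ends [simp]: "loop u v 0 = 0" "loop u v 1 = 0"
  by (simp_all add: loop_def)

lemma loop_has_vector_derivative [derivative_intros]:
  "(loop u v has_vector_derivative loop' u v t) (at t within S)"
  unfolding loop_def[abs_def] loop'_def has_vector_derivative_def
  by (auto intro!: derivative_eq_intros simp: algebra_simps)

lemma loop_bounds:
  assumes "t \<in> {0..1}"
  shows "norm (loop u v t) \<le> norm u + norm v" "norm (loop' u v t) \<le> norm u + norm v"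
proof -
  have t2: "0 \<le> t^2" "t^2 \<le> t" "0 \<le> t^3" "t^3 \<le> t^2" "t \<le> 1"
    using assms by (auto simp: power2_eq_square power3_eq_cube mult_left_le mult_left_le_one_le)
  have *: "norm (a *\<^sub>R u + b *\<^sub>R v) \<le> norm u + norm v" if "\<bar>a\<bar> \<le> 1" "\<bar>b\<bar> \<le> 1" for a b
    using norm_triangle_ineq[of "a *\<^sub>R u" "b *\<^sub>R v"] mult_right_mono[OF that(1) norm_ge_zero[of u]]
      mult_right_mono[OF that(2) norm_ge_zero[of v]] by simp
  show "norm (loop u v t) \<le> norm u + norm v"
    unfolding loop_def using t2 assms unfolding atLeastAtMost_iff by (intro *) linarith+
  have "0 \<le> (1 - t) * (3 * t + 1)" using assms by auto
  then have "- 1 \<le> 2 * t - 3 * t^2" by (simp add: algebra_simps power2_eq_square)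
  moreover have "0 \<le> 1 - 2 * t + t^2" using zero_le_power2[of "1 - t"] by (simp add: power2_diff)
  then have "2 * t - 3 * t^2 \<le> 1" using t2(1) by linarith
  ultimately show "norm (loop' u v t) \<le> norm u + norm v"
    unfolding loop'_def using assms by (intro *) (auto simp: abs_le_iff)
qed

section \<open>Second-order expansion of the transport around a scaled loop\<close>

context local_riemann
begin

text \<open>The error must be uniform in \<open>a\<close> and \<open>b\<close>, since the velocity
  and the transported vector vary along the loop. By bilinearity finitely many pairs of basis
  vectors suffice.\<close>

lemma levi_expansion:
  assumes x: "x0 \<in> W" and e: "e > 0"
  shows "\<exists>d>0. \<forall>y. dist x0 y < d \<longrightarrow> y \<in> W \<and>
    (\<forall>a b. norm (\<Gamma> y a b - \<Gamma> x0 a b - d\<Gamma> x0 (y - x0) a b) \<le> e * norm (y - x0) * norm a * norm b)"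
proof -
  \<comment> \<open>The number of pairs of basis vectors, among which the error \<open>e\<close> is
    divided.\<close>
  define N where "N = real (DIM('e) * DIM('e))"
  have N: "N > 0" by (simp add: N_def)
  let ?E = "\<lambda>y a b. \<Gamma> y a b - \<Gamma> x0 a b - d\<Gamma> x0 (y - x0) a b"
  have "\<forall>\<^sub>F y in at x0. norm (?E y i j) \<le> e / N * norm (y - x0)" for i j
    using differentiable_has_derivative[OF levi_differentiable[OF x], of i j] e N
    unfolding has_derivative_within_alt2 by (meson divide_pos_pos)
  then have "\<forall>\<^sub>F y in at x0. \<forall>i\<in>Basis. \<forall>j\<in>Basis. norm (?E y i j) \<le> e / N * norm (y - x0)"
    by (intro eventually_ball_finite finite_Basis ballI)
  moreover have "\<forall>\<^sub>F y in at x0. y \<in> W" using x open_W eventually_at_topological by blast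
  ultimately have "\<forall>\<^sub>F y in at x0. y \<in> W \<and> (\<forall>i\<in>Basis. \<forall>j\<in>Basis. norm (?E y i j) \<le> e / N * norm (y - x0))"
    by eventually_elim blast
  then obtain d where d: "d > 0" "\<And>y. y \<noteq> x0 \<Longrightarrow> dist y x0 < d \<Longrightarrow>
      y \<in> W \<and> (\<forall>i\<in>Basis. \<forall>j\<in>Basis. norm (?E y i j) \<le> e / N * norm (y - x0))"
    unfolding eventually_at by auto
  \<comment> \<open>The filter \<open>at x0\<close> leaves out \<open>x0\<close> itself, where the
    error is 0.\<close>
  have E0: "?E x0 i j = 0" for i j using linear_0[OF dlevi_linear[OF x]] by simp
  show ?thesis
  proof (intro exI conjI allI impI)
    fix y assume y: "dist x0 y < d"
    have yW: "y \<in> W" using d(2)[of y] y x by (cases "y = x0") (auto simp: dist_commute)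
    have E: "norm (?E y i j) \<le> e / N * norm (y - x0)" if "i \<in> Basis" "j \<in> Basis" for i j
    proof (cases "y = x0")
      case True
      then show ?thesis using E0 by simp
    next
      case False
      then show ?thesis using d(2)[of y] y that by (simp add: dist_commute)
    qed
    show "y \<in> W" by fact
    fix a b
    have "bilinear (?E y)"
      unfolding bilinear_def
      by (intro conjI allI linearI) (simp_all add: levi_simps dlevi_simps x yW algebra_simps)
    then have "norm (?E y a b) \<le> (\<Sum>i\<in>Basis. \<Sum>j\<in>Basis. norm (?E y i j)) * norm a * norm b"
      by (rule bilinear_bound)
    also have "\<dots> \<le> (\<Sum>i\<in>(Basis::'e set). \<Sum>j\<in>(Basis::'e set). e / N * norm (y - x0)) * norm a * norm b"
      by (intro mult_right_mono sum_mono E) auto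
    also have "\<dots> = e * norm (y - x0) * norm a * norm b" using N by (simp add: N_def)
    finally show "norm (?E y a b) \<le> e * norm (y - x0) * norm a * norm b" .
  qed (use d in simp)
qed

lemma dlevi_bound: "x \<in> W \<Longrightarrow> \<exists>K\<ge>0. \<forall>h a b. norm (d\<Gamma> x h a b) \<le> K * norm h * norm a * norm b"
proof -
  assume x: "x \<in> W"
  let ?K = "\<Sum>i\<in>Basis. \<Sum>j\<in>Basis. \<Sum>k\<in>Basis. norm (d\<Gamma> x i j k)"
  have "norm (d\<Gamma> x h a b) \<le> ?K * norm h * norm a * norm b" for h a b
  proof -
    have "norm (d\<Gamma> x h a b) \<le> (\<Sum>i\<in>Basis. norm ((h \<bullet> i) *\<^sub>R d\<Gamma> x i a b))"
      by (subst linear_sum_Basis[OF dlevi_linear[OF x]]) (rule norm_sum)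
    also have "\<dots> \<le> (\<Sum>i\<in>Basis. norm h * ((\<Sum>j\<in>Basis. \<Sum>k\<in>Basis. norm (d\<Gamma> x i j k)) * norm a * norm b))"
      unfolding norm_scaleR
      by (intro sum_mono mult_mono bilinear_bound[OF dlevi_bilinear[OF x]] Basis_le_norm)
        (auto intro!: sum_nonneg mult_nonneg_nonneg)
    finally show ?thesis by (simp add: sum_distrib_left sum_distrib_right mult_ac)
  qed
  moreover have "?K \<ge> 0" by (intro sum_nonneg) auto
  ultimately show ?thesis by blast
qed

lemma levi_locally_bounded:
  assumes x: "x0 \<in> W"
  shows "\<exists>K>0. \<exists>d>0. \<forall>y. dist x0 y < d \<longrightarrow> y \<in> W \<and> (\<forall>a b. norm (\<Gamma> y a b) \<le> K * norm a * norm b)"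
proof -
  obtain d where d: "d > 0" "\<And>y. dist x0 y < d \<Longrightarrow> y \<in> W"
    "\<And>y a b. dist x0 y < d \<Longrightarrow> norm (\<Gamma> y a b - \<Gamma> x0 a b - d\<Gamma> x0 (y - x0) a b) \<le> 1 * norm (y - x0) * norm a * norm b"
    using levi_expansion[OF x zero_less_one] by blast
  obtain K' where K': "K' \<ge> 0" "\<And>h a b. norm (d\<Gamma> x0 h a b) \<le> K' * norm h * norm a * norm b"
    using dlevi_bound[OF x] by blast
  define K0 where "K0 = (\<Sum>i\<in>Basis. \<Sum>j\<in>Basis. norm (\<Gamma> x0 i j))"
  have K0: "norm (\<Gamma> x0 a b) \<le> K0 * norm a * norm b" "K0 \<ge> 0" for a b
    using bilinear_bound[OF levi_bilinear[OF x]] by (auto simp: K0_def intro!: sum_nonneg)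
  have "norm (\<Gamma> y a b) \<le> (K0 + K' * d + d + 1) * norm a * norm b" if y: "dist x0 y < d" for y a b
  proof -
    have n: "norm (y - x0) \<le> d" using y by (simp add: dist_norm norm_minus_commute)
    have "norm (\<Gamma> y a b) \<le> norm (\<Gamma> y a b - \<Gamma> x0 a b - d\<Gamma> x0 (y - x0) a b) + norm (\<Gamma> x0 a b) + norm (d\<Gamma> x0 (y - x0) a b)"
      using norm_triangle_ineq[of "\<Gamma> y a b - \<Gamma> x0 a b - d\<Gamma> x0 (y - x0) a b" "\<Gamma> x0 a b + d\<Gamma> x0 (y - x0) a b"]
        norm_triangle_ineq[of "\<Gamma> x0 a b" "d\<Gamma> x0 (y - x0) a b"] by (simp add: algebra_simps)
    also have "\<dots> \<le> norm (y - x0) * norm a * norm b + K0 * norm a * norm b + K' * norm (y - x0) * norm a * norm b"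
      using d(3)[OF y, of a b] K0(1)[of a b] K'(2)[of a b "y - x0"] by linarith
    also have "\<dots> \<le> d * norm a * norm b + K0 * norm a * norm b + K' * d * norm a * norm b"
      by (intro add_mono mult_right_mono mult_left_mono n K' order_refl) auto
    also have "\<dots> \<le> (K0 + K' * d + d + 1) * norm a * norm b" by (simp add: algebra_simps)
    finally show ?thesis .
  qed
  moreover have "K0 + K' * d + d + 1 > 0" using K0 K' d by (intro add_nonneg_pos add_nonneg_nonneg) auto
  ultimately show ?thesis using d(1,2) by blast
qed

lemma levi_continuous_along:
  assumes "continuous_on S c" "continuous_on S a" "\<And>t. t \<in> S \<Longrightarrow> c t \<in> W"
  shows "continuous_on S (\<lambda>t. \<Gamma> (c t) (a t) w)"
proof -
  have c: "continuous_on W (\<lambda>y. \<Gamma> y i w)" for i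
    using levi_Ck[of 0 i w] by simp
  have "continuous_on S (\<lambda>t. \<Gamma> (c t) i w)" for i
    by (rule continuous_on_compose2[OF c assms(1)]) (use assms(3) in auto)
  then have "continuous_on S (\<lambda>t. \<Sum>i\<in>Basis. (a t \<bullet> i) *\<^sub>R \<Gamma> (c t) i w)"
    by (intro continuous_intros assms(2))
  then show ?thesis
  proof (rule continuous_on_eq)
    show "(\<Sum>i\<in>Basis. (a t \<bullet> i) *\<^sub>R \<Gamma> (c t) i w) = \<Gamma> (c t) (a t) w" if "t \<in> S" for t
      using linear_sum_Basis[of "\<lambda>z. \<Gamma> (c t) z w" "a t"] levi_bilinear[OF assms(3)[OF that]]
      by (simp add: bilinear_def)
  qed
qed

definition loop_parallel :: "'e \<Rightarrow> 'e \<Rightarrow> 'e \<Rightarrow> real \<Rightarrow> (real \<Rightarrow> 'e) \<Rightarrow> bool" where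
  "loop_parallel x0 u v e V \<longleftrightarrow> (\<forall>t\<in>{0..1}.
     (V has_vector_derivative - \<Gamma> (x0 + e *\<^sub>R loop u v t) (e *\<^sub>R loop' u v t) (V t)) (at t within {0..1}))"

lemma loop_near:
  assumes "t \<in> {0..1}" "0 \<le> e" "e * (norm u + norm v) < d"
  shows "dist x0 (x0 + e *\<^sub>R loop u v t) < d"
  using mult_left_mono[OF loop_bounds(1)[OF assms(1)] assms(2), of u v] assms by (simp add: dist_norm)

lemma loop_parallel_exists:
  assumes x: "x0 \<in> W"
  shows "\<exists>e0>0. \<forall>e. 0 < e \<and> e < e0 \<longrightarrow> (\<forall>w. \<exists>V. V 0 = w \<and> loop_parallel x0 u v e V)"
proof -
  obtain K d where K: "K > 0" "d > 0" "\<And>y. dist x0 y < d \<Longrightarrow> y \<in> W"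
    "\<And>y a b. dist x0 y < d \<Longrightarrow> norm (\<Gamma> y a b) \<le> K * norm a * norm b"
    using levi_locally_bounded[OF x] by blast
  define M where "M = norm u + norm v + 1"
  have M: "M > 0" "norm u + norm v \<le> M" by (auto simp: M_def add_nonneg_pos)
  show ?thesis
  \<comment> \<open>The first bound keeps the loop in the ball where \<open>K\<close> controls the
    connection; the second yields the factor one half required by
    \<open>linear_ode_exists\<close>.\<close>
  proof (intro exI[of _ "min (d / M) (1 / (2 * K * M))"] conjI allI impI)
    show "0 < min (d / M) (1 / (2 * K * M))" using K M by simp
    fix e w assume e: "0 < e \<and> e < min (d / M) (1 / (2 * K * M))"
    then have eM: "e * M < d" "K * (e * M) \<le> 1 / 2" using K M by (auto simp: field_simps)
    have "e * (norm u + norm v) \<le> e * M" using M e by (simp add: mult_left_mono)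
    then have near: "dist x0 (x0 + e *\<^sub>R loop u v t) < d" if "t \<in> {0..1}" for t
      using eM(1) e by (intro loop_near that) linarith+
    have inW: "x0 + e *\<^sub>R loop u v t \<in> W" if "t \<in> {0..1}" for t
      using K(3) near[OF that] by blast
    show "\<exists>V. V 0 = w \<and> loop_parallel x0 u v e V"
      unfolding loop_parallel_def
    proof (rule linear_ode_exists)
      fix t :: real assume t: "t \<in> {0..1}"
      show "linear (\<lambda>z. - \<Gamma> (x0 + e *\<^sub>R loop u v t) (e *\<^sub>R loop' u v t) z)"
        by (intro linearI) (simp_all add: levi_simps inW[OF t])
      fix z
      have "norm (- \<Gamma> (x0 + e *\<^sub>R loop u v t) (e *\<^sub>R loop' u v t) z) \<le> K * norm (e *\<^sub>R loop' u v t) * norm z"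
        unfolding norm_minus_cancel by (rule K(4)[OF near[OF t]])
      also have "\<dots> \<le> K * (e * M) * norm z"
        using loop_bounds(2)[OF t, of u v] M e K by (intro mult_right_mono mult_left_mono) auto
      also have "\<dots> \<le> norm z / 2" using mult_right_mono[OF eM(2) norm_ge_zero[of z]] by simp
      finally show "norm (- \<Gamma> (x0 + e *\<^sub>R loop u v t) (e *\<^sub>R loop' u v t) z) \<le> norm z / 2" .
    next
      show "continuous_on {0..1} (\<lambda>t. - \<Gamma> (x0 + e *\<^sub>R loop u v t) (e *\<^sub>R loop' u v t) w)" for w
        by (intro continuous_on_minus levi_continuous_along inW)
          (auto simp: loop_def loop'_def intro!: continuous_intros)
    qed
  qed
qed

text \<open>The gauge-corrected section \<open>V + e \<Gamma>(l, V)\<close> has a derivative of order \<open>e\<^sup>2\<close>, whose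
  leading coefficient is an explicit polynomial in \<open>t\<close>; its integral over the loop is
  a multiple of the curvature.\<close>

lemma loop_parallel_expansion:
  assumes x: "x0 \<in> W" and \<eta>: "\<eta> > 0"
  shows "\<exists>e0>0. \<forall>e V. 0 < e \<and> e < e0 \<and> V 0 = w \<and> loop_parallel x0 u v e V \<longrightarrow>
     norm ((1 / e^2) *\<^sub>R (V 1 - w) + (1/60) *\<^sub>R R x0 u v w) \<le> \<eta>"
proof -
  obtain K d where K: "K > 0" "d > 0" "\<And>y. dist x0 y < d \<Longrightarrow> y \<in> W"
    "\<And>y a b. dist x0 y < d \<Longrightarrow> norm (\<Gamma> y a b) \<le> K * norm a * norm b"
    using levi_locally_bounded[OF x] by blast
  have K0: "norm (\<Gamma> x0 a b) \<le> K * norm a * norm b" for a b using K(4)[of x0] K(2) by simp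
  obtain L where L: "L \<ge> 0" "\<And>h a b. norm (d\<Gamma> x0 h a b) \<le> L * norm h * norm a * norm b"
    using dlevi_bound[OF x] by blast
  define M where "M = norm u + norm v + 1"
  have M: "M > 0" "norm u + norm v \<le> M" by (auto simp: M_def add_nonneg_pos)
  define n where "n = norm w"
  have n: "n \<ge> 0" by (simp add: n_def)
  \<comment> \<open>\<open>C1\<close> and \<open>C2\<close> are read off the final estimate
    \<open>\<eta>1 * C1 + e * C2\<close>; then \<open>\<eta>1\<close> and \<open>e0\<close> are
    chosen to make each summand at most half of \<open>\<eta>\<close>.\<close>
  define C1 where "C1 = M * M * (2 * n) + K * M * (M * M * (2 * n)) + 1"
  define C2 where "C2 = L * M * M * (2 * K * M * n) + K * M * (L * M * M * (2 * n)) + K * M * (K * M * (2 * K * M * n)) + 1"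
  have C: "C1 > 0" "C2 > 0"
    unfolding C1_def C2_def using M K L n by (intro add_nonneg_pos add_nonneg_nonneg mult_nonneg_nonneg; simp)+
  define \<eta>1 where "\<eta>1 = \<eta> / (2 * C1)"
  have \<eta>1: "\<eta>1 > 0" using \<eta> C by (simp add: \<eta>1_def)
  obtain d1 where d1: "d1 > 0" 
    "\<And>y a b. dist x0 y < d1 \<Longrightarrow> norm (\<Gamma> y a b - \<Gamma> x0 a b - d\<Gamma> x0 (y - x0) a b) \<le> \<eta>1 * norm (y - x0) * norm a * norm b"
    using levi_expansion[OF x \<eta>1] by blast
  define e0 where "e0 = min (min (d / M) (d1 / M)) (min (1 / (2 * K * M)) (min 1 (\<eta> / (2 * C2))))"
  \<comment> \<open>At the position and velocity of the loop, \<open>X\<close> is minus the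
    coefficient of \<open>e^2\<close> in the derivative of the corrected section, with
    \<open>V\<close> frozen at \<open>w\<close>. Antisymmetrising \<open>X\<close> gives the
    curvature.\<close>
  define X where "X p q = d\<Gamma> x0 p q w + \<Gamma> x0 p (\<Gamma> x0 q w)" for p q
  have Xb: "X (a *\<^sub>R u + b *\<^sub>R v) (c *\<^sub>R u + d *\<^sub>R v) =
    (a * c) *\<^sub>R X u u + (a * d) *\<^sub>R X u v + (b * c) *\<^sub>R X v u + (b * d) *\<^sub>R X v v" for a b c d
    unfolding X_def by (simp add: levi_simps dlevi_simps x algebra_simps)
  \<comment> \<open>A primitive of minus \<open>X\<close> along the loop. The polynomial with
    coefficients 2/3, -5/4, 3/5 integrates the coefficient
    \<open>(t - t^2) * (2 * t - 3 * t^2)\<close> of \<open>X u v\<close>; that of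
    \<open>X v u\<close> follows by integration by parts. At time 1 they equal 1/60 and -1/60, and
    the other two vanish.\<close>
  define Q where "Q t = - (((t - t^2)^2 / 2) *\<^sub>R X u u + (2 * t^3 / 3 - 5 * t^4 / 4 + 3 * t^5 / 5) *\<^sub>R X u v
     + ((t - t^2) * (t^2 - t^3) - (2 * t^3 / 3 - 5 * t^4 / 4 + 3 * t^5 / 5)) *\<^sub>R X v u + ((t^2 - t^3)^2 / 2) *\<^sub>R X v v)" for t :: real
  have Q': "(Q has_vector_derivative - X (loop u v t) (loop' u v t)) (at t within {0..1})" for t
  proof -
    have p: "((\<lambda>t. p t *\<^sub>R z) has_vector_derivative p' *\<^sub>R z) (at t within {0..1})"
      if "(p has_real_derivative p') (at t within {0..1})" for p p' t and z :: 'e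
      using has_vector_derivative_scaleR[OF that has_vector_derivative_const[of z]] by simp
    show ?thesis
      unfolding loop_def loop'_def Xb Q_def[abs_def]
      by (intro has_vector_derivative_minus has_vector_derivative_add p)
        (auto intro!: derivative_eq_intros simp: field_simps power_numeral_reduce)
  qed
  have Q01: "Q 0 = 0" "Q 1 = - (1/60) *\<^sub>R R x0 u v w"
    unfolding Q_def curv_form_def X_def by (simp_all add: algebra_simps)
  show ?thesis
  proof (intro exI conjI allI impI)
    show "e0 > 0" unfolding e0_def using K M d1 \<eta> C by simp
    fix e V assume asm: "0 < e \<and> e < e0 \<and> V 0 = w \<and> loop_parallel x0 u v e V"
    let ?y = "\<lambda>t. x0 + e *\<^sub>R loop u v t"
    let ?l = "loop u v" and ?l' = "loop' u v"
    have e: "0 < e" "e * M < d" "e * M < d1" "K * (e * M) \<le> 1 / 2" "e \<le> 1" "e * C2 \<le> \<eta> / 2"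
      using asm K M C by (auto simp: e0_def field_simps)
    have e': "e \<noteq> 0" using e by simp
    have "e * (norm u + norm v) \<le> e * M" using M e by (simp add: mult_left_mono)
    then have near: "dist x0 (?y t) < d" "dist x0 (?y t) < d1" if "t \<in> {0..1}" for t
      using e by (intro loop_near that; linarith)+
    have V: "(V has_vector_derivative - \<Gamma> (?y t) (e *\<^sub>R ?l' t) (V t)) (at t within {0..1})" if "t \<in> {0..1}" for t
      using asm that by (simp add: loop_parallel_def)
    have lb: "norm (?l t) \<le> M" "norm (?l' t) \<le> M" if "t \<in> {0..1}" for t
      using loop_bounds[OF that, of u v] M(2) by linarith+
    have A: "norm (- \<Gamma> (?y t) (e *\<^sub>R ?l' t) z) \<le> (K * (e * M)) * norm z" if t: "t \<in> {0..1}" for t z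
    proof -
      have "norm (- \<Gamma> (?y t) (e *\<^sub>R ?l' t) z) \<le> K * norm (e *\<^sub>R ?l' t) * norm z"
        unfolding norm_minus_cancel by (rule K(4)[OF near(1)[OF t]])
      also have "\<dots> \<le> K * (e * M) * norm z"
        using lb[OF t] e K by (intro mult_right_mono mult_left_mono) auto
      finally show ?thesis .
    qed
    have Vb: "norm (V t) \<le> 2 * n" "norm (V t - w) \<le> e * (2 * K * M * n)" if "t \<in> {0..1}" for t
      using linear_ode_bound[of V "\<lambda>t z. - \<Gamma> (?y t) (e *\<^sub>R ?l' t) z", OF V A _ e(4) that] K M e asm
      by (auto simp: n_def mult_ac)
    define Z where "Z t = V t + e *\<^sub>R \<Gamma> x0 (?l t) (V t)" for t
    define Z' where "Z' t = - \<Gamma> (?y t) (e *\<^sub>R ?l' t) (V t) +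
       e *\<^sub>R (\<Gamma> x0 (?l t) (- \<Gamma> (?y t) (e *\<^sub>R ?l' t) (V t)) + \<Gamma> x0 (?l' t) (V t))" for t
    have bb: "bounded_bilinear (\<Gamma> x0)"
      using levi_bilinear[OF x] bilinear_conv_bounded_bilinear by blast
    have Z: "(Z has_vector_derivative Z' t) (at t within {0..1})" if "t \<in> {0..1}" for t
      unfolding Z_def[abs_def] Z'_def
      by (intro has_vector_derivative_add V that
        bounded_bilinear.has_vector_derivative[OF bb] loop_has_vector_derivative
        bounded_linear.has_vector_derivative[OF bounded_linear_scaleR_right])
    \<comment> \<open>At both ends the loop is at 0, where \<open>Z\<close> equals \<open>V\<close>,
      so the increment of \<open>F\<close> is the expression to be estimated and a bound of
      \<open>F'\<close> suffices.\<close>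
    define F where "F t = (1 / e^2) *\<^sub>R Z t - Q t" for t
    define F' where "F' t = (1 / e^2) *\<^sub>R Z' t - (- X (?l t) (?l' t))" for t
    have F: "(F has_vector_derivative F' t) (at t within {0..1})" if "t \<in> {0..1}" for t
      unfolding F_def[abs_def] F'_def
      by (intro has_vector_derivative_diff Z Q' that bounded_linear.has_vector_derivative[OF bounded_linear_scaleR_right])
    have F'b: "norm (F' t) \<le> \<eta>" if t: "t \<in> {0..1}" for t
    proof -
      \<comment> \<open>The Taylor error of the connection, at most \<open>e\<close> times a
        multiple of \<open>\<eta>1\<close>, so that even \<open>(1 / e) *\<^sub>R \<rho>\<close> is
        small. The terms of \<open>F'\<close> containing \<open>V t - w\<close> are of order
        \<open>e\<close>.\<close>
      define \<rho> where "\<rho> = \<Gamma> (?y t) (?l' t) (V t) - \<Gamma> x0 (?l' t) (V t) - d\<Gamma> x0 (e *\<^sub>R ?l t) (?l' t) (V t)"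
      have "norm \<rho> \<le> \<eta>1 * norm (e *\<^sub>R ?l t) * norm (?l' t) * norm (V t)"
        unfolding \<rho>_def using d1(2)[OF near(2)[OF t], of "?l' t" "V t"] by simp
      also have "\<dots> \<le> \<eta>1 * (e * M) * M * (2 * n)"
        using lb[OF t] Vb[OF t] e \<eta>1 M n by (intro mult_mono) auto
      finally have \<rho>: "norm \<rho> \<le> e * (\<eta>1 * (M * M * (2 * n)))" by (simp add: mult_ac)
      define \<sigma> where "\<sigma> = d\<Gamma> x0 (?l t) (?l' t) (V t)"
      have \<sigma>: "norm \<sigma> \<le> L * M * M * (2 * n)"
        unfolding \<sigma>_def using lb[OF t] Vb[OF t] L M n
        by (intro order_trans[OF L(2)] mult_mono mult_nonneg_nonneg) auto
      have yW: "?y t \<in> W" using K(3) near[OF t] by blast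
      have G: "\<Gamma> (?y t) (?l' t) (V t) = \<Gamma> x0 (?l' t) (V t) + \<rho> + e *\<^sub>R \<sigma>"
        unfolding \<rho>_def \<sigma>_def by (simp add: dlevi_simps x)
      have "Z' t = - (e *\<^sub>R \<rho>) - e^2 *\<^sub>R \<sigma> - e^2 *\<^sub>R \<Gamma> x0 (?l t) (\<Gamma> x0 (?l' t) (V t) + \<rho> + e *\<^sub>R \<sigma>)"
        unfolding Z'_def using yW x
        by (simp add: levi_simps G bilinear_rneg[OF levi_bilinear] bilinear_rsub[OF levi_bilinear] scaleR_add_right scaleR_diff_right power2_eq_square)
      then have "(1 / e^2) *\<^sub>R Z' t = - ((1 / e) *\<^sub>R \<rho>) - \<sigma> - \<Gamma> x0 (?l t) (\<Gamma> x0 (?l' t) (V t) + \<rho> + e *\<^sub>R \<sigma>)"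
        using e' by (simp add: scaleR_diff_right power2_eq_square)
      then have "F' t = - ((1 / e) *\<^sub>R \<rho>) - \<sigma> - \<Gamma> x0 (?l t) (\<Gamma> x0 (?l' t) (V t) + (\<rho> + e *\<^sub>R \<sigma>))
          + (d\<Gamma> x0 (?l t) (?l' t) w + \<Gamma> x0 (?l t) (\<Gamma> x0 (?l' t) w))"
        unfolding F'_def X_def by (simp add: add.assoc)
      also have "\<dots> = - ((1 / e) *\<^sub>R \<rho>) - d\<Gamma> x0 (?l t) (?l' t) (V t - w) - \<Gamma> x0 (?l t) (\<rho> + e *\<^sub>R \<sigma>)
          - \<Gamma> x0 (?l t) (\<Gamma> x0 (?l' t) (V t - w))"
        unfolding \<sigma>_def using x
        by (simp add: levi_simps bilinear_rsub[OF levi_bilinear] bilinear_rsub[OF dlevi_bilinear] algebra_simps)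
      finally have F'eq: "F' t = \<dots>" .
      have "norm (F' t) \<le> norm ((1 / e) *\<^sub>R \<rho>) + norm (d\<Gamma> x0 (?l t) (?l' t) (V t - w)) + norm (\<Gamma> x0 (?l t) (\<rho> + e *\<^sub>R \<sigma>))
          + norm (\<Gamma> x0 (?l t) (\<Gamma> x0 (?l' t) (V t - w)))"
        unfolding F'eq by (intro order_trans[OF norm_triangle_ineq4] add_mono) auto
      also have "norm ((1 / e) *\<^sub>R \<rho>) \<le> \<eta>1 * (M * M * (2 * n))"
        using \<rho> e by (simp add: field_simps)
      also have "norm (d\<Gamma> x0 (?l t) (?l' t) (V t - w)) \<le> L * M * M * (e * (2 * K * M * n))"
        using lb[OF t] Vb[OF t] L M n K e
        by (intro order_trans[OF L(2)] mult_mono mult_nonneg_nonneg) auto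
      also have "norm (\<Gamma> x0 (?l t) (\<rho> + e *\<^sub>R \<sigma>)) \<le> K * M * (\<eta>1 * (M * M * (2 * n)) + e * (L * M * M * (2 * n)))"
      proof -
        have "norm (\<rho> + e *\<^sub>R \<sigma>) \<le> e * (\<eta>1 * (M * M * (2 * n))) + e * (L * M * M * (2 * n))"
          using \<rho> \<sigma> e by (intro order_trans[OF norm_triangle_ineq] add_mono) auto
        also have "\<dots> \<le> 1 * (\<eta>1 * (M * M * (2 * n))) + e * (L * M * M * (2 * n))"
          using e \<eta>1 M n by (intro add_mono mult_right_mono order_refl) auto
        finally have "norm (\<rho> + e *\<^sub>R \<sigma>) \<le> \<eta>1 * (M * M * (2 * n)) + e * (L * M * M * (2 * n))" by simp
        then show ?thesis using lb[OF t] K M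
          by (rule_tac order_trans[OF K0]) (intro mult_mono mult_nonneg_nonneg, auto)
      qed
      also have "norm (\<Gamma> x0 (?l t) (\<Gamma> x0 (?l' t) (V t - w))) \<le> K * M * (K * M * (e * (2 * K * M * n)))"
      proof -
        have "norm (\<Gamma> x0 (?l' t) (V t - w)) \<le> K * M * (e * (2 * K * M * n))"
          using lb[OF t] Vb[OF t] K M by (intro order_trans[OF K0] mult_mono mult_nonneg_nonneg) auto
        then show ?thesis using lb[OF t] K M
          by (rule_tac order_trans[OF K0]) (intro mult_mono mult_nonneg_nonneg, auto)
      qed
      finally have "norm (F' t) \<le> \<eta>1 * C1 + e * C2"
        using \<eta>1 e by (simp add: C1_def C2_def algebra_simps)
      also have "\<dots> \<le> \<eta> / 2 + \<eta> / 2" using C e by (intro add_mono) (auto simp: \<eta>1_def)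
      finally show ?thesis by simp
    qed
    have "norm (F 1 - F 0) \<le> \<eta>" by (rule vector_derivative_bound[OF F F'b]) auto
    moreover have "F 1 - F 0 = (1 / e^2) *\<^sub>R (V 1 - w) + (1/60) *\<^sub>R R x0 u v w"
      unfolding F_def Z_def using asm Q01 bilinear_lzero[OF levi_bilinear[OF x]] by (simp add: scaleR_diff_right)
    ultimately show "norm ((1 / e^2) *\<^sub>R (V 1 - w) + (1/60) *\<^sub>R R x0 u v w) \<le> \<eta>" by simp
  qed
qed

end


section \<open>Curvature tensors commuting with a quaternionic structure up to its span\<close>

definition orth_map :: "('v::euclidean_space \<Rightarrow> 'v) \<Rightarrow> bool" where
  "orth_map F \<longleftrightarrow> linear F \<and> (\<forall>x y. F x \<bullet> F y = x \<bullet> y)"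

text \<open>Orthogonality makes \<open>F\<close> composed with its adjoint the identity, which is
  \<open>key\<close>. Traces may thus be computed in the image of the basis under \<open>I\<close>,
  under \<open>J\<close> or under an orthonormal frame.\<close>

lemma trace_orth_map:
  fixes B :: "'v::euclidean_space \<Rightarrow> 'v \<Rightarrow> real"
  assumes B: "bilinear B" and F: "orth_map F"
  shows "(\<Sum>j\<in>Basis. B (F j) (F j)) = (\<Sum>j\<in>Basis. B j j)"
proof -
  have lF: "linear F" and oF: "F x \<bullet> F y = x \<bullet> y" for x y using F by (auto simp: orth_map_def)
  have "inj F" using oF by (metis (no_types, lifting) inner_eq_zero_iff inner_diff_right inner_diff_left right_minus_eq injI)
  then have sF: "surj F" using lF linear_injective_imp_surjective by blast
  have adj: "F x \<bullet> y = x \<bullet> adjoint F y" for x y using adjoint_works[OF lF] by simp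
  have FA: "F (adjoint F y) = y" for y
  proof -
    obtain z where "y = F z" using sF by blast
    moreover have "adjoint F (F z) = z" for z
      by (rule vector_eq_rdot[THEN iffD1]) (metis adj oF inner_commute)
    ultimately show ?thesis by simp
  qed
  have key: "(\<Sum>j\<in>Basis. (F j \<bullet> k) * (F j \<bullet> l)) = k \<bullet> l" for k l
  proof -
    have "F j \<bullet> y = adjoint F y \<bullet> j" for j y unfolding adj by (rule inner_commute)
    then have "(\<Sum>j\<in>Basis. (F j \<bullet> k) * (F j \<bullet> l)) = (\<Sum>j\<in>Basis. (adjoint F k \<bullet> j) * (adjoint F l \<bullet> j))"
      by presburger
    also have "\<dots> = adjoint F k \<bullet> adjoint F l" by (rule euclidean_inner[symmetric])
    also have "\<dots> = k \<bullet> l" using oF[of "adjoint F k" "adjoint F l"] by (simp add: FA)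
    finally show ?thesis .
  qed
  have "(\<Sum>j\<in>Basis. B (F j) (F j)) =
    (\<Sum>j\<in>(Basis::'v set). \<Sum>k\<in>Basis. \<Sum>l\<in>Basis. (F j \<bullet> k) * (F j \<bullet> l) * B k l)"
    by (subst bilinear_sum_Basis[OF B]) simp
  also have "\<dots> = (\<Sum>k\<in>Basis. \<Sum>l\<in>Basis. \<Sum>j\<in>(Basis::'v set). (F j \<bullet> k) * (F j \<bullet> l) * B k l)"
    by (rule trans[OF sum.swap sum.cong[OF refl sum.swap]])
  also have "\<dots> = (\<Sum>k\<in>Basis. \<Sum>l\<in>Basis. (k \<bullet> l) * B k l)"
    by (simp add: sum_distrib_right[symmetric] key)
  also have "\<dots> = (\<Sum>k\<in>Basis. B k k)"
    by (intro sum.cong refl) (simp add: inner_Basis if_distrib[of "\<lambda>x. x * _"] cong: if_cong)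
  finally show ?thesis .
qed

section \<open>Algebraic curvature tensors and their Ricci form\<close>

locale curvature_tensor =
  fixes R :: "'v::euclidean_space \<Rightarrow> 'v \<Rightarrow> 'v \<Rightarrow> 'v"
  assumes lin1: "linear (\<lambda>u. R u v w)" and lin2: "linear (\<lambda>v. R u v w)" and lin3: "linear (R u v)"
    and antisym: "R u v w = - R v u w"
    and bianchi: "R u v w + R v w u + R w u v = 0"
    and skew: "R u v w \<bullet> z = - (R u v z \<bullet> w)"
begin

text \<open>The octahedron argument: four instances of the Bianchi identity, one for each cyclic
  shift of \<open>a\<close>, \<open>b\<close>, \<open>c\<close>, \<open>d\<close>; the two skew
  symmetries cancel the remaining terms.\<close>

lemma pair_sym: "R a b c \<bullet> d = R c d a \<bullet> b"
proof -
  have B: "R u v w \<bullet> z + R v w u \<bullet> z + R w u v \<bullet> z = 0" for u v w z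
    using bianchi[of u v w] by (metis inner_add_left inner_zero_left)
  have A: "R u v w \<bullet> z = - (R v u w \<bullet> z)" for u v w z by (subst antisym) simp
  have "R a b c \<bullet> d + R b c a \<bullet> d + R c a b \<bullet> d = 0" "R b c d \<bullet> a + R c d b \<bullet> a + R d b c \<bullet> a = 0"
    "R c d a \<bullet> b + R d a c \<bullet> b + R a c d \<bullet> b = 0" "R d a b \<bullet> c + R a b d \<bullet> c + R b d a \<bullet> c = 0"
    using B by blast+
  moreover have "R a b d \<bullet> c = - (R a b c \<bullet> d)" "R b c d \<bullet> a = - (R b c a \<bullet> d)" "R c d b \<bullet> a = - (R c d a \<bullet> b)"
    "R d a c \<bullet> b = - (R d a b \<bullet> c)" using skew by blast+
  moreover have "R c a b \<bullet> d = - (R a c b \<bullet> d)" "R a c d \<bullet> b = - (R a c b \<bullet> d)"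
    "R d b c \<bullet> a = - (R b d c \<bullet> a)" "R b d a \<bullet> c = - (R b d c \<bullet> a)" using A skew by blast+
  ultimately show ?thesis by linarith
qed

lemmas R_simps = linear_add[OF lin1] linear_add[OF lin2] linear_add[OF lin3]
  linear_cmul[OF lin1] linear_cmul[OF lin2] linear_cmul[OF lin3]
  linear_diff[OF lin1] linear_diff[OF lin2] linear_diff[OF lin3]
  linear_neg[OF lin1] linear_neg[OF lin2] linear_neg[OF lin3]
  linear_0[OF lin1] linear_0[OF lin2] linear_0[OF lin3]

definition Ric :: "'v \<Rightarrow> 'v \<Rightarrow> real" where
  "Ric u w = (\<Sum>j\<in>Basis. R u j j \<bullet> w)"

lemma Ric_orth_map: "orth_map F \<Longrightarrow> (\<Sum>j\<in>Basis. R u (F j) (F j) \<bullet> w) = Ric u w"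
  unfolding Ric_def
  by (rule trace_orth_map) (auto simp: bilinear_def R_simps inner_add_left intro!: linearI)

lemma Ric_sym: "Ric u w = Ric w u"
proof -
  have "R u j j \<bullet> w = R w j j \<bullet> u" for j
    using pair_sym[of u j j w] antisym[of j w u] skew[of w j u j] by simp
  then show ?thesis unfolding Ric_def by simp
qed

end

text \<open>The third unit K is not a parameter; it appears as \<open>I (J x)\<close>.\<close>

locale quaternionic_structure =
  fixes I J :: "'v::euclidean_space \<Rightarrow> 'v"
  assumes orth_I: "orth_map I" and orth_J: "orth_map J"
    and I_sq: "I (I x) = - x" and J_sq: "J (J x) = - x" and JI: "J (I x) = - I (J x)"
begin

lemma IJ_linear: "linear I" "linear J" using orth_I orth_J by (auto simp: orth_map_def)

lemmas IJ_simps = I_sq J_sq JI linear_add[OF IJ_linear(1)] linear_add[OF IJ_linear(2)]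
  linear_cmul[OF IJ_linear(1)] linear_cmul[OF IJ_linear(2)] linear_neg[OF IJ_linear(1)] linear_neg[OF IJ_linear(2)]
  linear_diff[OF IJ_linear(1)] linear_diff[OF IJ_linear(2)] linear_0[OF IJ_linear(1)] linear_0[OF IJ_linear(2)]

lemma I_skew: "I x \<bullet> y = - (x \<bullet> I y)"
proof -
  have "I x \<bullet> y = I (I x) \<bullet> I y" using orth_I by (simp add: orth_map_def)
  then show ?thesis by (simp add: I_sq)
qed

lemma J_skew: "J x \<bullet> y = - (x \<bullet> J y)"
proof -
  have "J x \<bullet> y = J (J x) \<bullet> J y" using orth_J by (simp add: orth_map_def)
  then show ?thesis by (simp add: J_sq)
qed

lemma frame_inner:
  "x \<bullet> I x = 0" "I x \<bullet> x = 0" "x \<bullet> J x = 0" "J x \<bullet> x = 0" "x \<bullet> I (J x) = 0" "I (J x) \<bullet> x = 0"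
  "I x \<bullet> I x = x \<bullet> x" "J x \<bullet> J x = x \<bullet> x" "I x \<bullet> J x = 0" "J x \<bullet> I x = 0"
  "I (J x) \<bullet> I (J x) = x \<bullet> x" "I x \<bullet> I (J x) = 0" "I (J x) \<bullet> I x = 0" "J x \<bullet> I (J x) = 0" "I (J x) \<bullet> J x = 0"
proof -
  show 1: "x \<bullet> I x = 0" "I x \<bullet> x = 0" for x using I_skew[of x x] by (simp_all add: inner_commute)
  show 2: "x \<bullet> J x = 0" "J x \<bullet> x = 0" for x using J_skew[of x x] by (simp_all add: inner_commute)
  show 3: "I x \<bullet> I x = x \<bullet> x" "J x \<bullet> J x = x \<bullet> x" for x using orth_I orth_J by (auto simp: orth_map_def)
  show 4: "I x \<bullet> J x = 0" for x
    using I_skew[of x "J x"] J_skew[of "I x" x] by (simp add: JI inner_commute)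
  then show "J x \<bullet> I x = 0" "x \<bullet> I (J x) = 0" "I (J x) \<bullet> x = 0" using I_skew[of x "J x"] by (simp_all add: inner_commute)
  show "I (J x) \<bullet> I (J x) = x \<bullet> x" by (simp add: 3)
  show "I x \<bullet> I (J x) = 0" "I (J x) \<bullet> I x = 0" using orth_I 2 by (simp_all add: orth_map_def)
  show "J x \<bullet> I (J x) = 0" "I (J x) \<bullet> J x = 0" using 1 by blast+
qed

text \<open>A dimension count against the four vectors spanning the quaternionic line of
  \<open>N\<close>. This is where m >= 2 enters.\<close>

lemma dim_gt_4_orthogonal:
  fixes N :: 'v
  assumes "DIM('v) > 4"
  shows "\<exists>z::'v. z \<noteq> 0 \<and> z \<bullet> N = 0 \<and> z \<bullet> I N = 0 \<and> z \<bullet> J N = 0 \<and> z \<bullet> I (J N) = 0"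
proof -
  let ?S = "{N, I N, J N, I (J N)}"
  have "dim ?S \<le> card ?S" by (rule dim_le_card') simp
  also have "\<dots> \<le> 4" by (simp add: card_insert_if)
  finally have "dim ?S < DIM('v)" using assms by linarith
  then obtain z :: 'v where z: "z \<noteq> 0" "\<And>y. y \<in> span ?S \<Longrightarrow> orthogonal z y"
    using orthogonal_to_subspace_exists by metis
  have "z \<bullet> y = 0" if "y \<in> ?S" for y
    using z(2)[OF span_base[OF that]] by (simp add: orthogonal_def)
  then show ?thesis using z(1) by blast
qed

end

locale quaternionic_curvature = curvature_tensor R + quaternionic_structure I J
  for R :: "'v::euclidean_space \<Rightarrow> 'v \<Rightarrow> 'v \<Rightarrow> 'v" and I J :: "'v \<Rightarrow> 'v" +
  assumes comm_I: "\<exists>p q r. \<forall>w. R u v (I w) - I (R u v w) = p *\<^sub>R I w + q *\<^sub>R J w + r *\<^sub>R I (J w)"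
    and comm_J: "\<exists>p q r. \<forall>w. R u v (J w) - J (R u v w) = p *\<^sub>R I w + q *\<^sub>R J w + r *\<^sub>R I (J w)"
begin

text \<open>Commuting with the skew map \<open>R u v\<close> is a derivation on the span of I, J, K
  that preserves inner products infinitesimally, hence a skew map of a three-dimensional space, with
  three coefficients. They are compared at the nonzero vector \<open>z\<close>.\<close>

lemma commutators:
  fixes z :: 'v
  assumes "z \<noteq> 0"
  shows "\<exists>a b c. (\<forall>w. R u v (I w) = I (R u v w) + c *\<^sub>R J w - b *\<^sub>R I (J w)) \<and>
     (\<forall>w. R u v (J w) = J (R u v w) - c *\<^sub>R I w + a *\<^sub>R I (J w))"
proof -
  obtain p1 p2 p3 where p: "\<And>w. R u v (I w) - I (R u v w) = p1 *\<^sub>R I w + p2 *\<^sub>R J w + p3 *\<^sub>R I (J w)"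
    using comm_I by blast
  obtain q1 q2 q3 where q: "\<And>w. R u v (J w) - J (R u v w) = q1 *\<^sub>R I w + q2 *\<^sub>R J w + q3 *\<^sub>R I (J w)"
    using comm_J by blast
  have 0: "R u v w \<bullet> w = 0" for w using skew[of u v w w] by simp
  have z: "z \<bullet> z \<noteq> 0" using assms by simp
  have "(R u v (I z) - I (R u v z)) \<bullet> I z = 0"
    using 0 orth_I by (simp add: inner_diff_left orth_map_def)
  then have p1: "p1 = 0" unfolding p using z by (simp add: inner_add_left frame_inner)
  have "(R u v (J z) - J (R u v z)) \<bullet> J z = 0"
    using 0 orth_J by (simp add: inner_diff_left orth_map_def)
  then have q2: "q2 = 0" unfolding q using z by (simp add: inner_add_left frame_inner)
  have "(R u v (I z) - I (R u v z)) \<bullet> J z + (R u v (J z) - J (R u v z)) \<bullet> I z = 0"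
    using skew[of u v "I z" "J z"] I_skew[of "R u v z" "J z"] J_skew[of "R u v z" "I z"]
    by (simp add: inner_diff_left JI)
  then have "p2 + q1 = 0" unfolding p q using z
    by (simp add: inner_add_left frame_inner flip: distrib_right)
  then have q1: "q1 = - p2" by simp
  show ?thesis
  proof (intro exI conjI allI)
    show "R u v (I w) = I (R u v w) + p2 *\<^sub>R J w - (- p3) *\<^sub>R I (J w)" for w
      using p[of w] p1 by (simp add: algebra_simps)
    show "R u v (J w) = J (R u v w) - p2 *\<^sub>R I w + q3 *\<^sub>R I (J w)" for w
      using q[of w] q1 q2 by (simp add: algebra_simps)
  qed
qed

text \<open>The trace of \<open>I\<close> composed with \<open>R(u, v)\<close> vanishes, as \<open>J\<close> anticommutes with \<open>I\<close>; the Bianchi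
  identity turns this trace into a combination of Ricci curvatures.\<close>

lemma Ric_eq_0:
  assumes I: "\<And>u v w. R u v (I w) = I (R u v w)" and J: "\<And>u v w. R u v (J w) = J (R u v w)"
  shows "Ric u w = 0"
proof -
  have tr: "(\<Sum>j\<in>Basis. R u v j \<bullet> I j) = 0" for u v
  proof -
    have bil: "bilinear (\<lambda>a b. R u v a \<bullet> I b)"
      by (auto simp: bilinear_def R_simps IJ_simps inner_add_left inner_add_right intro!: linearI)
    have "(\<Sum>j\<in>Basis. R u v (J j) \<bullet> I (J j)) = (\<Sum>j\<in>Basis. R u v j \<bullet> I j)"
      by (rule trace_orth_map[OF bil orth_J])
    moreover have "R u v (J j) \<bullet> I (J j) = - (R u v j \<bullet> I j)" for j
      using orth_J by (simp add: J orth_map_def flip: JI[of j, THEN arg_cong[where f = uminus], simplified])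
    ultimately show ?thesis by (simp add: sum_negf)
  qed
  have Ric_I: "Ric v (I u) = Ric u (I v)" for u v
  proof -
    have "R u v j \<bullet> I j = R v j j \<bullet> I u * (-1) + R u j j \<bullet> I v" for j
    proof -
      have "R u v j \<bullet> I j + R v j u \<bullet> I j + R j u v \<bullet> I j = 0"
        using bianchi[of u v j] by (metis inner_add_left inner_zero_left)
      moreover have "R v j u \<bullet> I j = R v j j \<bullet> I u"
        using I_skew[of "R v j u" j] skew[of v j "I u" j] by (simp add: I)
      moreover have "R j u v \<bullet> I j = - (R u j j \<bullet> I v)"
        using I_skew[of "R j u v" j] skew[of j u "I v" j] antisym[of j u j] by (simp add: I)
      ultimately show ?thesis by simp
    qed
    then show ?thesis using tr[of u v] unfolding Ric_def by (simp add: sum_subtractf)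
  qed
  \<comment> \<open>Pair symmetry moves the commutation rule from the third slot of \<open>R\<close>
    to the first two.\<close>
  have RI: "R (I u) (I v) w = R u v w" for u v w
  proof (rule vector_eq_rdot[THEN iffD1], rule allI)
    fix z
    have "R (I u) (I v) w \<bullet> z = I (R w z u) \<bullet> I v" using pair_sym[of "I u" "I v" w z] by (simp add: I)
    also have "\<dots> = R u v w \<bullet> z" using orth_I pair_sym[of w z u v] by (simp add: orth_map_def)
    finally show "R (I u) (I v) w \<bullet> z = R u v w \<bullet> z" .
  qed
  \<comment> \<open>In the basis rotated by \<open>I\<close> the Ricci form turns out to be
    invariant under \<open>I\<close>, while \<open>Ric_I\<close> makes it change sign.\<close>
  have "Ric (I u) (I w) = (\<Sum>j\<in>Basis. R (I u) (I j) (I j) \<bullet> I w)"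
    by (rule Ric_orth_map[OF orth_I, symmetric])
  also have "\<dots> = Ric u w" unfolding Ric_def RI I using orth_I by (simp add: orth_map_def)
  finally have "Ric (I u) (I w) = Ric u w" .
  moreover have "Ric (I u) (I w) = - Ric u w"
  proof -
    have "Ric (I u) (I w) = Ric w (I (I u))" by (rule Ric_I)
    also have "\<dots> = - Ric w u" by (simp add: I_sq Ric_def sum_negf)
    finally show ?thesis by (simp add: Ric_sym)
  qed
  ultimately show ?thesis by simp
qed

theorem Ric_eq_0_if_kills_normal:
  assumes dim: "DIM('v) > 4" and N: "N \<bullet> N = 1"
    and kill: "\<And>X Y. X \<bullet> N = 0 \<Longrightarrow> Y \<bullet> N = 0 \<Longrightarrow> R X Y N = 0"
  shows "Ric u w = 0"
proof -
  let ?K = "\<lambda>x. I (J x)"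
  obtain z where z: "z \<noteq> 0" "z \<bullet> N = 0" "z \<bullet> I N = 0" "z \<bullet> J N = 0" "z \<bullet> ?K N = 0"
    using dim_gt_4_orthogonal[OF dim] by blast
  obtain a b c where RI: "\<And>u v w. R u v (I w) = I (R u v w) + c u v *\<^sub>R J w - b u v *\<^sub>R ?K w"
    and RJ: "\<And>u v w. R u v (J w) = J (R u v w) - c u v *\<^sub>R I w + a u v *\<^sub>R ?K w"
    using commutators[OF z(1)] by metis
  have RK: "R u v (?K w) = ?K (R u v w) + b u v *\<^sub>R I w - a u v *\<^sub>R J w" for u v w
    unfolding RI RJ by (simp add: IJ_simps)
  define D where "D = {x. x \<bullet> N = 0 \<and> x \<bullet> I N = 0 \<and> x \<bullet> J N = 0 \<and> x \<bullet> ?K N = 0}"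
  have zD: "z \<in> D" using z by (simp add: D_def)
  \<comment> \<open>As \<open>R X Y\<close> kills \<open>N\<close>, the commutator relations at
    \<open>N\<close> show that it maps the quaternionic line of \<open>N\<close> to itself. Being
    skew, it then preserves \<open>D\<close> as well.\<close>
  have HN: "R X Y (I N) = c X Y *\<^sub>R J N - b X Y *\<^sub>R ?K N" "R X Y (J N) = a X Y *\<^sub>R ?K N - c X Y *\<^sub>R I N"
    "R X Y (?K N) = b X Y *\<^sub>R I N - a X Y *\<^sub>R J N"
    if "X \<bullet> N = 0" "Y \<bullet> N = 0" for X Y
    using kill[OF that] by (simp_all only: RI RJ RK IJ_simps) simp_all
  have pres: "R X Y Z \<in> D" if "X \<bullet> N = 0" "Y \<bullet> N = 0" "Z \<in> D" for X Y Z
    using skew[of X Y Z N] skew[of X Y Z "I N"] skew[of X Y Z "J N"] skew[of X Y Z "?K N"] that(3)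
    unfolding HN[OF that(1,2)] kill[OF that(1,2)]
    by (simp add: D_def inner_diff_right inner_commute)
  have HNperp: "I N \<bullet> N = 0" "J N \<bullet> N = 0" "?K N \<bullet> N = 0" by (simp_all add: frame_inner)
  have D0: "X \<bullet> N = 0" if "X \<in> D" for X using that by (simp add: D_def)
  \<comment> \<open>The other two terms of the Bianchi sum apply operators with tangent arguments to
    elements of \<open>D\<close>, so they lie in \<open>D\<close> and are orthogonal to
    \<open>Q\<close>.\<close>
  have bi: "R X Y P \<bullet> Q = 0" if "X \<in> D" "Y \<in> D" "P \<bullet> N = 0" "Q \<in> {I N, J N, ?K N}" for X Y P Q
  proof -
    have "R Y P X \<in> D" "R P X Y \<in> D" using that D0 by (auto intro!: pres)
    moreover have "R X Y P \<bullet> Q + R Y P X \<bullet> Q + R P X Y \<bullet> Q = 0"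
      using bianchi[of X Y P] by (metis inner_add_left inner_zero_left)
    ultimately show ?thesis using that(4) by (auto simp: D_def)
  qed
  \<comment> \<open>\<open>R P Q X\<close> lies in \<open>D\<close>, so it can be tested against
    itself; pair symmetry reduces this product to \<open>bi\<close>.\<close>
  have kD: "R P Q X = 0" if "P \<in> {I N, J N, ?K N}" "Q \<in> {I N, J N, ?K N}" "X \<in> D" for P Q X
  proof -
    have PQ: "P \<bullet> N = 0" "Q \<bullet> N = 0" using that HNperp by auto
    have "R P Q X \<in> D" using pres[OF PQ that(3)] .
    then have "R P Q X \<bullet> R P Q X = 0"
      using pair_sym[of P Q X "R P Q X"] bi[OF that(3) _ PQ(1) that(2)] by simp
    then show ?thesis by simp
  qed
  have IzD: "I z \<in> D" "J z \<in> D" "?K z \<in> D"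
    using z I_skew[of z] J_skew[of z] I_skew[of "J z"] by (simp_all add: D_def IJ_simps)
  have zz: "z \<bullet> z \<noteq> 0" using z by simp
  \<comment> \<open>At \<open>z\<close> the commutators are combinations of \<open>I z\<close>,
    \<open>J z\<close>, \<open>?K z\<close>, all in \<open>D\<close>, so a value in the line of
    \<open>N\<close> forces the coefficients to vanish. Used for \<open>R P Q\<close> with the value
    0, and for \<open>R N X\<close>.\<close>
  have abc0: "a u v = 0 \<and> b u v = 0 \<and> c u v = 0"
    if "R u v (I z) - I (R u v z) = p *\<^sub>R N + q *\<^sub>R I N" "R u v (J z) - J (R u v z) = r *\<^sub>R N + s *\<^sub>R J N" for u v p q r s
  proof -
    have "(R u v (I z) - I (R u v z)) \<bullet> J z = 0" "(R u v (I z) - I (R u v z)) \<bullet> ?K z = 0"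
      "(R u v (J z) - J (R u v z)) \<bullet> ?K z = 0"
      unfolding that using IzD by (simp_all add: D_def inner_add_right inner_commute)
    then show ?thesis unfolding RI RJ using zz by (simp add: inner_add_left inner_diff_left frame_inner)
  qed
  have PQ0: "R P Q X = 0" if "P \<in> {I N, J N, ?K N}" "Q \<in> {I N, J N, ?K N}" for P Q X
  proof -
    have PQ: "P \<bullet> N = 0" "Q \<bullet> N = 0" using that HNperp by auto
    have "a P Q = 0 \<and> b P Q = 0 \<and> c P Q = 0"
      using abc0[of P Q 0 0 0 0] kD[OF that zD] kD[OF that IzD(1)] kD[OF that IzD(2)] by (simp add: IJ_simps)
    then have h: "R P Q (I N) = 0" "R P Q (J N) = 0" "R P Q (?K N) = 0" "R P Q N = 0"
      using HN[OF PQ] kill[OF PQ] by simp_all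
    define Z where "Z = X - (X \<bullet> N) *\<^sub>R N - (X \<bullet> I N) *\<^sub>R I N - (X \<bullet> J N) *\<^sub>R J N - (X \<bullet> ?K N) *\<^sub>R ?K N"
    have "Z \<in> D" unfolding Z_def D_def by (simp add: inner_diff_left frame_inner N)
    then have "R P Q Z = 0" using kD[OF that] by blast
    then show ?thesis unfolding Z_def by (simp add: R_simps h)
  qed
  have abc_perp: "a X Y = 0 \<and> b X Y = 0 \<and> c X Y = 0" if XY: "X \<bullet> N = 0" "Y \<bullet> N = 0" for X Y
  proof -
    have "R X Y P \<bullet> Q = 0" if "P \<in> {I N, J N, ?K N}" "Q \<in> {I N, J N, ?K N}" for P Q
      using pair_sym[of X Y P Q] PQ0[OF that] by simp
    \<comment> \<open>By \<open>HN\<close> these products are \<open>c\<close>, \<open>b\<close> and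
      \<open>a\<close> up to sign.\<close>
    then have "R X Y (I N) \<bullet> J N = 0" "R X Y (I N) \<bullet> ?K N = 0" "R X Y (J N) \<bullet> ?K N = 0" by blast+
    then show ?thesis unfolding HN[OF XY] by (simp add: inner_diff_left frame_inner N)
  qed
  have normal: "R N X Y = 0" if X: "X \<bullet> N = 0" for X Y
  proof -
    \<comment> \<open>For tangent \<open>Y\<close> and \<open>Z\<close> pair symmetry gives
      \<open>R N X Y \<bullet> Z = R Y Z N \<bullet> X = 0\<close>, so only the component along
      \<open>N\<close> survives.\<close>
    have rank: "R N X Y = (R N X Y \<bullet> N) *\<^sub>R N" if Y: "Y \<bullet> N = 0" for Y
    proof -
      define Z where "Z = R N X Y - (R N X Y \<bullet> N) *\<^sub>R N"
      have ZN: "Z \<bullet> N = 0" by (simp add: Z_def inner_diff_left N)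
      have "R N X Y \<bullet> Z = 0" using pair_sym[of N X Y Z] kill[OF Y ZN] by simp
      moreover have "R N X Y = Z + (R N X Y \<bullet> N) *\<^sub>R N" by (simp add: Z_def)
      ultimately have "Z \<bullet> Z = 0" using ZN by (metis add.right_neutral inner_add_left inner_commute inner_scaleR_left mult_zero_right)
      then show ?thesis by (simp add: Z_def)
    qed
    have Izp: "z \<bullet> N = 0" "I z \<bullet> N = 0" "J z \<bullet> N = 0" using z IzD by (simp_all add: D_def)
    have "a N X = 0 \<and> b N X = 0 \<and> c N X = 0"
    proof (rule abc0)
      show "R N X (I z) - I (R N X z) = (R N X (I z) \<bullet> N) *\<^sub>R N + (- (R N X z \<bullet> N)) *\<^sub>R I N"
        using rank[OF Izp(1)] rank[OF Izp(2)] by (metis IJ_simps(6) diff_conv_add_uminus scaleR_minus_left)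
      show "R N X (J z) - J (R N X z) = (R N X (J z) \<bullet> N) *\<^sub>R N + (- (R N X z \<bullet> N)) *\<^sub>R J N"
        using rank[OF Izp(1)] rank[OF Izp(3)] by (metis IJ_simps(7) diff_conv_add_uminus scaleR_minus_left)
    qed
    then have "I (R N X N) = R N X (I N)" "J (R N X N) = R N X (J N)" by (simp_all add: RI RJ)
    \<comment> \<open>Both \<open>I\<close> and \<open>J\<close> send \<open>R N X N\<close> to
      multiples of \<open>N\<close>, so it is a multiple of \<open>I N\<close> and of
      \<open>J N\<close> at once, and these are orthogonal.\<close>
    then obtain s t where "I (R N X N) = s *\<^sub>R N" "J (R N X N) = t *\<^sub>R N"
      using rank[OF HNperp(1)] rank[OF HNperp(2)] by metis
    then have v: "R N X N = (- s) *\<^sub>R I N" "R N X N = (- t) *\<^sub>R J N"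
      using I_sq[of "R N X N"] J_sq[of "R N X N"]
      by (metis IJ_simps(6) minus_minus scaleR_minus_left, metis IJ_simps(7) minus_minus scaleR_minus_left)
    have "R N X N \<bullet> I N = - s" unfolding v(1) by (simp add: frame_inner N)
    moreover have "R N X N \<bullet> I N = 0" unfolding v(2) by (simp add: frame_inner)
    ultimately have RN: "R N X N = 0" using v(1) by simp
    \<comment> \<open>On the tangent part the remaining component \<open>R N X Z \<bullet> N\<close>
      is minus \<open>R N X N \<bullet> Z\<close>, which is 0.\<close>
    define Z where "Z = Y - (Y \<bullet> N) *\<^sub>R N"
    have "Z \<bullet> N = 0" by (simp add: Z_def inner_diff_left N)
    from rank[OF this] have "R N X Z = 0" using skew[of N X Z N] RN by simp
    then show ?thesis by (simp add: Z_def R_simps RN)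
  qed
  have comm: "R u v (I w) = I (R u v w) \<and> R u v (J w) = J (R u v w)" for u v w
  proof -
    \<comment> \<open>Terms with \<open>N\<close> in one of the first two slots vanish by
      \<open>normal\<close> and antisymmetry, so \<open>R u v\<close> only depends on the tangent
      parts of \<open>u\<close> and \<open>v\<close>.\<close>
    define X Y where "X = u - (u \<bullet> N) *\<^sub>R N" and "Y = v - (v \<bullet> N) *\<^sub>R N"
    have XY: "X \<bullet> N = 0" "Y \<bullet> N = 0" by (simp_all add: X_def Y_def inner_diff_left N)
    have "2 *\<^sub>R R N N w = 0" for w
      unfolding scaleR_2 using antisym[of N N w] by (metis add.left_inverse)
    then have "R N N w = 0" for w by simp
    then have "R u v w = R X Y w" for w
      using normal[OF XY(1), of w] normal[OF XY(2), of w] antisym[of X N w]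
      unfolding X_def Y_def by (simp add: R_simps)
    then have "R u v = R X Y" by blast
    then show ?thesis using abc_perp[OF XY] RI[of X Y w] RJ[of X Y w] by simp
  qed
  show ?thesis using Ric_eq_0 comm by blast
qed

end


section \<open>Charts and tangent vectors\<close>

locale manifold_charts =
  fixes M :: "('a, 'e::euclidean_space) manifold"
  assumes mfd: "smooth_manifold M"
begin

lemma chart_openin: "c \<in> atlas M \<Longrightarrow> openin (mtop M) (fst c)"
  and chart_open: "c \<in> atlas M \<Longrightarrow> open (snd c ` fst c)"
  and chart_homeo: "c \<in> atlas M \<Longrightarrow>
    homeomorphic_map (subtopology (mtop M) (fst c)) (top_of_set (snd c ` fst c)) (snd c)"
  and transition_smooth: "c \<in> atlas M \<Longrightarrow> c' \<in> atlas M \<Longrightarrow> smooth_on (snd c ` (fst c \<inter> fst c')) (snd c' \<circ> cinv c)"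
  and points_charts: "points M = (\<Union>c\<in>atlas M. fst c)"
  using mfd unfolding smooth_manifold_def by blast+

lemma charts_at_iff: "c \<in> charts_at M p \<longleftrightarrow> c \<in> atlas M \<and> p \<in> fst c"
  by (simp add: charts_at_def)

lemma chart_at_charts_at: "p \<in> points M \<Longrightarrow> chart_at M p \<in> charts_at M p"
  unfolding chart_at_def by (rule someI_ex) (use points_charts in \<open>auto simp: charts_at_def\<close>)

lemma chart_topspace: "c \<in> atlas M \<Longrightarrow> topspace (subtopology (mtop M) (fst c)) = fst c"
  using openin_subset[OF chart_openin, of c] by (simp add: inf_absorb2)

lemma chart_inj: "c \<in> atlas M \<Longrightarrow> inj_on (snd c) (fst c)"
  using homeomorphic_imp_injective_map[OF chart_homeo] chart_topspace by metis

lemma cinv_left: "c \<in> atlas M \<Longrightarrow> p \<in> fst c \<Longrightarrow> cinv c (snd c p) = p"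
  unfolding cinv_def using chart_inj inv_into_f_f by metis

lemma cinv_right: "x \<in> snd c ` fst c \<Longrightarrow> snd c (cinv c x) = x"
  and cinv_mem: "x \<in> snd c ` fst c \<Longrightarrow> cinv c x \<in> fst c"
  unfolding cinv_def by (simp_all add: f_inv_into_f inv_into_into)

lemma chart_image_open:
  assumes "c \<in> atlas M" "openin (mtop M) U"
  shows "open (snd c ` (fst c \<inter> U))"
proof -
  have "openin (subtopology (mtop M) (fst c)) (fst c \<inter> U)"
    using assms(2) by (simp add: openin_subtopology_Int2)
  then have "openin (top_of_set (snd c ` fst c)) (snd c ` (fst c \<inter> U))"
    using homeomorphic_imp_open_map[OF chart_homeo[OF assms(1)]] by (simp add: open_map_def)
  then show ?thesis using chart_open[OF assms(1)] openin_open_trans by blast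
qed

lemma chart_image_iff: "c \<in> atlas M \<Longrightarrow> x \<in> snd c ` (fst c \<inter> U) \<longleftrightarrow> x \<in> snd c ` fst c \<and> cinv c x \<in> U"
  using cinv_left[of c] cinv_right[of x c] cinv_mem[of x c] by (auto intro!: image_eqI[of _ _ "cinv c x"])

lemma overlap_open: "c \<in> atlas M \<Longrightarrow> c' \<in> atlas M \<Longrightarrow> open (snd c ` (fst c \<inter> fst c'))"
  using chart_image_open chart_openin by blast

lemma cinv_continuous: "c \<in> atlas M \<Longrightarrow> continuous_map (top_of_set (snd c ` fst c)) (mtop M) (cinv c)"
proof -
  assume c: "c \<in> atlas M"
  obtain h where h: "homeomorphic_maps (subtopology (mtop M) (fst c)) (top_of_set (snd c ` fst c)) (snd c) h"
    using chart_homeo[OF c] homeomorphic_map_maps by blast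
  then have "continuous_map (top_of_set (snd c ` fst c)) (subtopology (mtop M) (fst c)) h"
    by (simp add: homeomorphic_maps_def)
  moreover have "h y = cinv c y" if "y \<in> topspace (top_of_set (snd c ` fst c))" for y
    using h that cinv_left[OF c] openin_subset[OF chart_openin[OF c]] unfolding homeomorphic_maps_def by auto
  ultimately have "continuous_map (top_of_set (snd c ` fst c)) (subtopology (mtop M) (fst c)) (cinv c)"
    by (rule continuous_map_eq)
  then show ?thesis by (simp add: continuous_map_in_subtopology)
qed

lemma transition_Ck: "c \<in> atlas M \<Longrightarrow> c' \<in> atlas M \<Longrightarrow> Ck_on k (snd c ` (fst c \<inter> fst c')) (snd c' \<circ> cinv c)"
  using transition_smooth overlap_open smooth_on_open_iff by blast

abbreviation dtrans :: "('a, 'e) chart \<Rightarrow> ('a, 'e) chart \<Rightarrow> 'a \<Rightarrow> 'e \<Rightarrow> 'e" where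
  "dtrans c c' p \<equiv> \<D> (snd c' \<circ> cinv c) (snd c p)"

lemma transition_has_derivative:
  assumes "c \<in> charts_at M p" "c' \<in> charts_at M p"
  shows "((snd c' \<circ> cinv c) has_derivative dtrans c c' p) (at (snd c p))"
  using Ck_on_has_derivative[OF transition_Ck] assms by (auto simp: charts_at_iff)

lemma dtrans_linear: "c \<in> charts_at M p \<Longrightarrow> c' \<in> charts_at M p \<Longrightarrow> linear (dtrans c c' p)"
  using transition_has_derivative has_derivative_linear by blast

text \<open>The two composites agree on the overlap only, which is open. The cocycle rule for
  \<open>dtrans\<close> and the independence of \<open>vderiv\<close> from the chart are both
  instances of this chain rule.\<close>

lemma change_chart_has_derivative:
  assumes c: "c \<in> charts_at M p" "c' \<in> charts_at M p" and F: "((F \<circ> cinv c) has_derivative F') (at (snd c p))"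
  shows "((F \<circ> cinv c') has_derivative (\<lambda>w. F' (dtrans c' c p w))) (at (snd c' p))"
proof -
  have a: "c \<in> atlas M" "c' \<in> atlas M" "p \<in> fst c" "p \<in> fst c'" using c by (auto simp: charts_at_iff)
  have "((snd c \<circ> cinv c') has_derivative dtrans c' c p) (at (snd c' p))"
    using transition_has_derivative c by blast
  moreover have "((F \<circ> cinv c) has_derivative F') (at ((snd c \<circ> cinv c') (snd c' p)))"
    using F a by (simp add: cinv_left)
  ultimately have "((\<lambda>y. (F \<circ> cinv c) ((snd c \<circ> cinv c') y)) has_derivative (\<lambda>w. F' (dtrans c' c p w))) (at (snd c' p))"
    by (rule has_derivative_compose)
  then show ?thesis
  proof (rule has_derivative_transform_within_open[OF _ overlap_open[OF a(2,1)]])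
    show "snd c' p \<in> snd c' ` (fst c' \<inter> fst c)" using a by blast
    show "(F \<circ> cinv c) ((snd c \<circ> cinv c') y) = (F \<circ> cinv c') y" if "y \<in> snd c' ` (fst c' \<inter> fst c)" for y
      using that a by (auto simp: cinv_left)
  qed
qed

lemma dtrans_self:
  assumes "c \<in> charts_at M p" shows "dtrans c c p u = u"
proof -
  have a: "c \<in> atlas M" "p \<in> fst c" using assms by (auto simp: charts_at_iff)
  have "((\<lambda>x. x) has_derivative (\<lambda>x. x)) (at (snd c p))" by simp
  then have "((snd c \<circ> cinv c) has_derivative (\<lambda>x. x)) (at (snd c p))"
  proof (rule has_derivative_transform_within_open[OF _ chart_open[OF a(1)]])
    show "y = (snd c \<circ> cinv c) y" if "y \<in> snd c ` fst c" for y using cinv_right[OF that] by simp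
  qed (use a in blast)
  from frechet_derivative_eqI[OF this] show ?thesis by simp
qed

lemma dtrans_comp:
  assumes "c \<in> charts_at M p" "c' \<in> charts_at M p" "c'' \<in> charts_at M p"
  shows "dtrans c' c'' p (dtrans c c' p u) = dtrans c c'' p u"
  using frechet_derivative_eqI[OF change_chart_has_derivative[OF assms(2,1) transition_has_derivative[OF assms(2,3)]]]
  by simp

lemma dtrans_inverse:
  assumes "c \<in> charts_at M p" "c' \<in> charts_at M p"
  shows "dtrans c' c p (dtrans c c' p u) = u"
  using dtrans_comp[OF assms assms(1)] dtrans_self[OF assms(1)] by simp

lemma mk_tvec_tangent: "c \<in> charts_at M p \<Longrightarrow> mk_tvec M c p u \<in> tangent_space M p"
  unfolding tangent_space_def mk_tvec_def by (simp add: dtrans_comp)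

lemma mk_tvec_apply: "c \<in> charts_at M p \<Longrightarrow> mk_tvec M c p u c = u"
  unfolding mk_tvec_def by (simp add: dtrans_self)

lemma mk_tvec_apply_chart: "c \<in> charts_at M p \<Longrightarrow> c' \<in> charts_at M p \<Longrightarrow> mk_tvec M c p u c' = dtrans c c' p u"
  unfolding mk_tvec_def by simp

lemma tangent_eq_mk_tvec: "v \<in> tangent_space M p \<Longrightarrow> c \<in> charts_at M p \<Longrightarrow> v = mk_tvec M c p (v c)"
proof (rule ext)
  fix c' assume v: "v \<in> tangent_space M p" and c: "c \<in> charts_at M p"
  have "c' \<in> charts_at M p \<Longrightarrow> v c' = dtrans c c' p (v c)" "c' \<notin> charts_at M p \<Longrightarrow> v c' = 0"
    using v c unfolding tangent_space_def by blast+
  then show "v c' = mk_tvec M c p (v c) c'" unfolding mk_tvec_def by presburger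
qed

lemma mk_tvec_change: "c \<in> charts_at M p \<Longrightarrow> c' \<in> charts_at M p \<Longrightarrow> mk_tvec M c p u = mk_tvec M c' p (dtrans c c' p u)"
  unfolding mk_tvec_def by (intro ext) (simp add: dtrans_comp)

text \<open>Frees \<open>vderiv\<close> from the arbitrary chart picked by
  \<open>chart_at\<close>.\<close>

lemma vderiv_chart:
  assumes v: "v \<in> tangent_space M p" and c: "c \<in> charts_at M p" and F: "((F \<circ> cinv c) has_derivative F') (at (snd c p))"
  shows "vderiv M p v F = F' (v c)"
proof -
  have "p \<in> points M" using c points_charts by (auto simp: charts_at_iff)
  then have c': "chart_at M p \<in> charts_at M p" by (rule chart_at_charts_at)
  have "vderiv M p v F = F' (dtrans (chart_at M p) c p (v (chart_at M p)))"
    unfolding vderiv_def Let_def using frechet_derivative_eqI[OF change_chart_has_derivative[OF c c' F]] by simp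
  also have "dtrans (chart_at M p) c p (v (chart_at M p)) = v c"
    using v c c' unfolding tangent_space_def mem_Collect_eq by metis
  finally show ?thesis .
qed

end

lemma christoffel_eq: "christoffel M g c = levi_form (local_metric M g c)"
  unfolding christoffel_def levi_form_def by (intro ext) simp

lemma curvature_eq: "curvature M g c = curv_form (levi_form (local_metric M g c))"
  unfolding curvature_def curv_form_def christoffel_eq Let_def by (intro ext) simp

lemma linear_family_derivative:
  fixes B :: "'d::real_normed_vector \<Rightarrow> 'b::euclidean_space \<Rightarrow> 'c::real_normed_vector"
    and f :: "'e::real_normed_vector \<Rightarrow> 'd"
  assumes W: "open W" "f x \<in> W" and B: "\<And>y. y \<in> W \<Longrightarrow> linear (B y)"
    and dB: "\<And>w. (\<lambda>y. B y w) differentiable (at (f x))"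
    and f: "(f has_derivative f') (at x)" and b: "(b has_derivative b') (at x)"
  shows "((\<lambda>y. B (f y) (b y)) has_derivative
     (\<lambda>u. \<D> (\<lambda>z. B z (b x)) (f x) (f' u) + B (f x) (b' u))) (at x)"
proof -
  \<comment> \<open>A constant factor 1 in an additional real slot makes the linear family
    bilinear.\<close>
  have "((\<lambda>y. 1 *\<^sub>R B (f y) (b y)) has_derivative
     (\<lambda>u. \<D> (\<lambda>z. 1 *\<^sub>R B z (b x)) (f x) (f' u) + 0 *\<^sub>R B (f x) (b x) + 1 *\<^sub>R B (f x) (b' u))) (at x)"
  proof (rule bilinear_family_derivative[where B = "\<lambda>y (r::real) w. r *\<^sub>R B y w" and f = f and W = W])
    show "bilinear (\<lambda>r w. r *\<^sub>R B y w)" if "y \<in> W" for y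
      using B[OF that] unfolding bilinear_def
      by (auto intro!: linearI simp: linear_add linear_cmul scaleR_add_left scaleR_add_right)
    show "(\<lambda>y. v *\<^sub>R B y w) differentiable (at (f x))" for v w
      using dB by (intro derivative_intros)
  qed (use f b W in auto)
  then show ?thesis by simp
qed

section \<open>Riemannian metrics in charts\<close>

locale riemannian_manifold = manifold_charts M for M :: "('a, 'e::euclidean_space) manifold" +
  fixes g :: "('a, 'e) metric_tensor"
  assumes metric: "riemannian_metric M g"
begin

lemma chart_riemann: "c \<in> atlas M \<Longrightarrow> local_riemann (snd c ` fst c) (local_metric M g c)"
  using metric chart_open smooth_on_open_iff[OF chart_open]
  unfolding riemannian_metric_def local_riemann_def by blast

lemma local_metric_at: "c \<in> charts_at M p \<Longrightarrow> local_metric M g c (snd c p) v w = g p (mk_tvec M c p v) (mk_tvec M c p w)"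
  unfolding local_metric_def by (simp add: charts_at_iff cinv_left)

lemma local_metric_tangent:
  assumes "c \<in> charts_at M p" "v \<in> tangent_space M p" "w \<in> tangent_space M p"
  shows "local_metric M g c (snd c p) (v c) (w c) = g p v w"
  using local_metric_at[OF assms(1)] tangent_eq_mk_tvec[OF assms(2,1)] tangent_eq_mk_tvec[OF assms(3,1)] by simp

lemma local_metric_change:
  assumes "c \<in> charts_at M p" "c' \<in> charts_at M p"
  shows "local_metric M g c (snd c p) v w = local_metric M g c' (snd c' p) (dtrans c c' p v) (dtrans c c' p w)"
  unfolding local_metric_at[OF assms(1)] local_metric_at[OF assms(2)] mk_tvec_change[OF assms] ..

text \<open>The right-hand side, pulled back to \<open>c\<close>, is symmetric and compatible with
  the metric of \<open>c\<close>, so uniqueness identifies it. The second derivative of the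
  coordinate change is the inhomogeneous term.\<close>

lemma christoffel_change:
  assumes c: "c \<in> charts_at M p" "c' \<in> charts_at M p"
  shows "dtrans c c' p (christoffel M g c (snd c p) u v) =
    \<D> (\<lambda>y. \<D> (snd c' \<circ> cinv c) y v) (snd c p) u +
    christoffel M g c' (snd c' p) (dtrans c c' p u) (dtrans c c' p v)"
proof -
  have a: "c \<in> atlas M" "c' \<in> atlas M" "p \<in> fst c" "p \<in> fst c'" using c by (auto simp: charts_at_iff)
  interpret A: local_riemann "snd c ` fst c" "local_metric M g c" by (rule chart_riemann) fact
  interpret B: local_riemann "snd c' ` fst c'" "local_metric M g c'" by (rule chart_riemann) fact
  let ?G = "local_metric M g c" and ?G' = "local_metric M g c'"
  let ?x = "snd c p" and ?\<phi> = "snd c' \<circ> cinv c" and ?O = "snd c ` (fst c \<inter> fst c')"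
  let ?D = "\<lambda>y. \<D> ?\<phi> y"
  have x: "?x \<in> snd c ` fst c" "?x \<in> ?O" and \<phi>x: "?\<phi> ?x = snd c' p" "?\<phi> ?x \<in> snd c' ` fst c'"
    using a by (auto simp: cinv_left)
  have C: "Ck_on k ?O ?\<phi>" for k by (rule transition_Ck) fact+
  have d\<phi>: "(?\<phi> has_derivative ?D ?x) (at ?x)" by (rule Ck_on_has_derivative[OF C x(2)])
  define H where "H u v = \<D> (\<lambda>y. ?D y v) ?x u" for u v
  have dD: "((\<lambda>y. ?D y v) has_derivative (\<lambda>u. H u v)) (at ?x)" for v
  proof -
    have "Ck_on (Suc 0) ?O (\<lambda>y. ?D y v)" using C[of "Suc (Suc 0)"] by simp
    from Ck_on_has_derivative[OF this x(2)] show ?thesis by (simp add: H_def[abs_def])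
  qed
  have Dlin: "linear (?D y)" if "y \<in> ?O" for y
    using Ck_on_has_derivative[OF C that] has_derivative_linear by blast
  have Hsym: "H u v = H v u" for u v
    unfolding H_def by (rule symmetric_second_derivative[OF overlap_open[OF a(1,2)] x(2) C])
  have Hlin1: "linear (\<lambda>u. H u v)" for v using dD has_derivative_linear by blast
  then have Hlin2: "linear (H u)" for u using Hsym[of u] by (simp add: ext[of "H u", OF Hsym])
  let ?E = "\<lambda>u v. H u v + B.\<Gamma> (snd c' p) (?D ?x u) (?D ?x v)"
  have GE: "?G' (snd c' p) E (?D ?x w) = ?G ?x (dtrans c' c p E) w" for E w
    unfolding local_metric_change[OF c] using dtrans_inverse[OF c(2,1)] by simp
  have key: "A.dG ?x u v w = ?G' (snd c' p) (?E u v) (?D ?x w) + ?G' (snd c' p) (?D ?x v) (?E u w)" for u v w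
  proof -
    have "((\<lambda>y. ?G' (?\<phi> y) (?D y v) (?D y w)) has_derivative
      (\<lambda>u. ?G' (?\<phi> ?x) (H u v + B.\<Gamma> (?\<phi> ?x) (?D ?x u) (?D ?x v)) (?D ?x w) +
        ?G' (?\<phi> ?x) (?D ?x v) (H u w + B.\<Gamma> (?\<phi> ?x) (?D ?x u) (?D ?x w)))) (at ?x)"
      by (rule B.metric_derivative[OF \<phi>x(2) d\<phi> dD dD])
    then have "((\<lambda>y. ?G y v w) has_derivative
      (\<lambda>u. ?G' (?\<phi> ?x) (H u v + B.\<Gamma> (?\<phi> ?x) (?D ?x u) (?D ?x v)) (?D ?x w) +
        ?G' (?\<phi> ?x) (?D ?x v) (H u w + B.\<Gamma> (?\<phi> ?x) (?D ?x u) (?D ?x w)))) (at ?x)"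
    proof (rule has_derivative_transform_within_open[OF _ overlap_open[OF a(1,2)] x(2)])
      fix y assume "y \<in> ?O"
      then obtain q where q: "q \<in> fst c" "q \<in> fst c'" "y = snd c q" by blast
      then show "?G' (?\<phi> y) (?D y v) (?D y w) = ?G y v w"
        using local_metric_change[of c q c' v w] a by (simp add: charts_at_iff cinv_left)
    qed
    from frechet_derivative_eqI[OF this] show ?thesis unfolding \<phi>x(1) by simp
  qed
  have "(\<lambda>u v. dtrans c' c p (?E u v)) = A.\<Gamma> ?x"
  proof (rule A.levi_unique[OF x(1)])
    have BG: "bilinear (B.\<Gamma> (snd c' p))" using B.levi_bilinear \<phi>x by simp
    have D: "linear (?D ?x)" using Dlin x by blast
    have T: "linear (dtrans c' c p)" using dtrans_linear c by blast
    show "bilinear (\<lambda>u v. dtrans c' c p (?E u v))"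
      unfolding bilinear_def
      by (intro conjI allI linearI)
        (simp_all add: linear_add[OF Hlin1] linear_add[OF Hlin2] linear_cmul[OF Hlin1] linear_cmul[OF Hlin2]
          linear_add[OF D] linear_cmul[OF D] linear_add[OF T] linear_cmul[OF T]
          bilinear_ladd[OF BG] bilinear_radd[OF BG] bilinear_lmul[OF BG] bilinear_rmul[OF BG] algebra_simps)
    show "dtrans c' c p (?E u v) = dtrans c' c p (?E v u)" for u v
      using Hsym[of u v] B.levi_sym[of "snd c' p" "?D ?x u"] \<phi>x by simp
    show "A.dG ?x u v w = ?G ?x (dtrans c' c p (?E u v)) w + ?G ?x v (dtrans c' c p (?E u w))" for u v w
      unfolding key GE using GE[of "?E u w" v] A.sym[OF x(1), of v] B.sym[of "snd c' p" "?D ?x v"] \<phi>x by simp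
  qed
  from fun_cong[OF fun_cong[OF this, of u], of v]
  have "dtrans c c' p (dtrans c' c p (?E u v)) = dtrans c c' p (A.\<Gamma> ?x u v)" by simp
  then have "dtrans c c' p (A.\<Gamma> ?x u v) = ?E u v"
    unfolding dtrans_inverse[OF c(2,1)] by simp
  then show ?thesis unfolding christoffel_eq H_def .
qed

end


section \<open>Elements of the restricted holonomy group from small loops\<close>

context manifold_charts
begin

text \<open>The coordinate curve is smooth on the whole line, so it supplies the extensions that
  \<open>smooth_on\<close> asks for on closed intervals, and the set of break points is
  empty.\<close>

lemma pw_smooth_curve_chart:
  assumes c: "c \<in> atlas M" and \<kappa>: "\<And>k. Ck_on k UNIV \<kappa>" "\<And>t. t \<in> {0..1} \<Longrightarrow> \<kappa> t \<in> snd c ` fst c"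
  shows "pw_smooth_curve M (cinv c \<circ> \<kappa>)"
  unfolding pw_smooth_curve_def
proof (intro conjI exI[of _ "{}"] allI impI ballI)
  have cont: "continuous_on UNIV \<kappa>" using \<kappa>(1)[of 0] by simp
  have "continuous_map (top_of_set {0..1}) (top_of_set (snd c ` fst c)) \<kappa>"
    using continuous_on_subset[OF cont] \<kappa>(2) by (auto simp: continuous_map_subtopology_eu)
  then show "continuous_map (top_of_set {0..1}) (mtop M) (cinv c \<circ> \<kappa>)"
    using continuous_map_compose cinv_continuous[OF c] by blast
  fix a b :: real and c' assume ab: "0 \<le> a \<and> a < b \<and> b \<le> 1 \<and> {a<..<b} \<inter> {} = {}" and c': "c' \<in> atlas M"
  let ?O = "snd c ` (fst c \<inter> fst c')"
  have O: "open (\<kappa> -` ?O)" using cont overlap_open[OF c c'] by (simp add: continuous_on_open_vimage)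
  show "smooth_on {t \<in> {a..b}. (cinv c \<circ> \<kappa>) t \<in> fst c'} (snd c' \<circ> (cinv c \<circ> \<kappa>))"
    unfolding smooth_on_def
  proof (intro ballI exI[of _ "\<kappa> -` ?O"] exI[of _ "\<lambda>s. (snd c' \<circ> cinv c) (\<kappa> s)"] conjI allI)
    fix t assume t: "t \<in> {t \<in> {a..b}. (cinv c \<circ> \<kappa>) t \<in> fst c'}"
    then show "t \<in> \<kappa> -` ?O" using ab \<kappa>(2)[of t] chart_image_iff[OF c, of "\<kappa> t" "fst c'"] by auto
    show "Ck_on k (\<kappa> -` ?O) (\<lambda>s. (snd c' \<circ> cinv c) (\<kappa> s))" for k
      by (rule Ck_on_compose[OF O overlap_open[OF c c'] Ck_on_subset[OF \<kappa>(1)] transition_Ck[OF c c']]) auto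
  qed (use O in auto)
qed simp

text \<open>Straight-line contraction in the coordinates. It fixes the base point because the curve
  starts and ends at the centre \<open>x0\<close>.\<close>

lemma null_homotopic_loop_chart:
  assumes c: "c \<in> atlas M" and \<kappa>: "continuous_on UNIV \<kappa>" "\<kappa> 0 = x0" "\<kappa> 1 = x0"
    and star: "\<And>s t. s \<in> {0..1} \<Longrightarrow> t \<in> {0..1} \<Longrightarrow> x0 + s *\<^sub>R (\<kappa> t - x0) \<in> snd c ` fst c"
  shows "null_homotopic_loop (mtop M) (cinv c x0) (cinv c \<circ> \<kappa>)"
proof -
  let ?h = "\<lambda>z::real \<times> real. x0 + (1 - fst z) *\<^sub>R (\<kappa> (snd z) - x0)"
  have "continuous_on UNIV ?h" by (intro continuous_intros continuous_on_compose2[OF \<kappa>(1)]) auto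
  moreover have "?h z \<in> snd c ` fst c" if "z \<in> {0..1} \<times> {0..1}" for z
    using star[of "1 - fst z" "snd z"] that by auto
  ultimately have "continuous_map (prod_topology (top_of_set {0..1}) (top_of_set {0..1})) (top_of_set (snd c ` fst c)) ?h"
    unfolding prod_topology_subtopology_eu continuous_map_subtopology_eu using continuous_on_subset by blast
  then have "continuous_map (prod_topology (top_of_set {0..1}) (top_of_set {0..1})) (mtop M) (cinv c \<circ> ?h)"
    using continuous_map_compose cinv_continuous[OF c] by blast
  then show ?thesis
    unfolding null_homotopic_loop_def homotopic_with_def using \<kappa> by (intro exI[of _ "cinv c \<circ> ?h"]) auto
qed

end

context riemannian_manifold
begin

lemma
  assumes c: "c \<in> atlas M" "c' \<in> atlas M" and y: "y \<in> snd c ` (fst c \<inter> fst c')"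
  shows transition_derivative_linear: "linear (\<D> (snd c' \<circ> cinv c) y)"
    and mk_tvec_cinv: "mk_tvec M c (cinv c y) w c' = \<D> (snd c' \<circ> cinv c) y w"
proof -
  show "linear (\<D> (snd c' \<circ> cinv c) y)"
    using Ck_on_has_derivative[OF transition_Ck[OF c] y] has_derivative_linear by blast
  show "mk_tvec M c (cinv c y) w c' = \<D> (snd c' \<circ> cinv c) y w"
    using y c by (auto simp: mk_tvec_def charts_at_iff cinv_left)
qed

text \<open>\<open>parallel_along\<close> asks for the transport equation in every chart around the
  point. The derivative of the coordinate change along the curve is compensated by the inhomogeneous
  term of \<open>christoffel_change\<close>.\<close>

lemma parallel_along_chart:
  assumes c: "c \<in> atlas M" and \<kappa>: "\<And>t. t \<in> {0..1} \<Longrightarrow> \<kappa> t \<in> snd c ` fst c"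
    and \<kappa>': "\<And>t. (\<kappa> has_vector_derivative \<kappa>' t) (at t)"
    and V: "\<And>t. t \<in> {0..1} \<Longrightarrow>
       (V has_vector_derivative - christoffel M g c (\<kappa> t) (\<kappa>' t) (V t)) (at t within {0..1})"
  shows "parallel_along M g (cinv c \<circ> \<kappa>) (\<lambda>t. mk_tvec M c (cinv c (\<kappa> t)) (V t))"
  unfolding parallel_along_def
proof (intro conjI ballI exI[of _ "{}"])
  have at: "c \<in> charts_at M (cinv c y)" "snd c (cinv c y) = y" if "y \<in> snd c ` fst c" for y
    using cinv_mem[OF that] cinv_right[OF that] c by (auto simp: charts_at_iff)
  have cont\<kappa>: "continuous_on UNIV \<kappa>"
    unfolding continuous_on_eq_continuous_within using has_vector_derivative_continuous[OF \<kappa>'] by blast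
  have contV: "continuous_on {0..1} V"
    unfolding continuous_on_eq_continuous_within using has_vector_derivative_continuous[OF V] by blast
  show "mk_tvec M c (cinv c (\<kappa> t)) (V t) \<in> tangent_space M ((cinv c \<circ> \<kappa>) t)" if "t \<in> {0..1}" for t
    using mk_tvec_tangent at \<kappa>[OF that] by simp
  show "finite {}" by simp
  fix c' assume c': "c' \<in> atlas M"
  let ?O = "snd c ` (fst c \<inter> fst c')" and ?\<phi> = "snd c' \<circ> cinv c"
  let ?D = "\<lambda>y. \<D> ?\<phi> y"
  have C: "Ck_on k ?O ?\<phi>" for k by (rule transition_Ck[OF c c'])
  note Dlin = transition_derivative_linear[OF c c'] and mk = mk_tvec_cinv[OF c c']
  let ?T = "{t \<in> {0..1}. (cinv c \<circ> \<kappa>) t \<in> fst c'}"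
  have T: "\<kappa> t \<in> ?O" if "t \<in> ?T" for t
    using that \<kappa>[of t] chart_image_iff[OF c, of "\<kappa> t" "fst c'"] by auto
  have contD: "continuous_on ?O (\<lambda>y. ?D y b)" for b using C[of "Suc 0"] by simp
  have "continuous_on ?T (\<lambda>t. ?D (\<kappa> t) b)" for b
    by (rule continuous_on_compose2[OF contD continuous_on_subset[OF cont\<kappa>]]) (use T in auto)
  then have "continuous_on ?T (\<lambda>t. \<Sum>b\<in>Basis. (V t \<bullet> b) *\<^sub>R ?D (\<kappa> t) b)"
    by (intro continuous_intros continuous_on_subset[OF contV]) auto
  then show "continuous_on ?T (\<lambda>t. mk_tvec M c (cinv c (\<kappa> t)) (V t) c')"
  proof (rule continuous_on_eq)
    show "(\<Sum>b\<in>Basis. (V t \<bullet> b) *\<^sub>R ?D (\<kappa> t) b) = mk_tvec M c (cinv c (\<kappa> t)) (V t) c'" if "t \<in> ?T" for t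
      unfolding mk[OF T[OF that]] by (rule linear_sum_Basis[OF Dlin[OF T[OF that]], symmetric])
  qed
next
  fix t c' assume t: "t \<in> {0<..<1} - {}" and c'p: "c' \<in> charts_at M ((cinv c \<circ> \<kappa>) t)"
  let ?p = "cinv c (\<kappa> t)"
  have tI: "t \<in> {0..1}" using t by simp
  have cp: "c \<in> charts_at M ?p" "snd c ?p = \<kappa> t"
    using cinv_mem[OF \<kappa>[OF tI]] cinv_right[OF \<kappa>[OF tI]] c by (simp_all add: charts_at_iff)
  have c': "c' \<in> charts_at M ?p" "c' \<in> atlas M" "?p \<in> fst c'" using c'p by (auto simp: charts_at_iff)
  let ?O = "snd c ` (fst c \<inter> fst c')" and ?\<phi> = "snd c' \<circ> cinv c"
  let ?D = "\<lambda>y. \<D> ?\<phi> y"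
  have C: "Ck_on k ?O ?\<phi>" for k by (rule transition_Ck[OF c c'(2)])
  note Dlin = transition_derivative_linear[OF c c'(2)] and mk = mk_tvec_cinv[OF c c'(2)]
  have O: "open ?O" by (rule overlap_open[OF c c'(2)])
  have tO: "\<kappa> t \<in> ?O" using \<kappa>[OF tI] chart_image_iff[OF c, of "\<kappa> t" "fst c'"] c'(3) by simp
  have cont\<kappa>: "continuous_on UNIV \<kappa>"
    unfolding continuous_on_eq_continuous_within using has_vector_derivative_continuous[OF \<kappa>'] by blast
  have OK: "open (\<kappa> -` ?O)" using cont\<kappa> O by (simp add: continuous_on_open_vimage)
  let ?V' = "- christoffel M g c (\<kappa> t) (\<kappa>' t) (V t)"
  have d\<kappa>: "(\<kappa> has_derivative (\<lambda>h. h *\<^sub>R \<kappa>' t)) (at t)"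
    using \<kappa>' by (simp add: has_vector_derivative_def)
  have dV: "(V has_derivative (\<lambda>h. h *\<^sub>R ?V')) (at t)"
    using V[OF tI] t by (simp add: has_vector_derivative_def at_within_Icc_at)
  have dD: "(\<lambda>y. ?D y w) differentiable (at (\<kappa> t))" for w
    using C[of "Suc (Suc 0)"] tO by auto
  have "((\<lambda>s. ?D (\<kappa> s) (V s)) has_derivative
     (\<lambda>h. \<D> (\<lambda>z. ?D z (V t)) (\<kappa> t) (h *\<^sub>R \<kappa>' t) + ?D (\<kappa> t) (h *\<^sub>R ?V'))) (at t)"
    by (rule linear_family_derivative[OF O tO Dlin dD d\<kappa> dV])
  then have "((\<lambda>s. ?D (\<kappa> s) (V s)) has_vector_derivative
     \<D> (\<lambda>z. ?D z (V t)) (\<kappa> t) (\<kappa>' t) + ?D (\<kappa> t) ?V') (at t)"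
    unfolding has_vector_derivative_def
    using linear_cmul[OF linear_frechet_derivative[OF dD]] linear_cmul[OF Dlin[OF tO]]
      linear_neg[OF Dlin[OF tO]]
    by (simp add: scaleR_add_right scaleR_diff_right)
  moreover have "?D (\<kappa> t) ?V' = - (\<D> (\<lambda>y. ?D y (V t)) (\<kappa> t) (\<kappa>' t)
      + christoffel M g c' (snd c' ?p) (?D (\<kappa> t) (\<kappa>' t)) (?D (\<kappa> t) (V t)))"
    using christoffel_change[OF cp(1) c'(1), of "\<kappa>' t" "V t"] linear_neg[OF Dlin[OF tO]] unfolding cp(2) by simp
  ultimately have "((\<lambda>s. ?D (\<kappa> s) (V s)) has_vector_derivative
     - christoffel M g c' (snd c' ?p) (?D (\<kappa> t) (\<kappa>' t)) (?D (\<kappa> t) (V t))) (at t)" by simp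
  then have "((\<lambda>s. mk_tvec M c (cinv c (\<kappa> s)) (V s) c') has_vector_derivative
     - christoffel M g c' (snd c' ?p) (?D (\<kappa> t) (\<kappa>' t)) (?D (\<kappa> t) (V t))) (at t)"
  proof (rule has_vector_derivative_transform_within_open[OF _ OK])
    show "t \<in> \<kappa> -` ?O" using tO by simp
    show "?D (\<kappa> s) (V s) = mk_tvec M c (cinv c (\<kappa> s)) (V s) c'" if "s \<in> \<kappa> -` ?O" for s
      using mk that by simp
  qed
  moreover have "velocity M (cinv c \<circ> \<kappa>) t c' = ?D (\<kappa> t) (\<kappa>' t)"
  proof -
    have "((\<lambda>s. ?\<phi> (\<kappa> s)) has_derivative (\<lambda>h. ?D (\<kappa> t) (h *\<^sub>R \<kappa>' t))) (at t)"
      by (rule has_derivative_compose[OF d\<kappa> Ck_on_has_derivative[OF C tO]])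
    then have "((\<lambda>s. ?\<phi> (\<kappa> s)) has_vector_derivative ?D (\<kappa> t) (\<kappa>' t)) (at t)"
      unfolding has_vector_derivative_def using linear_cmul[OF Dlin[OF tO]] by simp
    then show ?thesis using c'p unfolding velocity_def by (simp add: vector_derivative_at comp_def)
  qed
  ultimately show "((\<lambda>s. mk_tvec M c (cinv c (\<kappa> s)) (V s) c') has_vector_derivative
     - christoffel M g c' (snd c' ((cinv c \<circ> \<kappa>) t)) (velocity M (cinv c \<circ> \<kappa>) t c')
        (mk_tvec M c (cinv c (\<kappa> t)) (V t) c')) (at t)"
    using mk[OF tO] by simp
qed

lemma loop_holonomy:
  assumes c: "c \<in> charts_at M p"
  shows "\<exists>e0>0. \<forall>e. 0 < e \<and> e < e0 \<longrightarrow> (\<exists>A\<in>restricted_holonomy M g p. \<forall>w. \<exists>V. V 0 = w \<and>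
     local_riemann.loop_parallel (local_metric M g c) (snd c p) u v e V \<and> A (mk_tvec M c p w) = mk_tvec M c p (V 1))"
proof -
  have ca: "c \<in> atlas M" "p \<in> fst c" using c by (auto simp: charts_at_iff)
  interpret A: local_riemann "snd c ` fst c" "local_metric M g c" by (rule chart_riemann[OF ca(1)])
  let ?x = "snd c p"
  have x: "?x \<in> snd c ` fst c" using ca by simp
  obtain e1 where e1: "e1 > 0" "\<And>e w. 0 < e \<Longrightarrow> e < e1 \<Longrightarrow> \<exists>V. V 0 = w \<and> A.loop_parallel ?x u v e V"
    using A.loop_parallel_exists[OF x] by metis
  obtain d where d: "d > 0" "ball ?x d \<subseteq> snd c ` fst c" using A.open_W x open_contains_ball by blast
  define M0 where "M0 = norm u + norm v + 1"
  have M0: "M0 > 0" by (simp add: M0_def add_nonneg_pos)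
  show ?thesis
  \<comment> \<open>The second bound keeps the loop in a ball inside the chart, in which it can be
    contracted.\<close>
  proof (intro exI[of _ "min e1 (d / M0)"] conjI allI impI)
    show "0 < min e1 (d / M0)" using e1 d M0 by simp
    fix e assume e: "0 < e \<and> e < min e1 (d / M0)"
    define \<kappa> where "\<kappa> t = ?x + e *\<^sub>R loop u v t" for t
    have "e * M0 < d" using e M0 by (simp add: field_simps)
    then have eM: "e * (norm u + norm v) < d" using e by (simp add: M0_def algebra_simps)
    have star: "?x + s *\<^sub>R (\<kappa> t - ?x) \<in> snd c ` fst c" if "s \<in> {0..1}" "t \<in> {0..1}" for s t
    proof -
      have "dist ?x (?x + s *\<^sub>R (\<kappa> t - ?x)) = s * norm (\<kappa> t - ?x)" using that by (simp add: dist_norm)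
      also have "\<dots> \<le> 1 * norm (\<kappa> t - ?x)" using that by (intro mult_right_mono) auto
      also have "\<dots> = dist ?x (?x + e *\<^sub>R loop u v t)" by (simp add: \<kappa>_def dist_norm)
      also have "\<dots> < d" using e by (intro A.loop_near that eM) auto
      finally show ?thesis using d(2) by auto
    qed
    have \<kappa>W: "\<kappa> t \<in> snd c ` fst c" if "t \<in> {0..1}" for t using star[of 1 t] that by simp
    have Ck\<kappa>: "Ck_on k UNIV \<kappa>" for k
      unfolding \<kappa>_def[abs_def] loop_def
      by (intro Ck_on_add Ck_on_scaleR Ck_on_const Ck_on_diff Ck_on_power Ck_on_id open_UNIV)
    have \<kappa>': "(\<kappa> has_vector_derivative e *\<^sub>R loop' u v t) (at t)" for t
      unfolding \<kappa>_def[abs_def] by (auto intro!: derivative_eq_intros bounded_linear.has_vector_derivative[OF bounded_linear_scaleR_right])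
    have ends: "\<kappa> 0 = ?x" "\<kappa> 1 = ?x" by (simp_all add: \<kappa>_def)
    have p: "cinv c ?x = p" using ca by (simp add: cinv_left)
    obtain V where V: "\<And>w. V w 0 = w" "\<And>w. A.loop_parallel ?x u v e (V w)"
      using e1(2)[of e] e by (metis min_less_iff_conj)
    \<comment> \<open>Assembled from one chosen solution for each initial vector;
      \<open>restrict\<close> makes it extensional, as membership in
      \<open>restricted_holonomy\<close> demands.\<close>
    define A where "A = restrict (\<lambda>a. mk_tvec M c p (V (a c) 1)) (tangent_space M p)"
    have par: "parallel_along M g (cinv c \<circ> \<kappa>) (\<lambda>t. mk_tvec M c (cinv c (\<kappa> t)) (V w t))" for w
      by (rule parallel_along_chart[OF ca(1) \<kappa>W \<kappa>'])
        (use V(2)[of w] in \<open>auto simp: A.loop_parallel_def \<kappa>_def christoffel_eq\<close>)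
    have "A \<in> restricted_holonomy M g p"
      unfolding restricted_holonomy_def
    proof (intro CollectI conjI exI[of _ "cinv c \<circ> \<kappa>"] ballI)
      show "A \<in> tangent_space M p \<rightarrow>\<^sub>E tangent_space M p"
        unfolding A_def using mk_tvec_tangent[OF c] by auto
      show "pw_smooth_curve M (cinv c \<circ> \<kappa>)" by (rule pw_smooth_curve_chart[OF ca(1) Ck\<kappa> \<kappa>W])
      show "null_homotopic_loop (mtop M) p (cinv c \<circ> \<kappa>)"
        using null_homotopic_loop_chart[OF ca(1) _ ends star] Ck\<kappa>[of 0] p by simp
      fix a assume a: "a \<in> tangent_space M p"
      show "\<exists>V. parallel_along M g (cinv c \<circ> \<kappa>) V \<and> V 0 = a \<and> V 1 = A a"
        using par[of "a c"] a tangent_eq_mk_tvec[OF a c] V(1)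
        by (intro exI[of _ "\<lambda>t. mk_tvec M c (cinv c (\<kappa> t)) (V (a c) t)"]) (simp add: ends p A_def)
    qed
    moreover have "A (mk_tvec M c p w) = mk_tvec M c p (V w 1)" for w
      unfolding A_def using mk_tvec_tangent[OF c] by (simp add: mk_tvec_apply[OF c])
    ultimately show "\<exists>A\<in>restricted_holonomy M g p. \<forall>w. \<exists>V. V 0 = w \<and>
       A.loop_parallel ?x u v e V \<and> A (mk_tvec M c p w) = mk_tvec M c p (V 1)"
      using V by blast
  qed
qed

end


section \<open>The curvature of a quaternion-Kaehler manifold\<close>

lemma qmult_assoc: "qmult (qmult a b) c = qmult a (qmult b c)"
  by (simp add: qmult_def prod_eq_iff algebra_simps)

lemma qmult_add_left: "qmult (a + b) c = qmult a c + qmult b c"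
  by (simp add: qmult_def prod_eq_iff algebra_simps)

lemma qmult_sum_left: "qmult (sum f A) c = (\<Sum>x\<in>A. qmult (f x) c)"
  by (induction A rule: infinite_finite_induct) (simp_all add: qmult_add_left, simp_all add: qmult_def prod_eq_iff)

lemma qmult_qcnj: "norm q = 1 \<Longrightarrow> qmult q (qcnj q) = (1, 0)"
proof -
  assume "norm q = 1"
  then have "(cmod (fst q))\<^sup>2 + (cmod (snd q))\<^sup>2 = 1"
    by (simp add: norm_prod_def real_sqrt_eq_1_iff)
  then have "(complex_of_real (cmod (fst q)))\<^sup>2 + (complex_of_real (cmod (snd q)))\<^sup>2 = 1"
    by (metis of_real_1 of_real_add of_real_power)
  then show ?thesis
    by (simp add: qmult_def qcnj_def prod_eq_iff mult.commute flip: complex_norm_square)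
qed

text \<open>The units multiply from the right, hence commute with the matrices of \<open>Sp\<close>,
  which act from the left.\<close>

definition quatI :: "quat ^ 'm \<Rightarrow> quat ^ 'm" where
  "quatI x = (\<chi> i. qmult (x $ i) (\<i>, 0))"

definition quatJ :: "quat ^ 'm \<Rightarrow> quat ^ 'm" where
  "quatJ x = (\<chi> i. qmult (x $ i) (0, 1))"

lemma quaternionic_structure_quat: "quaternionic_structure (quatI :: quat ^ 'm \<Rightarrow> _) quatJ"
proof
  show "orth_map (quatI :: quat ^ 'm \<Rightarrow> _)"
    unfolding orth_map_def
    by (auto intro!: linearI sum.cong simp: quatI_def vec_eq_iff qmult_def prod_eq_iff inner_vec_def inner_prod_def
        inner_complex_def algebra_simps complex_eq_iff)
  show "orth_map (quatJ :: quat ^ 'm \<Rightarrow> _)"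
    unfolding orth_map_def
    by (auto intro!: linearI sum.cong simp: quatJ_def vec_eq_iff qmult_def prod_eq_iff inner_vec_def inner_prod_def
        inner_complex_def algebra_simps complex_eq_iff)
qed (simp_all add: quatI_def quatJ_def vec_eq_iff qmult_def prod_eq_iff mult.assoc)

text \<open>The composition \<open>quatI \<circ> quatJ\<close> is the right multiplication by \<open>j i = - k\<close>, whence the sign.\<close>

lemma qmult_imaginary:
  assumes "Re (fst r) = 0"
  shows "(\<chi> i. qmult (y $ i) r) =
    Im (fst r) *\<^sub>R quatI y + Re (snd r) *\<^sub>R quatJ y + (- Im (snd r)) *\<^sub>R quatI (quatJ y)"
  using assms
  by (auto simp: vec_eq_iff prod_eq_iff qmult_def quatI_def quatJ_def complex_eq_iff algebra_simps)

text \<open>For an imaginary t one has a x t q = (a x q)(q' t q) with q' the conjugate of q, and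
  conjugation by a unit quaternion preserves imaginary quaternions.\<close>

lemma SpSp1_normalizes:
  assumes B: "B \<in> SpSp1" and T: "T = quatI \<or> T = quatJ"
  shows "\<exists>p q r. \<forall>x. B (T x) = p *\<^sub>R quatI (B x) + q *\<^sub>R quatJ (B x) + r *\<^sub>R quatI (quatJ (B x))"
proof -
  obtain a q where Bq: "B = (\<lambda>x. \<chi> i. qmult (\<Sum>j\<in>UNIV. qmult (a $ i $ j) (x $ j)) q)" and q: "norm q = 1"
    using B unfolding SpSp1_def by blast
  obtain t where t: "T = (\<lambda>x. \<chi> i. qmult (x $ i) t)" "Re (fst t) = 0"
  proof (cases "T = quatI")
    case True
    show ?thesis by (rule that[of "(\<i>, 0)"]) (auto simp: True quatI_def[abs_def])
  next
    case False
    then have "T = quatJ" using T by blast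
    then show ?thesis by (intro that[of "(0, 1)"]) (auto simp: quatJ_def[abs_def])
  qed
  define r where "r = qmult (qmult (qcnj q) t) q"
  have "Re (fst r) = 0"
    using t(2) by (simp add: r_def qmult_def qcnj_def algebra_simps)
  have "B (T x) = (\<chi> i. qmult (B x $ i) r)" for x
  proof (simp add: vec_eq_iff Bq t(1), rule allI)
    fix i
    let ?s = "\<Sum>j\<in>UNIV. qmult (a $ i $ j) (x $ j)"
    have "(\<Sum>j\<in>UNIV. qmult (a $ i $ j) (qmult (x $ j) t)) = qmult ?s t"
      by (simp add: qmult_sum_left qmult_assoc)
    moreover have "qmult (qmult ?s q) r = qmult ?s (qmult (qmult q (qcnj q)) (qmult t q))"
      by (simp add: r_def qmult_assoc)
    moreover have "qmult (1, 0) z = z" for z by (simp add: qmult_def)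
    ultimately show "qmult (\<Sum>j\<in>UNIV. qmult (a $ i $ j) (qmult (x $ j) t)) q = qmult (qmult ?s q) r"
      using qmult_qcnj[OF q] by (simp add: qmult_assoc)
  qed
  then show ?thesis using qmult_imaginary[OF \<open>Re (fst r) = 0\<close>] by metis
qed

context quaternionic_structure
begin

text \<open>The coefficients of the commutators are recovered by inner products, hence converge.\<close>

lemma commutator_limit:
  fixes B :: "nat \<Rightarrow> 'v \<Rightarrow> 'v"
  assumes comm: "\<And>n. \<exists>p q r. \<forall>x. B n (T x) - T (B n x) = p *\<^sub>R I (B n x) + q *\<^sub>R J (B n x) + r *\<^sub>R I (J (B n x))"
    and E: "\<And>x. (\<lambda>n. s n *\<^sub>R (B n x - x)) \<longlonglongrightarrow> E x" and s: "\<And>n. s n \<noteq> 0" "(\<lambda>n. inverse (s n)) \<longlonglongrightarrow> 0"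
    and T: "linear T"
  shows "\<exists>p q r. \<forall>x. E (T x) - T (E x) = p *\<^sub>R I x + q *\<^sub>R J x + r *\<^sub>R I (J x)"
proof -
  have lims: "(f \<longlongrightarrow> l) F \<Longrightarrow> ((\<lambda>n. T (f n)) \<longlongrightarrow> T l) F" "(f \<longlongrightarrow> l) F \<Longrightarrow> ((\<lambda>n. I (f n)) \<longlongrightarrow> I l) F"
    "(f \<longlongrightarrow> l) F \<Longrightarrow> ((\<lambda>n. J (f n)) \<longlongrightarrow> J l) F" for f l and F :: "nat filter"
    using bounded_linear.tendsto T IJ_linear linear_conv_bounded_linear by blast+
  obtain p q r where pqr: "\<And>n x. B n (T x) - T (B n x) = p n *\<^sub>R I (B n x) + q n *\<^sub>R J (B n x) + r n *\<^sub>R I (J (B n x))"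
    using comm by metis
  \<comment> \<open>The differences \<open>B n x - x\<close>, scaled by \<open>s n\<close>,
    converge, and \<open>inverse (s n)\<close> tends to 0.\<close>
  have B: "(\<lambda>n. B n x) \<longlonglongrightarrow> x" for x
  proof -
    have "(\<lambda>n. x + inverse (s n) *\<^sub>R (s n *\<^sub>R (B n x - x))) \<longlonglongrightarrow> x + 0 *\<^sub>R E x"
      by (intro tendsto_intros s E)
    then show ?thesis using s(1) by simp
  qed
  define C where "C n x = s n *\<^sub>R (B n (T x) - T (B n x))" for n x
  have C: "(\<lambda>n. C n x) \<longlonglongrightarrow> E (T x) - T (E x)" for x
  proof -
    have "(\<lambda>n. s n *\<^sub>R (B n (T x) - T x) - T (s n *\<^sub>R (B n x - x))) \<longlonglongrightarrow> E (T x) - T (E x)"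
      by (intro tendsto_diff lims E)
    then show ?thesis
      unfolding C_def using T by (simp add: linear_cmul linear_diff scaleR_diff_right)
  qed
  have C_eq: "C n x = (s n * p n) *\<^sub>R I (B n x) + (s n * q n) *\<^sub>R J (B n x) + (s n * r n) *\<^sub>R I (J (B n x))" for n x
    unfolding C_def pqr by (simp add: scaleR_add_right)
  \<comment> \<open>All three coefficients are read off at this vector: the images of
    \<open>B n z\<close> under the units are orthogonal and as long as \<open>B n z\<close>, which
    is eventually nonzero.\<close>
  obtain z :: 'v where z: "z \<noteq> 0" using nonempty_Basis nonzero_Basis by blast
  let ?D = "E (T z) - T (E z)"
  have conv: "(\<lambda>n. (C n z \<bullet> U (B n z)) / (B n z \<bullet> B n z)) \<longlonglongrightarrow> (?D \<bullet> U z) / (z \<bullet> z)"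
    if "(\<lambda>n. U (B n z)) \<longlonglongrightarrow> U z" for U
    by (intro tendsto_divide tendsto_inner C B that) (use z in simp)
  have ev: "\<forall>\<^sub>F n in sequentially. B n z \<noteq> 0"
    using tendsto_imp_eventually_ne[OF B z] .
  have "(\<lambda>n. s n * p n) \<longlonglongrightarrow> (?D \<bullet> I z) / (z \<bullet> z)"
    by (rule Lim_transform_eventually[OF conv[of I]])
      (use ev in \<open>auto intro!: lims B elim!: eventually_mono simp: C_eq inner_add_left frame_inner\<close>)
  moreover have "(\<lambda>n. s n * q n) \<longlonglongrightarrow> (?D \<bullet> J z) / (z \<bullet> z)"
    by (rule Lim_transform_eventually[OF conv[of J]])
      (use ev in \<open>auto intro!: lims B elim!: eventually_mono simp: C_eq inner_add_left frame_inner\<close>)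
  moreover have "(\<lambda>n. s n * r n) \<longlonglongrightarrow> (?D \<bullet> I (J z)) / (z \<bullet> z)"
    by (rule Lim_transform_eventually[OF conv[of "\<lambda>x. I (J x)"]])
      (use ev in \<open>auto intro!: lims B elim!: eventually_mono simp: C_eq inner_add_left frame_inner\<close>)
  ultimately have "(\<lambda>n. C n x) \<longlonglongrightarrow> ((?D \<bullet> I z) / (z \<bullet> z)) *\<^sub>R I x + ((?D \<bullet> J z) / (z \<bullet> z)) *\<^sub>R J x
      + ((?D \<bullet> I (J z)) / (z \<bullet> z)) *\<^sub>R I (J x)" for x
    unfolding C_eq by (intro tendsto_add tendsto_scaleR lims B)
  then show ?thesis using LIMSEQ_unique C by blast
qed

end

lemma isometry_inverse:
  fixes F :: "'e::euclidean_space \<Rightarrow> 'e"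
  assumes "linear F" "inj F"
  shows "linear (inv F)" "F (inv F y) = y" "inv F (F y) = y"
proof -
  have s: "surj F" using linear_injective_imp_surjective assms by blast
  show 1: "F (inv F y) = y" for y using s by (rule surj_f_inv_f)
  show 2: "inv F (F y) = y" for y using assms(2) by (rule inv_f_f)
  show "linear (inv F)"
    by (intro linearI; rule injD[OF assms(2)]) (simp_all add: 1 linear_add[OF assms(1)] linear_cmul[OF assms(1)])
qed

text \<open>Moves the curvature at a point to the model space, where the metric is the inner product
  of the type and the algebraic results apply.\<close>

lemma (in local_riemann) curvature_tensor_pullback:
  fixes F :: "'e \<Rightarrow> 'e"
  assumes x: "x \<in> W" and F: "linear F" "inj F" and iso: "\<And>y z. G x (F y) (F z) = y \<bullet> z"
  shows "curvature_tensor (\<lambda>u v w. inv F (R x (F u) (F v) (F w)))"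
proof -
  note inv = isometry_inverse[OF F]
  have "inv F y \<bullet> z = G x y (F z)" for y z using iso[of "inv F y" z] inv by simp
  note ip = this
  have lc: "linear f \<Longrightarrow> linear (\<lambda>u. inv F (f (F u)))" for f
    using linear_compose[OF linear_compose[OF F(1)] inv(1), of f] by (simp add: comp_def)
  show ?thesis
  proof (rule curvature_tensor.intro)
    show "linear (\<lambda>u. inv F (R x (F u) (F v) (F w)))" for v w by (rule lc[OF curv_linear(1)[OF x]])
    show "linear (\<lambda>v. inv F (R x (F u) (F v) (F w)))" for u w by (rule lc[OF curv_linear(2)[OF x]])
    show "linear (\<lambda>w. inv F (R x (F u) (F v) (F w)))" for u v by (rule lc[OF curv_linear(3)[OF x]])
    show "inv F (R x (F u) (F v) (F w)) = - inv F (R x (F v) (F u) (F w))" for u v w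
      by (subst curv_antisym) (simp add: linear_neg[OF inv(1)])
    show "inv F (R x (F u) (F v) (F w)) + inv F (R x (F v) (F w) (F u)) + inv F (R x (F w) (F u) (F v)) = 0" for u v w
      by (simp add: curv_bianchi[OF x] linear_0[OF inv(1)] flip: linear_add[OF inv(1)])
    show "inv F (R x (F u) (F v) (F w)) \<bullet> z = - (inv F (R x (F u) (F v) (F z)) \<bullet> w)" for u v w z
      unfolding ip by (rule curv_skew[OF x])
  qed
qed

text \<open>Holonomies of loops of size \<open>e n\<close> become maps \<open>B n\<close> in
  \<open>SpSp1\<close>, and their differences to the identity, divided by
  \<open>(e n)\<^sup>2\<close>, tend to \<open>- (1/60) *\<^sub>R Rm u v\<close>. Lying in the span
  of I, J, K is a closed condition, so it passes from the commutators of the \<open>B n\<close> to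
  those of the curvature.\<close>

theorem quaternion_kaehler_curvature:
  fixes M :: "('a, quat ^ 'm) manifold"
  assumes qk: "quaternion_kaehler M g" and c: "c \<in> charts_at M p"
  shows "\<exists>F :: quat ^ 'm \<Rightarrow> quat ^ 'm. linear F \<and> inj F \<and> (\<forall>y z. local_metric M g c (snd c p) (F y) (F z) = y \<bullet> z) \<and>
    quaternionic_curvature (\<lambda>u v w. inv F (curvature M g c (snd c p) (F u) (F v) (F w))) quatI quatJ"
proof -
  interpret riemannian_manifold M g
    by standard (use qk in \<open>simp_all add: quaternion_kaehler_def\<close>)
  have ca: "c \<in> atlas M" "p \<in> fst c" using c by (auto simp: charts_at_iff)
  interpret A: local_riemann "snd c ` fst c" "local_metric M g c" by (rule chart_riemann[OF ca(1)])
  interpret Q: quaternionic_structure "quatI :: quat ^ 'm \<Rightarrow> _" quatJ by (rule quaternionic_structure_quat)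
  let ?x = "snd c p"
  have x: "?x \<in> snd c ` fst c" using ca by simp
  have "p \<in> points M" using ca points_charts by blast
  then obtain L where L: "orthonormal_frame M g p L" and hol: "\<And>A. A \<in> restricted_holonomy M g p \<Longrightarrow> \<exists>B\<in>SpSp1. \<forall>x. A (L x) = L (B x)"
    using qk unfolding quaternion_kaehler_def by blast
  define F where "F y = L y c" for y
  have Lt: "L y \<in> tangent_space M p" for y using L by (simp add: orthonormal_frame_def)
  have LF: "L y = mk_tvec M c p (F y)" for y unfolding F_def by (rule tangent_eq_mk_tvec[OF Lt c])
  have lin: "linear F" using L c unfolding orthonormal_frame_def F_def by blast
  have iso: "local_metric M g c ?x (F y) (F z) = y \<bullet> z" for y z
    unfolding F_def local_metric_tangent[OF c Lt Lt] using L by (simp add: orthonormal_frame_def)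
  have inj: "inj F"
  proof (rule linear_injective_0[OF lin, THEN iffD2], intro allI impI)
    fix y assume "F y = 0"
    then have "y \<bullet> y = 0" using iso[of y y] bilinear_lzero[OF A.bil[OF x]] by simp
    then show "y = 0" by simp
  qed
  note inv = isometry_inverse[OF lin inj]
  define Rm where "Rm u v w = inv F (A.R ?x (F u) (F v) (F w))" for u v w
  have comm: "\<exists>p q r. \<forall>w. Rm u v (T w) - T (Rm u v w) = p *\<^sub>R quatI w + q *\<^sub>R quatJ w + r *\<^sub>R quatI (quatJ w)"
    if T: "T = quatI \<or> T = quatJ" for T u v
  proof -
    obtain e0 where e0: "e0 > 0" "\<And>e. 0 < e \<Longrightarrow> e < e0 \<Longrightarrow> \<exists>A\<in>restricted_holonomy M g p. \<forall>w. \<exists>V. V 0 = w \<and>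
        A.loop_parallel ?x (F u) (F v) e V \<and> A (mk_tvec M c p w) = mk_tvec M c p (V 1)"
      using loop_holonomy[OF c, of "F u" "F v"] by blast
    define e where "e n = e0 / 2 * inverse (real (Suc n))" for n
    have e: "0 < e n" "e n < e0" for n
    proof -
      show "0 < e n" using e0(1) by (simp add: e_def)
      have "e n \<le> e0 / 2 * 1" unfolding e_def using e0(1) by (intro mult_left_mono) (auto simp: inverse_le_1_iff)
      then show "e n < e0" using e0(1) by simp
    qed
    have e_lim: "e \<longlonglongrightarrow> 0"
      unfolding e_def by (rule tendsto_mult_right_zero[OF LIMSEQ_inverse_real_of_nat])
    let ?par = "A.loop_parallel ?x (F u) (F v)" and ?hol = "A.R ?x (F u) (F v)"
    have "\<exists>B\<in>SpSp1. \<forall>y. \<exists>V. V 0 = F y \<and> ?par (e n) V \<and> F (B y) = V 1" for n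
    proof -
      obtain A where A: "A \<in> restricted_holonomy M g p" "\<And>w. \<exists>V. V 0 = w \<and>
        ?par (e n) V \<and> A (mk_tvec M c p w) = mk_tvec M c p (V 1)"
        using e0(2)[OF e] by blast
      obtain B where B: "B \<in> SpSp1" "\<And>y. A (L y) = L (B y)" using hol[OF A(1)] by blast
      show ?thesis
      proof (intro bexI[OF _ B(1)] allI)
        fix y
        obtain V where V: "V 0 = F y" "?par (e n) V" "A (mk_tvec M c p (F y)) = mk_tvec M c p (V 1)"
          using A(2) by blast
        have "mk_tvec M c p (F (B y)) = mk_tvec M c p (V 1)" using V(3) B(2)[of y] unfolding LF by simp
        then have "F (B y) = V 1" using mk_tvec_apply[OF c] by metis
        then show "\<exists>V. V 0 = F y \<and> ?par (e n) V \<and> F (B y) = V 1" using V by blast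
      qed
    qed
    then obtain B where B: "\<And>n. B n \<in> SpSp1"
      "\<And>n y. \<exists>V. V 0 = F y \<and> ?par (e n) V \<and> F (B n y) = V 1"
      by metis
    have lim: "(\<lambda>n. (1 / (e n)\<^sup>2) *\<^sub>R (F (B n y) - F y)) \<longlonglongrightarrow> - ((1/60) *\<^sub>R ?hol (F y))" for y
    proof (rule LIMSEQ_I)
      fix r :: real assume "r > 0"
      then have "r / 2 > 0" by simp
      from A.loop_parallel_expansion[OF x this, of "F y" "F u" "F v"] obtain e1 where e1: "e1 > 0"
        "\<And>e V. 0 < e \<Longrightarrow> e < e1 \<Longrightarrow> V 0 = F y \<Longrightarrow> ?par e V \<Longrightarrow>
          norm ((1 / e\<^sup>2) *\<^sub>R (V 1 - F y) + (1/60) *\<^sub>R ?hol (F y)) \<le> r / 2" by blast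
      have "\<forall>\<^sub>F n in sequentially. e n < e1" using order_tendstoD(2)[OF e_lim e1(1)] .
      then obtain N where N: "\<And>n. n \<ge> N \<Longrightarrow> e n < e1" by (auto simp: eventually_sequentially)
      have "norm ((1 / (e n)\<^sup>2) *\<^sub>R (F (B n y) - F y) - - ((1/60) *\<^sub>R ?hol (F y))) < r" if "n \<ge> N" for n
      proof -
        obtain V where "V 0 = F y" "?par (e n) V" "F (B n y) = V 1" using B(2) by blast
        with e1(2)[OF e(1) N[OF that], of V] \<open>r > 0\<close> show ?thesis by simp
      qed
      then show "\<exists>N. \<forall>n\<ge>N. norm ((1 / (e n)\<^sup>2) *\<^sub>R (F (B n y) - F y) - - ((1/60) *\<^sub>R ?hol (F y))) < r" by blast
    qed
    have bl: "bounded_linear (inv F)" using inv(1) linear_conv_bounded_linear by blast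
    have lim': "(\<lambda>n. (1 / (e n)\<^sup>2) *\<^sub>R (B n y - y)) \<longlonglongrightarrow> - ((1/60) *\<^sub>R Rm u v y)" for y
      using bounded_linear.tendsto[OF bl lim[of y]]
      by (simp add: linear_cmul[OF inv(1)] linear_diff[OF inv(1)] linear_neg[OF inv(1)] inv Rm_def)
    have Tlin: "linear T" using T Q.IJ_linear by blast
    have "\<exists>p q r. \<forall>y. - ((1/60) *\<^sub>R Rm u v (T y)) - T (- ((1/60) *\<^sub>R Rm u v y)) =
       p *\<^sub>R quatI y + q *\<^sub>R quatJ y + r *\<^sub>R quatI (quatJ y)"
    proof (rule Q.commutator_limit[OF _ lim' _ _ Tlin])
      fix n
      obtain p q r where *: "\<And>y. B n (T y) = p *\<^sub>R quatI (B n y) + q *\<^sub>R quatJ (B n y) + r *\<^sub>R quatI (quatJ (B n y))"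
        using SpSp1_normalizes[OF B(1) T] by blast
      show "\<exists>p q r. \<forall>y. B n (T y) - T (B n y) = p *\<^sub>R quatI (B n y) + q *\<^sub>R quatJ (B n y) + r *\<^sub>R quatI (quatJ (B n y))"
      \<comment> \<open>Subtracting \<open>T (B n y)\<close> lowers the coefficient belonging to
        \<open>T\<close> by one.\<close>
      proof (cases "T = quatI")
        case True
        show ?thesis by (intro exI[of _ "p - 1"] exI[of _ q] exI[of _ r] allI, unfold *) (simp add: True algebra_simps)
      next
        case False
        then have "T = quatJ" using T by blast
        then show ?thesis by (intro exI[of _ p] exI[of _ "q - 1"] exI[of _ r] allI, unfold *) (simp add: algebra_simps)
      qed
    next
      show "1 / (e n)\<^sup>2 \<noteq> 0" for n using e[of n] by simp
      show "(\<lambda>n. inverse (1 / (e n)\<^sup>2)) \<longlonglongrightarrow> 0" using tendsto_power[OF e_lim, of 2] by simp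
    qed
    then obtain p q r where **: "\<And>y. - ((1/60) *\<^sub>R Rm u v (T y)) - T (- ((1/60) *\<^sub>R Rm u v y)) =
       p *\<^sub>R quatI y + q *\<^sub>R quatJ y + r *\<^sub>R quatI (quatJ y)" by blast
    show ?thesis
    proof (intro exI allI)
      fix w
      \<comment> \<open>The factor -60 undoes the area of the loop and the sign of the transport
        equation.\<close>
      have "Rm u v (T w) - T (Rm u v w) = (-60) *\<^sub>R (- ((1/60) *\<^sub>R Rm u v (T w)) - T (- ((1/60) *\<^sub>R Rm u v w)))"
        by (simp add: linear_neg[OF Tlin] linear_cmul[OF Tlin] scaleR_diff_right)
      also have "\<dots> = (-60 * p) *\<^sub>R quatI w + (-60 * q) *\<^sub>R quatJ w + (-60 * r) *\<^sub>R quatI (quatJ w)"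
        unfolding ** by (simp only: scaleR_add_right scaleR_scaleR)
      finally show "Rm u v (T w) - T (Rm u v w) = (-60 * p) *\<^sub>R quatI w + (-60 * q) *\<^sub>R quatJ w + (-60 * r) *\<^sub>R quatI (quatJ w)" .
    qed
  qed
  interpret CT: curvature_tensor Rm
    unfolding Rm_def[abs_def] by (rule A.curvature_tensor_pullback[OF x lin inj iso])
  have "quaternionic_curvature Rm quatI quatJ"
    by unfold_locales (use comm in blast)+
  then have "quaternionic_curvature (\<lambda>u v w. inv F (curvature M g c ?x (F u) (F v) (F w))) quatI quatJ"
    unfolding curvature_eq Rm_def[abs_def] .
  then show ?thesis using lin inj iso by blast
qed


section \<open>Umbilical hypersurfaces\<close>

text \<open>\<open>f\<close> and \<open>n\<close> are the inclusion and the unit normal in charts.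
  The vector \<open>z\<close> in \<open>umbilical\<close> collects the whole tangential part, so the
  condition prescribes the normal component.\<close>

locale umbilical_hypersurface = local_riemann W G
  for W :: "'e::euclidean_space set" and G +
  fixes U :: "'d::euclidean_space set" and f n :: "'d \<Rightarrow> 'e" and l :: real
  assumes open_U: "open U" and fU: "x \<in> U \<Longrightarrow> f x \<in> W"
    and Ck_f: "Ck_on k U f" and Ck_n: "Ck_on k U n"
    and codim: "DIM('d) + 1 = DIM('e)"
    and unit: "x \<in> U \<Longrightarrow> G (f x) (n x) (n x) = 1"
    and normal: "x \<in> U \<Longrightarrow> G (f x) (\<D> f x w) (n x) = 0"
    and immersion: "x \<in> U \<Longrightarrow> inj (\<D> f x)"
    and umbilical: "x \<in> U \<Longrightarrow> \<exists>z. \<D> (\<lambda>y. \<D> f y w) x u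
      + levi_form G (f x) (\<D> f x u) (\<D> f x w)
      - \<D> f x z =
      (l * G (f x) (\<D> f x u) (\<D> f x w)) *\<^sub>R n x"
begin

abbreviation df :: "'d \<Rightarrow> 'd \<Rightarrow> 'e" where "df x \<equiv> \<D> f x"
abbreviation dn :: "'d \<Rightarrow> 'd \<Rightarrow> 'e" where "dn x \<equiv> \<D> n x"
abbreviation ddf :: "'d \<Rightarrow> 'd \<Rightarrow> 'd \<Rightarrow> 'e" where
  "ddf x u w \<equiv> \<D> (\<lambda>y. df y w) x u"

lemma f_deriv: "x \<in> U \<Longrightarrow> (f has_derivative df x) (at x)"
  and n_deriv: "x \<in> U \<Longrightarrow> (n has_derivative dn x) (at x)"
  using Ck_on_has_derivative[OF Ck_f] Ck_on_has_derivative[OF Ck_n] by blast+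

lemma df_deriv:
  assumes x: "x \<in> U" shows "((\<lambda>y. df y w) has_derivative (\<lambda>u. ddf x u w)) (at x)"
proof -
  have "Ck_on (Suc 0) U (\<lambda>y. df y w)" using Ck_f[of "Suc (Suc 0)"] by simp
  from Ck_on_has_derivative[OF this x] show ?thesis .
qed

lemma df_linear: "x \<in> U \<Longrightarrow> linear (df x)"
  using f_deriv has_derivative_linear by blast

text \<open>The map sending a tangent vector and a multiple of the normal to their sum is injective,
  and codimension one makes the dimensions equal.\<close>

lemma tangent_normal_decomposition:
  assumes x: "x \<in> U" shows "\<exists>w s. y = df x w + s *\<^sub>R n x"
proof -
  define \<Phi> where "\<Phi> z = df x (fst z) + snd z *\<^sub>R n x" for z :: "'d \<times> real"
  note b = bil[OF fU[OF x]]
  have lin: "linear \<Phi>"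
    unfolding \<Phi>_def using df_linear[OF x]
    by (intro linearI) (simp_all add: linear_add linear_cmul algebra_simps)
  have "inj \<Phi>"
  proof (rule linear_injective_0[OF lin, THEN iffD2], intro allI impI)
    fix z assume z: "\<Phi> z = 0"
    have "G (f x) (\<Phi> z) (n x) = snd z"
      unfolding \<Phi>_def using unit[OF x] normal[OF x] by (simp add: bilinear_ladd[OF b] bilinear_lmul[OF b])
    then have s: "snd z = 0" using z bilinear_lzero[OF b] by simp
    then have "df x (fst z) = df x 0" using z linear_0[OF df_linear[OF x]] by (simp add: \<Phi>_def)
    then show "z = 0" using s injD[OF immersion[OF x]] by (simp add: prod_eq_iff)
  qed
  then have "dim (range \<Phi>) = DIM('d \<times> real)"
    using dim_image_eq[OF lin, of UNIV] by simp
  then have "dim (range \<Phi>) = DIM('e)" using codim by simp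
  then have "span (range \<Phi>) = UNIV" using dim_eq_full by blast
  moreover have "span (range \<Phi>) = range \<Phi>"
    using span_linear_image[OF lin, of UNIV] by simp
  ultimately obtain z where "y = \<Phi> z" by blast
  then show ?thesis unfolding \<Phi>_def by blast
qed

lemma tangent_if_orthogonal:
  assumes x: "x \<in> U" and y: "G (f x) y (n x) = 0" shows "\<exists>w. y = df x w"
proof -
  obtain w s where ws: "y = df x w + s *\<^sub>R n x" using tangent_normal_decomposition[OF x] by blast
  note b = bil[OF fU[OF x]]
  have "G (f x) y (n x) = s"
    unfolding ws using unit[OF x] normal[OF x] by (simp add: bilinear_ladd[OF b] bilinear_lmul[OF b])
  then show ?thesis using ws y by auto
qed

text \<open>The covariant derivative \<open>N\<close> of the unit normal is determined by two kinds
  of products: with \<open>n x\<close>, where constant length gives 0, and with tangent vectors,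
  where differentiating orthogonality brings in the umbilical condition.\<close>

lemma weingarten:
  assumes x: "x \<in> U"
  shows "dn x u = - (l *\<^sub>R df x u) - \<Gamma> (f x) (df x u) (n x)"
proof -
  note b = bil[OF fU[OF x]]
  note bs = bilinear_ladd[OF b] bilinear_lmul[OF b] bilinear_radd[OF b] bilinear_rmul[OF b]
  define N where "N = dn x u + \<Gamma> (f x) (df x u) (n x)"
  have d1: "((\<lambda>y. G (f y) (n y) (n y)) has_derivative (\<lambda>u. G (f x) (dn x u + \<Gamma> (f x) (df x u) (n x)) (n x) +
       G (f x) (n x) (dn x u + \<Gamma> (f x) (df x u) (n x)))) (at x)"
    by (rule metric_derivative[OF fU[OF x] f_deriv[OF x] n_deriv[OF x] n_deriv[OF x]])
  have d2: "((\<lambda>y. G (f y) (n y) (n y)) has_derivative (\<lambda>u. 0)) (at x)"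
    by (rule has_derivative_transform_within_open[OF has_derivative_const open_U x]) (simp add: unit)
  from fun_cong[OF has_derivative_unique[OF d1 d2], of u]
  have "G (f x) N (n x) + G (f x) (n x) N = 0" unfolding N_def .
  then have Nn: "G (f x) N (n x) = 0" using sym[OF fU[OF x], of N] by simp
  have Nw: "G (f x) N (df x w) = - (l * G (f x) (df x u) (df x w))" for w
  proof -
    have d1: "((\<lambda>y. G (f y) (df y w) (n y)) has_derivative (\<lambda>u. G (f x) (ddf x u w + \<Gamma> (f x) (df x u) (df x w)) (n x) +
         G (f x) (df x w) (dn x u + \<Gamma> (f x) (df x u) (n x)))) (at x)"
      by (rule metric_derivative[OF fU[OF x] f_deriv[OF x] df_deriv[OF x] n_deriv[OF x]])
    have d2: "((\<lambda>y. G (f y) (df y w) (n y)) has_derivative (\<lambda>u. 0)) (at x)"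
      by (rule has_derivative_transform_within_open[OF has_derivative_const open_U x]) (simp add: normal)
    from fun_cong[OF has_derivative_unique[OF d1 d2], of u]
    have 0: "G (f x) (ddf x u w + \<Gamma> (f x) (df x u) (df x w)) (n x) + G (f x) (df x w) N = 0"
      unfolding N_def .
    obtain z where "ddf x u w + \<Gamma> (f x) (df x u) (df x w) - df x z = (l * G (f x) (df x u) (df x w)) *\<^sub>R n x"
      using umbilical[OF x] by blast
    then have z: "ddf x u w + \<Gamma> (f x) (df x u) (df x w) = df x z + (l * G (f x) (df x u) (df x w)) *\<^sub>R n x"
      by (simp add: algebra_simps)
    have "G (f x) (ddf x u w + \<Gamma> (f x) (df x u) (df x w)) (n x) = l * G (f x) (df x u) (df x w)"
      unfolding z using unit[OF x] normal[OF x] by (simp add: bs)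
    then show ?thesis using 0 sym[OF fU[OF x], of N "df x w"] by simp
  qed
  have "N + l *\<^sub>R df x u = 0"
  proof (rule nondegenerate[OF fU[OF x]])
    fix y
    obtain w s where ws: "y = df x w + s *\<^sub>R n x" using tangent_normal_decomposition[OF x] by blast
    show "G (f x) (N + l *\<^sub>R df x u) y = 0"
      unfolding ws using Nn Nw normal[OF x] by (simp add: bs)
  qed
  then show ?thesis unfolding N_def by (simp add: algebra_simps eq_neg_iff_add_eq_0)
qed

text \<open>The second derivatives of the normal, computed from the Weingarten equation, commute.\<close>

lemma curvature_kills_normal:
  assumes x: "x \<in> U" and X: "G (f x) X (n x) = 0" and Y: "G (f x) Y (n x) = 0"
  shows "R (f x) X Y (n x) = 0"
proof -
  obtain u v where u: "X = df x u" and v: "Y = df x v" using tangent_if_orthogonal[OF x] X Y by blast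
  note fx = fU[OF x]
  note bG = levi_bilinear[OF fx]
  have D: "\<D> (\<lambda>y. dn y v) x u =
    - (l *\<^sub>R ddf x u v) - (d\<Gamma> (f x) (df x u) (df x v) (n x) + \<Gamma> (f x) (ddf x u v) (n x)
      + \<Gamma> (f x) (df x v) (- (l *\<^sub>R df x u) - \<Gamma> (f x) (df x u) (n x)))" for u v
  proof -
    have "((\<lambda>y. - (l *\<^sub>R df y v) - \<Gamma> (f y) (df y v) (n y)) has_derivative
      (\<lambda>u. - (l *\<^sub>R ddf x u v) - (d\<Gamma> (f x) (df x u) (df x v) (n x) + \<Gamma> (f x) (ddf x u v) (n x)
        + \<Gamma> (f x) (df x v) (dn x u)))) (at x)"
      by (intro has_derivative_diff has_derivative_minus has_derivative_scaleR_right df_deriv[OF x]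
        bilinear_family_derivative[OF open_W fx levi_bilinear levi_differentiable[OF fx] f_deriv[OF x] df_deriv[OF x] n_deriv[OF x]])
    then have "((\<lambda>y. dn y v) has_derivative
      (\<lambda>u. - (l *\<^sub>R ddf x u v) - (d\<Gamma> (f x) (df x u) (df x v) (n x) + \<Gamma> (f x) (ddf x u v) (n x)
        + \<Gamma> (f x) (df x v) (dn x u)))) (at x)"
      by (rule has_derivative_transform_within_open[OF _ open_U x]) (rule weingarten[symmetric])
    from frechet_derivative_eqI[OF this] show ?thesis by (simp only: weingarten[OF x])
  qed
  have s1: "\<D> (\<lambda>y. dn y v) x u = \<D> (\<lambda>y. dn y u) x v"
    by (rule symmetric_second_derivative[OF open_U x Ck_n])
  have s2: "ddf x u v = ddf x v u"
    by (rule symmetric_second_derivative[OF open_U x Ck_f])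
  have s3: "\<Gamma> (f x) (df x u) (df x v) = \<Gamma> (f x) (df x v) (df x u)" by (rule levi_sym[OF fx])
  \<comment> \<open>Under the exchange of \<open>u\<close> and \<open>v\<close> the terms with
    \<open>l\<close> and with second derivatives of \<open>f\<close> agree by \<open>s2\<close> and
    \<open>s3\<close>; the rest is the curvature formula.\<close>
  have "d\<Gamma> (f x) (df x u) (df x v) (n x) - \<Gamma> (f x) (df x v) (\<Gamma> (f x) (df x u) (n x))
     = d\<Gamma> (f x) (df x v) (df x u) (n x) - \<Gamma> (f x) (df x u) (\<Gamma> (f x) (df x v) (n x))"
    using s1 unfolding D s2 bilinear_rsub[OF bG] bilinear_rneg[OF bG] bilinear_rmul[OF bG] s3
    by (simp add: algebra_simps)
  then show ?thesis unfolding u v curv_form_def by (simp add: algebra_simps)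
qed

end

section \<open>Coordinate fields cut off to global fields\<close>

context manifold_charts
begin

definition bump_field :: "('a, 'e) chart \<Rightarrow> ('e \<Rightarrow> real) \<Rightarrow> 'e \<Rightarrow> 'a \<Rightarrow> ('a, 'e) tvec" where
  "bump_field c \<phi> u q = (if q \<in> fst c then mk_tvec M c q (\<phi> (snd c q) *\<^sub>R u) else (\<lambda>_. 0))"

lemma zero_tangent: "(\<lambda>_. 0) \<in> tangent_space M q"
  unfolding tangent_space_def using dtrans_linear linear_0 by fastforce

text \<open>Two open sets cover the manifold: the chart domain, where the field is a smooth multiple
  of a coordinate field, and the complement of the compact set \<open>K\<close>, where it is zero.
  The Hausdorff property makes \<open>K\<close> closed.\<close>

lemma bump_field_smooth:
  assumes c: "c \<in> atlas M" and \<phi>: "\<And>k. Ck_on k UNIV \<phi>" "\<And>x. dist x0 x \<ge> r \<Longrightarrow> \<phi> x = 0"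
    and ball: "cball x0 r \<subseteq> snd c ` fst c"
  shows "smooth_field M (bump_field c \<phi> u)"
  unfolding smooth_field_along_def
proof (intro conjI ballI)
  show "bump_field c \<phi> u p \<in> tangent_space M (id p)" for p
    using mk_tvec_tangent[of c p] zero_tangent c by (simp add: bump_field_def charts_at_iff)
  define K where "K = cinv c ` cball x0 r"
  have "continuous_map (top_of_set (cball x0 r)) (mtop M) (cinv c)"
    using continuous_map_from_subtopology_mono[OF cinv_continuous[OF c] ball] .
  then have "compactin (mtop M) K"
    unfolding K_def by (rule image_compactin[rotated]) (simp add: compactin_subtopology)
  then have closedK: "closedin (mtop M) K"
    using mfd by (simp add: compactin_imp_closedin smooth_manifold_def)
  have zero: "bump_field c \<phi> u q = (\<lambda>_. 0)" if "q \<notin> K" for q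
  proof (cases "q \<in> fst c")
    case True
    then have "snd c q \<notin> cball x0 r" using that cinv_left[OF c True] unfolding K_def by (metis imageI)
    then have "\<phi> (snd c q) = 0" using \<phi>(2) by simp
    then show ?thesis
      using True c linear_0[OF dtrans_linear[of c q]] by (auto simp: bump_field_def mk_tvec_def charts_at_iff)
  qed (simp add: bump_field_def)
  fix c1 c2 assume c1: "c1 \<in> atlas M" and c2: "c2 \<in> atlas M"
  have C: "Ck_on k (snd c1 ` (fst c1 \<inter> fst c2)) (\<lambda>x. bump_field c \<phi> u (cinv c1 x) c2)" for k
  proof (rule Ck_on_local)
    fix x assume "x \<in> snd c1 ` (fst c1 \<inter> fst c2)"
    then obtain q where q: "q \<in> fst c1" "q \<in> fst c2" "x = snd c1 q" by blast
    show "\<exists>U. open U \<and> x \<in> U \<and> Ck_on k U (\<lambda>x. bump_field c \<phi> u (cinv c1 x) c2)"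
    proof (cases "q \<in> fst c")
      case True
      let ?U = "snd c1 ` (fst c1 \<inter> (fst c2 \<inter> fst c))"
      let ?\<tau> = "snd c \<circ> cinv c1"
      have U: "open ?U" by (intro chart_image_open c1 openin_Int chart_openin c2 c)
      have \<tau>: "Ck_on k ?U ?\<tau>" for k
        by (rule Ck_on_subset[OF transition_Ck[OF c1 c]]) auto
      have \<tau>U: "?\<tau> ` ?U \<subseteq> snd c ` (fst c \<inter> fst c2)" using cinv_left[OF c1] by auto
      have "Ck_on k ?U (\<lambda>x. \<phi> (?\<tau> x) *\<^sub>R \<D> (snd c2 \<circ> cinv c) (?\<tau> x) u)"
      proof (rule Ck_on_scaleR[OF U])
        show "Ck_on k ?U (\<lambda>x. \<phi> (?\<tau> x))" by (rule Ck_on_compose[OF U open_UNIV \<tau> \<phi>(1)]) simp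
        have "Ck_on k (snd c ` (fst c \<inter> fst c2)) (\<lambda>y. \<D> (snd c2 \<circ> cinv c) y u)"
          using transition_Ck[OF c c2, of "Suc k"] by simp
        then show "Ck_on k ?U (\<lambda>x. \<D> (snd c2 \<circ> cinv c) (?\<tau> x) u)"
          by (rule Ck_on_compose[OF U overlap_open[OF c c2] \<tau> _ \<tau>U])
      qed
      moreover have "\<phi> (?\<tau> y) *\<^sub>R \<D> (snd c2 \<circ> cinv c) (?\<tau> y) u = bump_field c \<phi> u (cinv c1 y) c2"
        if y: "y \<in> ?U" for y
      proof -
        obtain p where p: "p \<in> fst c1" "p \<in> fst c2" "p \<in> fst c" "y = snd c1 p" using y by blast
        then have ch: "c \<in> charts_at M p" "c2 \<in> charts_at M p" using c c2 by (auto simp: charts_at_iff)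
        show ?thesis
          using p linear_cmul[OF dtrans_linear[OF ch]]
          by (simp add: cinv_left[OF c1] bump_field_def mk_tvec_apply_chart[OF ch])
      qed
      ultimately have "Ck_on k ?U (\<lambda>x. bump_field c \<phi> u (cinv c1 x) c2)"
        by (rule Ck_on_cong[OF U, rotated])
      moreover have "x \<in> ?U" using q True by simp
      ultimately show ?thesis using U by (intro exI[of _ ?U] conjI)
    next
      case False
      have "K \<subseteq> fst c" unfolding K_def by (intro image_subsetI cinv_mem subsetD[OF ball])
      then have qK: "q \<notin> K" using False by blast
      have qM: "q \<in> points M" using q c1 points_charts by blast
      let ?U = "snd c1 ` (fst c1 \<inter> (points M - K))"
      have U: "open ?U" by (intro chart_image_open c1 openin_diff openin_topspace closedK)
      have "0 = bump_field c \<phi> u (cinv c1 y) c2" if "y \<in> ?U" for y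
        using that zero cinv_left[OF c1] by auto
      then have "Ck_on k ?U (\<lambda>x. bump_field c \<phi> u (cinv c1 x) c2)"
        by (rule Ck_on_cong[OF U _ Ck_on_const])
      moreover have "x \<in> ?U" using q qK qM by simp
      ultimately show ?thesis using U by (intro exI[of _ ?U] conjI)
    qed
  qed
  show "smooth_on (snd c1 ` (fst c1 \<inter> id -` fst c2)) (\<lambda>x. bump_field c \<phi> u (cinv c1 x) c2)"
    unfolding vimage_id id_apply smooth_on_open_iff[OF overlap_open[OF c1 c2]] using C by blast
qed

end

section \<open>The inclusion of the hypersurface in charts\<close>

locale riemannian_hypersurface = M: manifold_charts M + N: riemannian_manifold N h
  for M :: "('a, 'f::euclidean_space) manifold" and N :: "('a, 'e::euclidean_space) manifold" and h +
  assumes hyp: "hypersurface M N"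
begin

lemma mixed_overlap_open: "c \<in> atlas M \<Longrightarrow> d \<in> atlas N \<Longrightarrow> open (snd c ` (fst c \<inter> fst d))"
proof -
  assume c: "c \<in> atlas M" and d: "d \<in> atlas N"
  have "continuous_map (mtop M) (mtop N) id" using hyp by (simp add: hypersurface_def smooth_map_def)
  then have "openin (mtop M) {p \<in> points M. id p \<in> fst d}"
    using N.chart_openin[OF d] by (rule openin_continuous_map_preimage)
  from M.chart_image_open[OF c this] have "open (snd c ` (fst c \<inter> {p \<in> points M. p \<in> fst d}))" by simp
  moreover have "fst c \<inter> {p \<in> points M. p \<in> fst d} = fst c \<inter> fst d" using c M.points_charts by auto
  ultimately show ?thesis by simp
qed

lemma inclusion_Ck:
  assumes c: "c \<in> atlas M" and d: "d \<in> atlas N"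
  shows "Ck_on k (snd c ` (fst c \<inter> fst d)) (snd d \<circ> cinv c)"
proof -
  have "smooth_on (snd c ` (fst c \<inter> id -` fst d)) (snd d \<circ> id \<circ> cinv c)"
    using hyp c d unfolding hypersurface_def smooth_map_def by blast
  then have "smooth_on (snd c ` (fst c \<inter> fst d)) (snd d \<circ> cinv c)" by simp
  then show ?thesis using smooth_on_open_iff[OF mixed_overlap_open[OF c d]] by blast
qed

abbreviation dincl :: "('a, 'f) chart \<Rightarrow> ('a, 'e) chart \<Rightarrow> 'a \<Rightarrow> 'f \<Rightarrow> 'e" where
  "dincl c d q \<equiv> \<D> (snd d \<circ> cinv c) (snd c q)"

lemma inclusion_has_derivative:
  assumes c: "c \<in> charts_at M q" and d: "d \<in> charts_at N q"
  shows "((snd d \<circ> cinv c) has_derivative dincl c d q) (at (snd c q))"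
proof -
  have "c \<in> atlas M" "d \<in> atlas N" "snd c q \<in> snd c ` (fst c \<inter> fst d)"
    using c d by (auto simp: M.charts_at_iff N.charts_at_iff)
  then show ?thesis using Ck_on_has_derivative[OF inclusion_Ck] by blast
qed

lemma pushforward_chart:
  assumes c: "c \<in> charts_at M q" and d: "d \<in> charts_at N q" and v: "v \<in> tangent_space M q"
  shows "pushforward M N id q v = mk_tvec N d q (dincl c d q (v c))"
proof (rule ext)
  have ca: "c \<in> atlas M" "q \<in> fst c" and da: "d \<in> atlas N" "q \<in> fst d"
    using c d by (auto simp: M.charts_at_iff N.charts_at_iff)
  have qc: "cinv c (snd c q) = q" using ca by (simp add: M.cinv_left)
  fix d'
  show "pushforward M N id q v d' = mk_tvec N d q (dincl c d q (v c)) d'"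
  proof (cases "d' \<in> charts_at N q")
    case True
    have "((snd d' \<circ> cinv d) has_derivative N.dtrans d d' q) (at ((snd d \<circ> cinv c) (snd c q)))"
      using N.transition_has_derivative[OF d True] qc by simp
    from has_derivative_compose[OF inclusion_has_derivative[OF c d] this]
    have "((\<lambda>y. (snd d' \<circ> cinv d) ((snd d \<circ> cinv c) y)) has_derivative (\<lambda>w. N.dtrans d d' q (dincl c d q w))) (at (snd c q))" .
    then have "((snd d' \<circ> id \<circ> cinv c) has_derivative (\<lambda>w. N.dtrans d d' q (dincl c d q w))) (at (snd c q))"
    proof (rule has_derivative_transform_within_open[OF _ mixed_overlap_open[OF ca(1) da(1)]])
      show "snd c q \<in> snd c ` (fst c \<inter> fst d)" using ca da by blast
      show "(snd d' \<circ> cinv d) ((snd d \<circ> cinv c) y) = (snd d' \<circ> id \<circ> cinv c) y" if "y \<in> snd c ` (fst c \<inter> fst d)" for y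
        using that ca da by (auto simp: M.cinv_left N.cinv_left)
    qed
    then have "vderiv M q v (snd d' \<circ> id) = N.dtrans d d' q (dincl c d q (v c))"
      by (rule M.vderiv_chart[OF v c])
    then show ?thesis using True N.mk_tvec_apply_chart[OF d True] by (simp add: pushforward_def)
  next
    case False
    then show ?thesis by (simp add: pushforward_def mk_tvec_def)
  qed
qed

text \<open>Since \<open>pushforward\<close> only reads a vector in one chart, this holds for any family \<open>v\<close>, so that the tangency
  of the induced covariant derivative is never needed.\<close>

lemma pushforward_in_range:
  assumes c: "c \<in> charts_at M q" and d: "d \<in> charts_at N q"
  shows "\<exists>z. pushforward M N id q v d = dincl c d q z"
proof -
  have "q \<in> points M" using c M.points_charts by (auto simp: M.charts_at_iff)
  then have c': "chart_at M q \<in> charts_at M q" by (rule M.chart_at_charts_at)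
  have "((snd d \<circ> id \<circ> cinv c) has_derivative dincl c d q) (at (snd c q))"
    using inclusion_has_derivative[OF c d] by simp
  from frechet_derivative_eqI[OF M.change_chart_has_derivative[OF c c' this]]
  have "vderiv M q v (snd d \<circ> id) = dincl c d q (M.dtrans (chart_at M q) c q (v (chart_at M q)))"
    unfolding vderiv_def Let_def by simp
  then show ?thesis using d by (auto simp: pushforward_def)
qed

lemma inclusion_immersion:
  assumes c: "c \<in> charts_at M q" and d: "d \<in> charts_at N q"
  shows "inj (dincl c d q)"
proof (rule injI)
  fix v w assume eq: "dincl c d q v = dincl c d q w"
  have "q \<in> points M" using c M.points_charts by (auto simp: M.charts_at_iff)
  then have inj: "inj_on (pushforward M N id q) (tangent_space M q)"
    using hyp by (simp add: hypersurface_def)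
  have t: "mk_tvec M c q u \<in> tangent_space M q" for u by (rule M.mk_tvec_tangent[OF c])
  have "pushforward M N id q (mk_tvec M c q v) = pushforward M N id q (mk_tvec M c q w)"
    unfolding pushforward_chart[OF c d t] M.mk_tvec_apply[OF c] eq ..
  then have "mk_tvec M c q v = mk_tvec M c q w" using inj_onD[OF inj] t by blast
  then show "v = w" using M.mk_tvec_apply[OF c] by metis
qed

text \<open>The fields \<open>X\<close>, \<open>Y\<close> need not be constant in the chart near \<open>q\<close>: the derivative of the bump function
  only contributes a tangential term.\<close>

lemma umbilical_in_charts:
  assumes c: "c \<in> charts_at M q" and d: "d \<in> charts_at N q"
    and II: "\<And>X Y. smooth_field M X \<Longrightarrow> smooth_field M Y \<Longrightarrow>
      second_fundamental_form M N h X Y q = (\<lambda>d. (l * induced_metric M N h q (X q) (Y q)) *\<^sub>R \<nu> q d)"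
  shows "\<exists>z. \<D> (\<lambda>y. \<D> (snd d \<circ> cinv c) y w) (snd c q) u
      + christoffel N h d (snd d q) (dincl c d q u) (dincl c d q w) - dincl c d q z =
      (l * local_metric N h d (snd d q) (dincl c d q u) (dincl c d q w)) *\<^sub>R \<nu> q d"
proof -
  have ca: "c \<in> atlas M" "q \<in> fst c" and da: "d \<in> atlas N" "q \<in> fst d"
    using c d by (auto simp: M.charts_at_iff N.charts_at_iff)
  interpret A: local_riemann "snd d ` fst d" "local_metric N h d" by (rule N.chart_riemann[OF da(1)])
  let ?x = "snd c q" and ?f = "snd d \<circ> cinv c" and ?O = "snd c ` (fst c \<inter> fst d)"
  have xO: "?x \<in> ?O" using ca da by blast
  have O: "open ?O" by (rule mixed_overlap_open[OF ca(1) da(1)])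
  obtain r where r: "r > 0" "cball ?x r \<subseteq> snd c ` fst c"
    using M.chart_open[OF ca(1)] ca open_contains_cball by blast
  obtain \<phi> :: "'f \<Rightarrow> real" where \<phi>: "\<And>k. Ck_on k UNIV \<phi>" "\<And>x. \<phi> x > 0 \<longleftrightarrow> dist ?x x < r" "\<And>x. dist ?x x \<ge> r \<Longrightarrow> \<phi> x = 0"
    using bump_function_exists[OF r(1), of ?x] by blast
  \<comment> \<open>\<open>X\<close> and \<open>Y\<close> have the coordinates
    \<open>s *\<^sub>R u\<close> and \<open>s *\<^sub>R w\<close> at \<open>q\<close>; the positive
    factor is divided out at the end.\<close>
  define s where "s = \<phi> ?x"
  have s: "s > 0" using \<phi>(2) r by (simp add: s_def)
  define X where "X = M.bump_field c \<phi> u"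
  define Y where "Y = M.bump_field c \<phi> w"
  have sm: "smooth_field M X" "smooth_field M Y"
    unfolding X_def Y_def by (rule M.bump_field_smooth[OF ca(1) \<phi>(1,3) r(2)]; assumption)+
  have ch: "c \<in> charts_at M p" "d \<in> charts_at N p" if "p \<in> fst c \<inter> fst d" for p
    using that ca da by (auto simp: M.charts_at_iff N.charts_at_iff)
  have bt: "M.bump_field c \<phi> a p \<in> tangent_space M p" "M.bump_field c \<phi> a p c = \<phi> (snd c p) *\<^sub>R a" if "p \<in> fst c \<inter> fst d" for p a
    using that M.mk_tvec_tangent[OF ch(1)[OF that]] M.mk_tvec_apply[OF ch(1)[OF that]]
    by (simp_all add: M.bump_field_def)
  have q: "q \<in> fst c \<inter> fst d" using ca da by blast
  have Df_lin: "linear (dincl c d p)" if "p \<in> fst c \<inter> fst d" for p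
    using inclusion_has_derivative[OF ch[OF that]] has_derivative_linear by blast
  have push: "pushforward M N id p (M.bump_field c \<phi> a p) = mk_tvec N d p (\<phi> (snd c p) *\<^sub>R dincl c d p a)" if "p \<in> fst c \<inter> fst d" for p a
    unfolding pushforward_chart[OF ch[OF that] bt(1)[OF that]] bt(2)[OF that] linear_cmul[OF Df_lin[OF that]] ..
  have pushd: "pushforward M N id p (M.bump_field c \<phi> a p) d = \<phi> (snd c p) *\<^sub>R dincl c d p a" if "p \<in> fst c \<inter> fst d" for p a
    unfolding push[OF that] by (rule N.mk_tvec_apply[OF ch(2)[OF that]])
  let ?D = "\<lambda>y. \<D> ?f y"
  let ?H = "\<lambda>u w. \<D> (\<lambda>y. ?D y w) ?x u"
  let ?d\<phi> = "\<D> \<phi> ?x"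
  have d\<phi>: "(\<phi> has_derivative ?d\<phi>) (at ?x)" using Ck_on_has_derivative[OF \<phi>(1)] by blast
  have "Ck_on (Suc 0) ?O (\<lambda>y. ?D y w)" using inclusion_Ck[OF ca(1) da(1), of "Suc (Suc 0)"] by simp
  from Ck_on_has_derivative[OF this xO] have dD: "((\<lambda>y. ?D y w) has_derivative (\<lambda>u. ?H u w)) (at ?x)" .
  have "((\<lambda>y. \<phi> y *\<^sub>R ?D y w) has_derivative (\<lambda>v. s *\<^sub>R ?H v w + ?d\<phi> v *\<^sub>R dincl c d q w)) (at ?x)"
    using has_derivative_scaleR[OF d\<phi> dD] by (simp add: s_def)
  then have "(((\<lambda>p. pushforward M N id p (Y p) d) \<circ> cinv c) has_derivative (\<lambda>v. s *\<^sub>R ?H v w + ?d\<phi> v *\<^sub>R dincl c d q w)) (at ?x)"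
  proof (rule has_derivative_transform_within_open[OF _ O xO])
    fix y assume "y \<in> ?O"
    then obtain p where p: "p \<in> fst c \<inter> fst d" "y = snd c p" by blast
    then have "cinv c y = p" using ca M.cinv_left by simp
    then show "\<phi> y *\<^sub>R ?D y w = ((\<lambda>p. pushforward M N id p (Y p) d) \<circ> cinv c) y"
      using pushd[OF p(1), of w] p(2) by (simp add: Y_def)
  qed
  from M.vderiv_chart[OF bt(1)[OF q] c this]
  have vd: "vderiv M q (X q) (\<lambda>p. pushforward M N id p (Y p) d) = (s * s) *\<^sub>R ?H u w + (s * ?d\<phi> u) *\<^sub>R dincl c d q w"
    unfolding X_def bt(2)[OF q] s_def[symmetric]
    using linear_cmul[OF has_derivative_linear[OF dD]] linear_cmul[OF has_derivative_linear[OF d\<phi>]] by simp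
  have cov: "cov_deriv_along M N h id (\<lambda>p. pushforward M N id p (Y p)) q (X q) d =
     (s * s) *\<^sub>R ?H u w + (s * ?d\<phi> u) *\<^sub>R dincl c d q w +
     (s * s) *\<^sub>R christoffel N h d (snd d q) (dincl c d q u) (dincl c d q w)"
  proof -
    have b: "bilinear (christoffel N h d (snd d q))"
      unfolding christoffel_eq using A.levi_bilinear da by simp
    show ?thesis
      unfolding cov_deriv_along_def using d vd pushd[OF q]
      by (simp add: X_def Y_def s_def bilinear_lmul[OF b] bilinear_rmul[OF b])
  qed
  obtain z where z: "pushforward M N id q (levi_civita M (induced_metric M N h) X Y q) d = dincl c d q z"
    using pushforward_in_range[OF c d] by blast
  have ind: "induced_metric M N h q (X q) (Y q) = s * s * local_metric N h d (snd d q) (dincl c d q u) (dincl c d q w)"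
  proof -
    have b: "bilinear (local_metric N h d (snd d q))" using A.bil da by simp
    have "induced_metric M N h q (X q) (Y q) = local_metric N h d (snd d q) (s *\<^sub>R dincl c d q u) (s *\<^sub>R dincl c d q w)"
      unfolding induced_metric_def X_def Y_def push[OF q] N.local_metric_at[OF d] s_def ..
    then show ?thesis by (simp add: bilinear_lmul[OF b] bilinear_rmul[OF b])
  qed
  let ?C = "christoffel N h d (snd d q) (dincl c d q u) (dincl c d q w)"
  let ?g = "local_metric N h d (snd d q) (dincl c d q u) (dincl c d q w)"
  have main: "(s * s) *\<^sub>R ?H u w + (s * ?d\<phi> u) *\<^sub>R dincl c d q w + (s * s) *\<^sub>R ?C - dincl c d q z = (l * (s * s * ?g)) *\<^sub>R \<nu> q d"
    using fun_cong[OF II[OF sm], of d] unfolding second_fundamental_form_def cov z ind .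
  \<comment> \<open>Dividing by \<open>s * s\<close> and moving the derivative of the bump function
    into the tangential vector gives the witness for \<open>z\<close>.\<close>
  have "?H u w + ?C - dincl c d q ((1 / (s * s)) *\<^sub>R (z - (s * ?d\<phi> u) *\<^sub>R w)) =
      (1 / (s * s)) *\<^sub>R ((s * s) *\<^sub>R ?H u w + (s * ?d\<phi> u) *\<^sub>R dincl c d q w + (s * s) *\<^sub>R ?C - dincl c d q z)"
    using s Df_lin[OF q] by (simp add: linear_cmul linear_diff scaleR_add_right scaleR_diff_right)
  also have "\<dots> = (l * ?g) *\<^sub>R \<nu> q d" unfolding main using s by simp
  finally show ?thesis by blast
qed

text \<open>In a pair of charts the inclusion meets the assumptions of
  \<open>umbilical_hypersurface\<close>. The outcome is the Codazzi equation, one side of which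
  vanishes because the shape operator is a constant multiple of the identity.\<close>

theorem codazzi_umbilical:
  assumes \<nu>: "unit_normal_field M N h \<nu>" and p: "p \<in> points M" and d: "d \<in> charts_at N p"
    and II: "\<And>X Y q. smooth_field M X \<Longrightarrow> smooth_field M Y \<Longrightarrow> q \<in> points M \<Longrightarrow>
      second_fundamental_form M N h X Y q = (\<lambda>d. (l * induced_metric M N h q (X q) (Y q)) *\<^sub>R \<nu> q d)"
  shows "local_metric N h d (snd d p) (\<nu> p d) (\<nu> p d) = 1"
    and "\<And>X Y. local_metric N h d (snd d p) X (\<nu> p d) = 0 \<Longrightarrow> local_metric N h d (snd d p) Y (\<nu> p d) = 0 \<Longrightarrow>
      curvature N h d (snd d p) X Y (\<nu> p d) = 0"
proof -
  define c where "c = chart_at M p"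
  have c: "c \<in> charts_at M p" unfolding c_def by (rule M.chart_at_charts_at[OF p])
  have ca: "c \<in> atlas M" "p \<in> fst c" and da: "d \<in> atlas N" "p \<in> fst d"
    using c d by (auto simp: M.charts_at_iff N.charts_at_iff)
  let ?f = "snd d \<circ> cinv c" and ?n = "\<lambda>x. \<nu> (cinv c x) d" and ?O = "snd c ` (fst c \<inter> fst d)"
  have ch: "c \<in> charts_at M q" "d \<in> charts_at N q" "q \<in> points M" "cinv c (snd c q) = q" if "q \<in> fst c \<inter> fst d" for q
    using that ca da M.points_charts by (auto simp: M.charts_at_iff N.charts_at_iff M.cinv_left)
  have \<nu>t: "\<nu> q \<in> tangent_space N q" if "q \<in> points M" for q
    using \<nu> that by (simp add: unit_normal_field_def smooth_field_along_def)
  have O: "open ?O" by (rule mixed_overlap_open[OF ca(1) da(1)])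
  have "smooth_on (snd c ` (fst c \<inter> id -` fst d)) ?n"
    using \<nu> ca da unfolding unit_normal_field_def smooth_field_along_def by blast
  then have smn: "smooth_on ?O ?n" by simp
  have unit: "local_metric N h d (snd d q) (\<nu> q d) (\<nu> q d) = 1" if "q \<in> fst c \<inter> fst d" for q
    unfolding N.local_metric_tangent[OF ch(2)[OF that] \<nu>t[OF ch(3)[OF that]] \<nu>t[OF ch(3)[OF that]]]
    using \<nu> ch(3)[OF that] by (simp add: unit_normal_field_def)
  interpret A: local_riemann "snd d ` fst d" "local_metric N h d" by (rule N.chart_riemann[OF da(1)])
  interpret U: umbilical_hypersurface "snd d ` fst d" "local_metric N h d" ?O ?f ?n l
  proof unfold_locales
    show "open ?O" by (rule O)
    show "DIM('f) + 1 = DIM('e)" using hyp by (simp add: hypersurface_def)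
    show "Ck_on k ?O ?f" for k by (rule inclusion_Ck[OF ca(1) da(1)])
    show "Ck_on k ?O ?n" for k using smn smooth_on_open_iff[OF O] by blast
    fix x assume "x \<in> ?O"
    then obtain q where q: "q \<in> fst c \<inter> fst d" and x: "x = snd c q" by blast
    note chq = ch[OF q]
    have fx: "?f x = snd d q" and nx: "?n x = \<nu> q d" unfolding x using chq by simp_all
    show "?f x \<in> snd d ` fst d" unfolding fx using q by blast
    show "local_metric N h d (?f x) (?n x) (?n x) = 1" unfolding fx nx by (rule unit[OF q])
    show "inj (\<D> ?f x)" unfolding x by (rule inclusion_immersion[OF chq(1,2)])
    show "local_metric N h d (?f x) (\<D> ?f x w) (?n x) = 0" for w
    proof -
      have t: "mk_tvec M c q w \<in> tangent_space M q" by (rule M.mk_tvec_tangent[OF chq(1)])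
      have "h q (pushforward M N id q (mk_tvec M c q w)) (\<nu> q) = 0"
        using \<nu> t chq(3) unfolding unit_normal_field_def by blast
      then have "h q (mk_tvec N d q (dincl c d q w)) (mk_tvec N d q (\<nu> q d)) = 0"
        unfolding pushforward_chart[OF chq(1,2) t] M.mk_tvec_apply[OF chq(1)]
        using N.tangent_eq_mk_tvec[OF \<nu>t[OF chq(3)] chq(2)] by simp
      then show ?thesis unfolding fx nx unfolding N.local_metric_at[OF chq(2)] x .
    qed
    show "\<exists>z. \<D> (\<lambda>y. \<D> ?f y w) x u
      + levi_form (local_metric N h d) (?f x) (\<D> ?f x u) (\<D> ?f x w)
      - \<D> ?f x z =
      (l * local_metric N h d (?f x) (\<D> ?f x u) (\<D> ?f x w)) *\<^sub>R ?n x" for w u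
      unfolding fx nx unfolding x christoffel_eq[symmetric] by (rule umbilical_in_charts[OF chq(1,2)]) (rule II[OF _ _ chq(3)])
  qed
  have pO: "snd c p \<in> ?O" "p \<in> fst c \<inter> fst d" using ca da by blast+
  have fp: "?f (snd c p) = snd d p" and np: "?n (snd c p) = \<nu> p d" using ch[OF pO(2)] by simp_all
  show "local_metric N h d (snd d p) (\<nu> p d) (\<nu> p d) = 1" by (rule unit[OF pO(2)])
  show "curvature N h d (snd d p) X Y (\<nu> p d) = 0"
    if "local_metric N h d (snd d p) X (\<nu> p d) = 0" "local_metric N h d (snd d p) Y (\<nu> p d) = 0" for X Y
    using U.curvature_kills_normal[OF pO(1), of X Y] that unfolding curvature_eq fp np by blast
qed

end

section \<open>The scalar curvature as the trace of a vanishing Ricci form\<close>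

theorem theorem1p1:
  fixes Mbar :: "('a, quat ^ 'm) manifold"
    and gbar :: "('a, quat ^ 'm) metric_tensor"
  assumes "CARD('m) \<ge> 2"
    and "quaternion_kaehler Mbar gbar"
    and "\<forall>p\<in>points Mbar. scalar_curvature Mbar gbar p \<noteq> 0"
  shows "\<not> (\<exists>M :: ('a, 'f::euclidean_space) manifold. extrinsic_hypersphere M Mbar gbar)"
proof
  assume "\<exists>M :: ('a, 'f) manifold. extrinsic_hypersphere M Mbar gbar"
  then obtain M :: "('a, 'f) manifold" and l :: real and \<nu> where hyp: "hypersurface M Mbar"
    and \<nu>: "unit_normal_field M Mbar gbar \<nu>"
    and II: "\<And>X Y q. smooth_field M X \<Longrightarrow> smooth_field M Y \<Longrightarrow> q \<in> points M \<Longrightarrow>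
      second_fundamental_form M Mbar gbar X Y q = (\<lambda>d. (l * induced_metric M Mbar gbar q (X q) (Y q)) *\<^sub>R \<nu> q d)"
    unfolding extrinsic_hypersphere_def by blast
  interpret riemannian_hypersurface M Mbar gbar
    by unfold_locales (use assms(2) hyp in \<open>auto simp: quaternion_kaehler_def hypersurface_def\<close>)
  have "points M \<noteq> {}" using M.mfd unfolding smooth_manifold_def by blast
  then obtain p where p: "p \<in> points M" by blast
  then have pN: "p \<in> points Mbar" using hyp by (auto simp: hypersurface_def)
  define d where "d = chart_at Mbar p"
  have d: "d \<in> charts_at Mbar p" unfolding d_def by (rule N.chart_at_charts_at[OF pN])
  have da: "d \<in> atlas Mbar" "p \<in> fst d" using d by (auto simp: N.charts_at_iff)
  interpret A: local_riemann "snd d ` fst d" "local_metric Mbar gbar d" by (rule N.chart_riemann[OF da(1)])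
  let ?x = "snd d p" and ?G = "local_metric Mbar gbar d (snd d p)" and ?R = "curvature Mbar gbar d (snd d p)"
  have bG: "bilinear ?G" using A.bil da by simp
  obtain F :: "quat ^ 'm \<Rightarrow> quat ^ 'm" where F: "linear F" "inj F" "\<And>y z. ?G (F y) (F z) = y \<bullet> z"
    and QC: "quaternionic_curvature (\<lambda>u v w. inv F (?R (F u) (F v) (F w))) quatI quatJ"
    using quaternion_kaehler_curvature[OF assms(2) d] by blast
  note codazzi = codazzi_umbilical[where l = l and \<nu> = \<nu>, OF \<nu> p d II]
  note inv = isometry_inverse[OF F(1,2)]
  have Ginv: "?G y z = inv F y \<bullet> inv F z" for y z using F(3)[of "inv F y" "inv F z"] inv by simp
  interpret Q: quaternionic_curvature "\<lambda>u v w. inv F (?R (F u) (F v) (F w))" quatI quatJ by (rule QC)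
  define n where "n = inv F (\<nu> p d)"
  have Ric0: "Q.Ric u w = 0" for u w
  proof (rule Q.Ric_eq_0_if_kills_normal)
    \<comment> \<open>The real dimension of the model space is four times the cardinality of
      \<open>'m\<close>.\<close>
    show "DIM(quat ^ 'm) > 4" using assms(1) by simp
    show "n \<bullet> n = 1" using codazzi(1) unfolding Ginv n_def .
    fix X Y assume "X \<bullet> n = 0" "Y \<bullet> n = 0"
    then have "?R (F X) (F Y) (\<nu> p d) = 0"
      by (intro codazzi(2)) (simp_all add: Ginv n_def inv)
    then show "inv F (?R (F X) (F Y) (F n)) = 0" unfolding n_def using inv linear_0[OF inv(1)] by simp
  qed
  let ?P = "\<lambda>e. \<forall>i\<in>Basis. \<forall>j\<in>Basis. ?G (e i) (e j) = (if i = j then 1 else 0)"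
  define e where "e = (SOME e :: quat ^ 'm \<Rightarrow> quat ^ 'm. ?P e)"
  \<comment> \<open>\<open>F\<close> witnesses that orthonormal families exist, so the one chosen in
    \<open>scalar_curvature\<close> is orthonormal.\<close>
  have "?P F" by (simp add: F(3) inner_Basis)
  then have e: "?P e" unfolding e_def by (rule someI[of ?P F])
  \<comment> \<open>The orthogonal map of the model space that takes the standard basis to the
    preimages of the chosen family under \<open>F\<close>. Through \<open>Ric_orth_map\<close> it
    turns the double trace into a sum of Ricci values.\<close>
  define E where "E x = (\<Sum>i\<in>Basis. (x \<bullet> i) *\<^sub>R inv F (e i))" for x
  have Eb: "F (E i) = e i" if "i \<in> Basis" for i
  proof -
    have "E i = inv F (e i)"
      using that by (simp add: E_def inner_Basis if_distrib[of "\<lambda>x. x *\<^sub>R _"] cong: if_cong)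
    then show ?thesis by (simp add: inv)
  qed
  have "orth_map E"
    unfolding orth_map_def
  proof (intro conjI allI)
    show "linear E" unfolding E_def by (intro linearI) (simp_all add: inner_add_left scaleR_add_left sum.distrib scaleR_sum_right)
    have ee: "inv F (e i) \<bullet> inv F (e j) = (if i = j then 1 else 0)" if "i \<in> Basis" "j \<in> Basis" for i j
      using e that unfolding Ginv by blast
    show "E x \<bullet> E y = x \<bullet> y" for x y
    proof -
      have "E x \<bullet> E y = (\<Sum>i\<in>Basis. \<Sum>j\<in>Basis. (x \<bullet> i) * ((y \<bullet> j) * (inv F (e i) \<bullet> inv F (e j))))"
        unfolding E_def inner_sum_left unfolding inner_sum_right by (intro sum.cong refl) simp
      also have "\<dots> = (\<Sum>i\<in>Basis. (x \<bullet> i) * (y \<bullet> i))"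
        by (intro sum.cong refl) (simp add: ee if_distrib[of "\<lambda>z. _ * z"] cong: if_cong)
      finally show ?thesis by (simp add: euclidean_inner[of x y])
    qed
  qed
  from Q.Ric_orth_map[OF this]
  have z: "(\<Sum>j\<in>Basis. inv F (?R (F (E i)) (F (E j)) (F (E j))) \<bullet> E i) = 0" for i unfolding Ric0 .
  have "(\<Sum>j\<in>Basis. inv F (?R (e i) (e j) (e j)) \<bullet> E i) = 0" if "i \<in> Basis" for i
    using z[of i] that by (simp add: Eb)
  then have "(\<Sum>i\<in>Basis. \<Sum>j\<in>Basis. inv F (?R (e i) (e j) (e j)) \<bullet> E i) = 0" by simp
  moreover have "?G y (e i) = inv F y \<bullet> E i" if "i \<in> Basis" for i y
    unfolding Ginv Eb[OF that, symmetric] inv ..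
  ultimately have "(\<Sum>i\<in>Basis. \<Sum>j\<in>Basis. ?G (?R (e i) (e j) (e j)) (e i)) = 0" by simp
  then have "scalar_curvature Mbar gbar p = 0"
    unfolding scalar_curvature_def Let_def d_def[symmetric] e_def[symmetric] .
  then show False using assms(3) pN by blast
qed

end
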